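(* Let $p\in\mathbb C$, $p\neq0$, and $\Delta,\Lambda,\alpha,\beta\in\mathbb C$. (1) If $p\neq-1$, the $\mathfrak K(p)$-module $V_{\Delta,\Lambda,\alpha}$ is simple if and only if $2\Delta+\Lambda\neq0$ and $2\Delta-\Lambda\ne0$. Furthermore: (i) $V_{\Delta,-2\Delta,\alpha}$ contains a submodule isomorphic to $\widetilde{V^{(1)}_{\Delta+\frac12,\alpha}}$, and the quotient is (isomorphic to) $V^{(1)}_{\Delta,\alpha}$; (ii) $V_{\Delta,2\Delta,\alpha}$ contains a submodule isomorphic to $\widetilde{V^{(2)}_{\Delta+\frac12,\alpha}}$, and the quotient is $V^{(2)}_{\Delta,\alpha}$. (2) If $p=-1$, the $\mathfrak K(-1)$-module $V_{\Delta,\Lambda,\alpha,\beta}$ is simple if and only if $(2\Delta+\Lambda,\beta)\neq(0,0)$ and $(2\Delta-\Lambda,\beta)\neq(0,0)$. Furthermore: (i) $V_{\Delta,-2\Delta,\alpha,0}$ contains a submodule isomorphic to $\widetilde{V^{(1)}_{\Delta+\frac12,\alpha}}$, and the quotient is $V^{(1)}_{\Delta,\alpha}$; (ii) $V_{\Delta,2\Delta,\alpha,0}$ contains a submodule isomorphic to $\widetilde{V^{(2)}_{\Delta+\frac12,\alpha}}$, and the quotient is $V^{(2)}_{\Delta,\alpha}$. In addition, the same holds with the parity of all the modules reversed, that is: if $p\neq-1$, then $\widetilde{V_{\Delta,\Lambda,\alpha}}$ is simple if and only if $2\Delta+\Lambda\neq0$ and $2\Delta-\Lambda\neq0$, $\widetilde{V_{\Delta,-2\Delta,\alpha}}$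 contains a submodule isomorphic to $V^{(1)}_{\Delta+\frac12,\alpha}$ with quotient $\widetilde{V^{(1)}_{\Delta,\alpha}}$, and $\widetilde{V_{\Delta,2\Delta,\alpha}}$ contains a submodule isomorphic to $V^{(2)}_{\Delta+\frac12,\alpha}$ with quotient $\widetilde{V^{(2)}_{\Delta,\alpha}}$; if $p=-1$, then $\widetilde{V_{\Delta,\Lambda,\alpha,\beta}}$ is simple if and only if $(2\Delta+\Lambda,\beta)\neq(0,0)$ and $(2\Delta-\Lambda,\beta)\neq(0,0)$, $\widetilde{V_{\Delta,-2\Delta,\alpha,0}}$ contains a submodule isomorphic to $V^{(1)}_{\Delta+\frac12,\alpha}$ with quotient $\widetilde{V^{(1)}_{\Delta,\alpha}}$, and $\widetilde{V_{\Delta,2\Delta,\alpha,0}}$ contains a submodule isomorphic to $V^{(2)}_{\Delta+\frac12,\alpha}$ with quotient $\widetilde{V^{(2)}_{\Delta,\alpha}}$. All composition factors of these rank $(2+2)$ modules have multiplicity one. The composition factors of $V_{\Delta,-2\Delta,\alpha}$ (for $p\ne-1$), respectively of $V_{\Delta,-2\Delta,\alpha,0}$ (for $p=-1$), are: $V^{(1)}_{\Delta,\alpha}$, $\widetilde{V^{(1)}_{\Delta+\frac12,\alpha}}$ if $\Delta\neq0,-\frac12$; $\widetilde{V^{(1)}_{\frac12,\alpha}}$, $\widetilde{V^{(2)}_{\frac12,\alpha}}$, $\mathbb Cc_{-\alpha}$ if $\Delta=0$; $V^{(1)}_{-\frac12,\alpha}$, $V^{(2)}_{\frac12,\alpha}$,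 $\widetilde{\mathbb Cc_{-\alpha}}$ if $\Delta=-\frac12$. The composition factors of $V_{\Delta,2\Delta,\alpha}$ (for $p\neq-1$), respectively of $V_{\Delta,2\Delta,\alpha,0}$ (for $p=-1$), are: $V^{(2)}_{\Delta,\alpha}$, $\widetilde{V^{(2)}_{\Delta+\frac12,\alpha}}$ if $\Delta\ne0,-\frac12$; $\widetilde{V^{(1)}_{\frac12,\alpha}}$, $\widetilde{V^{(2)}_{\frac12,\alpha}}$, $\mathbb Cc_{-\alpha}$ if $\Delta=0$; $V^{(1)}_{\frac12,\alpha}$, $V^{(2)}_{-\frac12,\alpha}$, $\widetilde{\mathbb Cc_{-\alpha}}$ if $\Delta=-\frac12$.
   Context: A Lie conformal superalgebra is a $\mathbb Z/2\mathbb Z$-graded $\mathbb C[\partial]$-module $R=R_{\bar0}\oplus R_{\bar1}$ with a (parity-preserving) $\mathbb C$-linear $\lambda$-bracket $R\otimes R\to\mathbb C[\lambda]\otimes R$, $a\otimes b\mapsto[a\,{}_\lambda\, b]$, such that $[\partial a\,{}_\lambda\, b]=-\lambda[a\,{}_\lambda\, b]$, $[a\,{}_\lambda\,\partial b]=(\partial+\lambda)[a\,{}_\lambda\, b]$, $[a\,{}_\lambda\, b]=-(-1)^{|a||b|}[b\,{}_{-\lambda-\partial}\,a]$, $[a\,{}_\lambda[b\,{}_\mu c]]=[[a\,{}_\lambda b]\,{}_{\lambda+\mu}c]+(-1)^{|a||b|}[b\,{}_\mu[a\,{}_\lambda c]]$. A conformal $R$-module is a $\mathbb Z/2\mathbb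 Z$-graded $\mathbb C[\partial]$-module $M=M_{\bar0}\oplus M_{\bar1}$ with a (parity-preserving) $\mathbb C$-linear $\lambda$-action $R\otimes M\to\mathbb C[\lambda]\otimes M$, $a\otimes v\mapsto a\,{}_\lambda v$, such that $(\partial a)\,{}_\lambda v=-\lambda\, a\,{}_\lambda v$, $a\,{}_\lambda(\partial v)=(\partial+\lambda)a\,{}_\lambda v$, $[a\,{}_\lambda b]\,{}_{\lambda+\mu}v=a\,{}_\lambda(b\,{}_\mu v)-(-1)^{|a||b|}b\,{}_\mu(a\,{}_\lambda v)$. $\widetilde M$ denotes the module $M$ with reversed parity. For $\gamma\in\mathbb C$, $\mathbb Cc_\gamma$ is the even one-dimensional trivial module: $|c_\gamma|=\bar0$, $\partial c_\gamma=\gamma c_\gamma$, and $R$ acts as zero. For nonzero $p\in\mathbb C$, $\mathfrak K(p)$ is the Lie conformal superalgebra whose even part has $\mathbb C[\partial]$-basis $\{L_i,J_i\mid i\in\mathbb Z_+\}$ and odd part has $\mathbb C[\partial]$-basis $\{G_i^\pm\mid i\in\mathbb Z_+\}$ ($\mathbb Z_+=\{0,1,2,\dots\}$), with $[L_i\,{}_\lambda L_j]=((i+p)\partial+(i+j+2p)\lambda)L_{i+j}$, $[L_i\,{}_\lambda J_j]=((i+p)\partial+(i+j+p)\lambda)J_{i+j}$, $[L_i\,{}_\lambda G^\pm_j]=((i+p)\partial+(i+j+\frac32p)\lambda)G^\pm_{i+j}$, $[J_i\,{}_\lambda G^\pm_j]=\pm G^\pm_{i+j}$, $[G^+_i\,{}_\lambda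 G^-_j]=((2i+p)\partial+2(i+j+p)\lambda)J_{i+j}+2L_{i+j}$, the other brackets of basis elements being given by skew-symmetry or zero. Fix a square root $\sqrt p$ of $p$ (so $\sqrt p=\sqrt{-1}$ when $p=-1$). The following are conformal $\mathfrak K(p)$-modules, free over $\mathbb C[\partial]$; subscripts $\bar0,\bar1$ of basis vectors denote parity; $\Delta,\Lambda,\alpha,\beta\in\mathbb C$. $V^{(1)}_{\Delta,\alpha}=\mathbb C[\partial]v_{\bar0}\oplus\mathbb C[\partial]v_{\bar1}$: $L_0\,{}_\lambda v_{\bar0}=p(\partial+\Delta\lambda+\alpha)v_{\bar0}$, $L_0\,{}_\lambda v_{\bar1}=p(\partial+(\Delta+\frac12)\lambda+\alpha)v_{\bar1}$, $J_0\,{}_\lambda v_{\bar0}=-2\Delta v_{\bar0}$, $J_0\,{}_\lambda v_{\bar1}=(1-2\Delta)v_{\bar1}$, $G_0^+\,{}_\lambda v_{\bar0}=\sqrt p\,v_{\bar1}$, $G_0^+\,{}_\lambda v_{\bar1}=0$, $G_0^-\,{}_\lambda v_{\bar0}=0$, $G_0^-\,{}_\lambda v_{\bar1}=2\sqrt p(\partial+2\Delta\lambda+\alpha)v_{\bar0}$; $L_i,J_i,G_i^\pm$ act as zero for $i\ge1$. $V^{(2)}_{\Delta,\alpha}=\mathbb C[\partial]v_{\bar0}\oplus\mathbb C[\partial]v_{\bar1}$: $L_0\,{}_\lambda v_{\bar0}=p(\partial+\Delta\lambda+\alpha)v_{\bar0}$, $L_0\,{}_\lambda v_{\bar1}=p(\partial+(\Delta+\frac12)\lambda+\alpha)v_{\bar1}$,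 $J_0\,{}_\lambda v_{\bar0}=2\Delta v_{\bar0}$, $J_0\,{}_\lambda v_{\bar1}=(2\Delta-1)v_{\bar1}$, $G_0^+\,{}_\lambda v_{\bar0}=0$, $G_0^+\,{}_\lambda v_{\bar1}=2\sqrt p(\partial+2\Delta\lambda+\alpha)v_{\bar0}$, $G_0^-\,{}_\lambda v_{\bar0}=\sqrt p\,v_{\bar1}$, $G_0^-\,{}_\lambda v_{\bar1}=0$; $L_i,J_i,G_i^\pm$ act as zero for $i\ge1$. $V_{\Delta,\Lambda,\alpha}=\mathbb C[\partial]v_{\bar0}^{(1)}\oplus\mathbb C[\partial]v_{\bar0}^{(2)}\oplus\mathbb C[\partial]v_{\bar1}^{(1)}\oplus\mathbb C[\partial]v_{\bar1}^{(2)}$: $L_0\,{}_\lambda v_{\bar0}^{(1)}=p(\partial+\Delta\lambda+\alpha)v_{\bar0}^{(1)}$, $L_0\,{}_\lambda v_{\bar0}^{(2)}=p(\partial+(\Delta+1)\lambda+\alpha)v_{\bar0}^{(2)}+p(\Delta+\frac\Lambda2)\lambda^2v_{\bar0}^{(1)}$, $L_0\,{}_\lambda v_{\bar1}^{(\ell)}=p(\partial+(\Delta+\frac12)\lambda+\alpha)v_{\bar1}^{(\ell)}$ ($\ell=1,2$); $J_0\,{}_\lambda v_{\bar0}^{(1)}=\Lambda v_{\bar0}^{(1)}$, $J_0\,{}_\lambda v_{\bar0}^{(2)}=\Lambda v_{\bar0}^{(2)}+(2\Delta+\Lambda)\lambda v_{\bar0}^{(1)}$, $J_0\,{}_\lambda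 v_{\bar1}^{(1)}=(\Lambda+1)v_{\bar1}^{(1)}$, $J_0\,{}_\lambda v_{\bar1}^{(2)}=(\Lambda-1)v_{\bar1}^{(2)}$; $G_0^+\,{}_\lambda v_{\bar0}^{(1)}=\sqrt p\,v_{\bar1}^{(1)}$, $G_0^+\,{}_\lambda v_{\bar1}^{(1)}=0$, $G_0^+\,{}_\lambda v_{\bar0}^{(2)}=-\sqrt p(2\Delta+\Lambda)\lambda v_{\bar1}^{(1)}$, $G_0^+\,{}_\lambda v_{\bar1}^{(2)}=\sqrt p(2\Delta+\Lambda)\lambda v_{\bar0}^{(1)}+\sqrt p\,v_{\bar0}^{(2)}$; $G_0^-\,{}_\lambda v_{\bar0}^{(1)}=\sqrt p\,v_{\bar1}^{(2)}$, $G_0^-\,{}_\lambda v_{\bar1}^{(1)}=\sqrt p(2\partial+(2\Delta-\Lambda)\lambda+2\alpha)v_{\bar0}^{(1)}-\sqrt p\,v_{\bar0}^{(2)}$, $G_0^-\,{}_\lambda v_{\bar0}^{(2)}=\sqrt p(2\partial+(2\Delta-\Lambda+2)\lambda+2\alpha)v_{\bar1}^{(2)}$, $G_0^-\,{}_\lambda v_{\bar1}^{(2)}=0$; $L_i,J_i,G_i^\pm$ act as zero for $i\ge1$. $V_{\Delta,\Lambda,\alpha,\beta}$ (only for $p=-1$): same underlying $\mathbb C[\partial]$-module and same actions of $L_0,J_0,G_0^\pm$ as $V_{\Delta,\Lambda,\alpha}$ with $p=-1$; $L_1\,{}_\lambda v=-\frac{\sqrt{-1}}2\beta v$ for $v=v_{\bar0}^{(1)},v_{\bar1}^{(1)},v_{\bar1}^{(2)}$,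 $L_1\,{}_\lambda v_{\bar0}^{(2)}=-\frac{\sqrt{-1}}2\beta(v_{\bar0}^{(2)}+\lambda v_{\bar0}^{(1)})$; $J_1\,{}_\lambda v_{\bar0}^{(2)}=\sqrt{-1}\,\beta v_{\bar0}^{(1)}$; $G_1^+\,{}_\lambda v_{\bar0}^{(2)}=\beta v_{\bar1}^{(1)}$, $G_1^+\,{}_\lambda v_{\bar1}^{(2)}=-\beta v_{\bar0}^{(1)}$; $G_1^-\,{}_\lambda v_{\bar1}^{(1)}=-\beta v_{\bar0}^{(1)}$, $G_1^-\,{}_\lambda v_{\bar0}^{(2)}=-\beta v_{\bar1}^{(2)}$; $J_1,G_1^\pm$ act as zero on the remaining basis vectors; $L_i,J_i,G_i^\pm$ act as zero for $i\ge2$. *)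

theory Defs
  imports
    Complex_Main
    "HOL-Algebra.AbelCoset"
    "HOL-Algebra.Module"
    "HOL-Computational_Algebra.Polynomial"
    "HOL-Library.Poly_Mapping"
    "HOL-Library.Z2"
begin

section \<open>Lie conformal superalgebras and conformal modules\<close>

text \<open>The ring of polynomials in the derivation \<open>\<partial>\<close> with complex coefficients. The derivation itself
  is \<open>[:0, 1:]\<close> and the scalar \<open>c\<close> is \<open>[:c:]\<close>.\<close>

definition CD :: "complex poly ring" where
  "CD = \<lparr>carrier = UNIV, monoid.mult = (*), one = 1, zero = 0, add = (+)\<rparr>"

text \<open>The record carries the data of a \<open>\<lambda>\<close>-action of \<open>'r\<close> on a graded \<open>CD\<close>-module with elements
  in \<open>'v\<close>: \<open>grade M s\<close> is the homogeneous component of parity \<open>s\<close>, and \<open>lact M a v n\<close> is the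
  coefficient of \<open>\<lambda>\<^sup>n\<close> in \<open>a\<^sub>\<lambda> v\<close> (plain coefficients, not divided by factorials). A Lie conformal
  superalgebra is given by such a record with \<open>'v = 'r\<close>, \<open>lact R a b\<close> being the \<open>\<lambda>\<close>-bracket. The
  fields \<open>mult\<close> and \<open>one\<close> inherited from rings are irrelevant.\<close>

record ('r, 'v) conf = "(complex poly, 'v) module" +
  grade :: "bit \<Rightarrow> 'v set"
  lact :: "'r \<Rightarrow> 'v \<Rightarrow> nat \<Rightarrow> 'v"

definition ksign :: "bit \<Rightarrow> bit \<Rightarrow> complex" where
  "ksign s t = (if s = 1 \<and> t = 1 then - 1 else 1)"

locale supermodule = Module.module CD M for M :: "('r, 'v) conf" (structure) +
  assumes grade_submodule: "submodule (grade M s) CD M"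
    and grade_sum: "grade M 0 <+>\<^bsub>M\<^esub> grade M 1 = carrier M"
    and grade_int: "grade M 0 \<inter> grade M 1 = {\<zero>\<^bsub>M\<^esub>}"

text \<open>In \<open>jacobi\<close>, both sides are the coefficient of \<open>\<lambda>\<^sup>m \<mu>\<^sup>n\<close> in
  \<open>[a\<^sub>\<lambda> b]\<^bsub>\<lambda>+\<mu>\<^esub> v = a\<^sub>\<lambda> (b\<^sub>\<mu> v) - (-1)\<^bsup>|a||b|\<^esup> b\<^sub>\<mu> (a\<^sub>\<lambda> v)\<close>.\<close>

locale lambda_action = R: supermodule R + M: supermodule M
  for R :: "('r, 'r) conf" and M :: "('r, 'v) conf" +
  assumes lact_closed: "\<lbrakk>a \<in> carrier R; v \<in> carrier M\<rbrakk> \<Longrightarrow> lact M a v n \<in> carrier M"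
    and lact_finite: "\<lbrakk>a \<in> carrier R; v \<in> carrier M\<rbrakk> \<Longrightarrow> finite {n. lact M a v n \<noteq> \<zero>\<^bsub>M\<^esub>}"
    and lact_add_left: "\<lbrakk>a \<in> carrier R; b \<in> carrier R; v \<in> carrier M\<rbrakk>
      \<Longrightarrow> lact M (a \<oplus>\<^bsub>R\<^esub> b) v n = lact M a v n \<oplus>\<^bsub>M\<^esub> lact M b v n"
    and lact_add_right: "\<lbrakk>a \<in> carrier R; v \<in> carrier M; w \<in> carrier M\<rbrakk>
      \<Longrightarrow> lact M a (v \<oplus>\<^bsub>M\<^esub> w) n = lact M a v n \<oplus>\<^bsub>M\<^esub> lact M a w n"
    and lact_scale_left: "\<lbrakk>a \<in> carrier R; v \<in> carrier M\<rbrakk>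
      \<Longrightarrow> lact M ([:c:] \<odot>\<^bsub>R\<^esub> a) v n = [:c:] \<odot>\<^bsub>M\<^esub> lact M a v n"
    and lact_scale_right: "\<lbrakk>a \<in> carrier R; v \<in> carrier M\<rbrakk>
      \<Longrightarrow> lact M a ([:c:] \<odot>\<^bsub>M\<^esub> v) n = [:c:] \<odot>\<^bsub>M\<^esub> lact M a v n"
    and lact_parity: "\<lbrakk>a \<in> grade R s; v \<in> grade M t\<rbrakk> \<Longrightarrow> lact M a v n \<in> grade M (s + t)"
    and sesquilinear_left: "\<lbrakk>a \<in> carrier R; v \<in> carrier M\<rbrakk>
      \<Longrightarrow> lact M ([:0, 1:] \<odot>\<^bsub>R\<^esub> a) v n = (case n of 0 \<Rightarrow> \<zero>\<^bsub>M\<^esub> | Suc k \<Rightarrow> \<ominus>\<^bsub>M\<^esub> lact M a v k)"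
    and sesquilinear_right: "\<lbrakk>a \<in> carrier R; v \<in> carrier M\<rbrakk>
      \<Longrightarrow> lact M a ([:0, 1:] \<odot>\<^bsub>M\<^esub> v) n =
          [:0, 1:] \<odot>\<^bsub>M\<^esub> lact M a v n \<oplus>\<^bsub>M\<^esub> (case n of 0 \<Rightarrow> \<zero>\<^bsub>M\<^esub> | Suc k \<Rightarrow> lact M a v k)"
    and jacobi: "\<lbrakk>a \<in> grade R s; b \<in> grade R t; v \<in> carrier M\<rbrakk>
      \<Longrightarrow> (\<Oplus>\<^bsub>M\<^esub>k\<in>{..m}. [:of_nat ((m - k + n) choose n):] \<odot>\<^bsub>M\<^esub> lact M (lact R a b k) v (m - k + n)) =
          lact M a (lact M b v n) m \<ominus>\<^bsub>M\<^esub> [:ksign s t:] \<odot>\<^bsub>M\<^esub> lact M b (lact M a v m) n"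

text \<open>Acting on itself, \<open>jacobi\<close> is the Jacobi identity of the \<open>\<lambda>\<close>-bracket. In \<open>skew_symmetry\<close>,
  both sides are the coefficient of \<open>\<lambda>\<^sup>n\<close> in
  \<open>[a\<^sub>\<lambda> b] = - (-1)\<^bsup>|a||b|\<^esup> [b\<^bsub>-\<lambda>-\<partial>\<^esub> a]\<close>.\<close>

locale lie_conformal_superalgebra = lambda_action R R for R :: "('r, 'r) conf" +
  assumes skew_symmetry: "\<lbrakk>a \<in> grade R s; b \<in> grade R t\<rbrakk>
      \<Longrightarrow> lact R a b n = \<ominus>\<^bsub>R\<^esub> ([:ksign s t:] \<odot>\<^bsub>R\<^esub>
            (\<Oplus>\<^bsub>R\<^esub>k\<in>{k. n \<le> k \<and> lact R b a k \<noteq> \<zero>\<^bsub>R\<^esub>}.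
               ([:(- 1) ^ k * of_nat (k choose n):] * [:0, 1:] ^ (k - n)) \<odot>\<^bsub>R\<^esub> lact R b a k))"

locale conformal_module = lie_conformal_superalgebra R + lambda_action R M
  for R :: "('r, 'r) conf" and M :: "('r, 'v) conf"


section \<open>Submodules, quotients, composition factors\<close>

text \<open>Submodules are graded and isomorphisms preserve the parity.\<close>

definition conformal_submodule :: "('r, 'r) conf \<Rightarrow> ('r, 'v) conf \<Rightarrow> 'v set \<Rightarrow> bool" where
  "conformal_submodule R M N \<longleftrightarrow>
     conformal_module R M \<and> submodule N CD M \<and>
     (N \<inter> grade M 0) <+>\<^bsub>M\<^esub> (N \<inter> grade M 1) = N \<and>
     (\<forall>a\<in>carrier R. \<forall>v\<in>N. \<forall>n. lact M a v n \<in> N)"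

definition sub_conf :: "('r, 'v) conf \<Rightarrow> 'v set \<Rightarrow> ('r, 'v) conf" where
  "sub_conf M N = M\<lparr>carrier := N, grade := \<lambda>s. N \<inter> grade M s\<rparr>"

definition quot_conf :: "('r, 'v) conf \<Rightarrow> 'v set \<Rightarrow> ('r, 'v set) conf" where
  "quot_conf M N =
     \<lparr>carrier = a_rcosets\<^bsub>M\<^esub> N, monoid.mult = undefined, one = undefined, zero = N, add = set_add M,
      module.smult = (\<lambda>q A. \<Union>v\<in>A. N +>\<^bsub>M\<^esub> (q \<odot>\<^bsub>M\<^esub> v)),
      grade = (\<lambda>s. (\<lambda>v. N +>\<^bsub>M\<^esub> v) ` grade M s),
      lact = (\<lambda>a A n. \<Union>v\<in>A. N +>\<^bsub>M\<^esub> lact M a v n)\<rparr>"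

definition rev_parity :: "('r, 'v) conf \<Rightarrow> ('r, 'v) conf" where
  "rev_parity M = M\<lparr>grade := \<lambda>s. grade M (s + 1)\<rparr>"

definition conf_iso :: "('r, 'r) conf \<Rightarrow> ('r, 'v) conf \<Rightarrow> ('r, 'w) conf \<Rightarrow> bool" where
  "conf_iso R M N \<longleftrightarrow>
     (\<exists>f \<in> iso (add_monoid M) (add_monoid N).
        (\<forall>q. \<forall>v\<in>carrier M. f (q \<odot>\<^bsub>M\<^esub> v) = q \<odot>\<^bsub>N\<^esub> f v) \<and>
        (\<forall>s. f ` grade M s = grade N s) \<and>
        (\<forall>a\<in>carrier R. \<forall>v\<in>carrier M. \<forall>n. f (lact M a v n) = lact N a (f v) n))"

definition simple_module :: "('r, 'r) conf \<Rightarrow> ('r, 'v) conf \<Rightarrow> bool" where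
  "simple_module R M \<longleftrightarrow>
     conformal_module R M \<and> carrier M \<noteq> {\<zero>\<^bsub>M\<^esub>} \<and>
     (\<forall>N. conformal_submodule R M N \<longrightarrow> N = {\<zero>\<^bsub>M\<^esub>} \<or> N = carrier M)"

text \<open>\<open>M\<close> contains a submodule isomorphic to \<open>A\<close> with quotient isomorphic to \<open>B\<close>.\<close>

definition has_sub_quot ::
  "('r, 'r) conf \<Rightarrow> ('r, 'v) conf \<Rightarrow> ('r, 'a) conf \<Rightarrow> ('r, 'b) conf \<Rightarrow> bool" where
  "has_sub_quot R M A B \<longleftrightarrow>
     (\<exists>N. conformal_submodule R M N \<and> conf_iso R (sub_conf M N) A \<and> conf_iso R (quot_conf M N) B)"

definition series_factors :: "('r, 'v) conf \<Rightarrow> 'v set list \<Rightarrow> ('r, 'v set) conf list" where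
  "series_factors M Ns =
     map (\<lambda>i. quot_conf (sub_conf M (Ns ! Suc i)) (Ns ! i)) [0..<length Ns - 1]"

definition composition_series :: "('r, 'r) conf \<Rightarrow> ('r, 'v) conf \<Rightarrow> 'v set list \<Rightarrow> bool" where
  "composition_series R M Ns \<longleftrightarrow>
     Ns \<noteq> [] \<and> hd Ns = {\<zero>\<^bsub>M\<^esub>} \<and> last Ns = carrier M \<and>
     (\<forall>N\<in>set Ns. conformal_submodule R M N) \<and>
     (\<forall>i. Suc i < length Ns \<longrightarrow> Ns ! i \<subseteq> Ns ! Suc i) \<and>
     (\<forall>Q\<in>set (series_factors M Ns). simple_module R Q)"

text \<open>The expected factors may live on different types, so each one is given by its isomorphism class,
  as a predicate. A composition series is required to exist, and the factors of every composition
  series have to be the listed ones up to order.\<close>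

definition composition_factors_are ::
  "('r, 'r) conf \<Rightarrow> ('r, 'v) conf \<Rightarrow> (('r, 'v set) conf \<Rightarrow> bool) list \<Rightarrow> bool" where
  "composition_factors_are R M Fs \<longleftrightarrow>
     (\<exists>Ns. composition_series R M Ns) \<and>
     (\<forall>Ns. composition_series R M Ns \<longrightarrow>
        (\<exists>\<pi>. bij_betw \<pi> {..<length (series_factors M Ns)} {..<length Fs} \<and>
             (\<forall>i<length (series_factors M Ns). (Fs ! \<pi> i) (series_factors M Ns ! i))))"

definition series_multiplicity ::
  "('r, 'r) conf \<Rightarrow> ('r, 'v) conf \<Rightarrow> 'v set list \<Rightarrow> ('r, 'w) conf \<Rightarrow> nat" where
  "series_multiplicity R M Ns S =
     card {i. i < length (series_factors M Ns) \<and> conf_iso R S (series_factors M Ns ! i)}"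

definition multiplicity_one :: "('r, 'r) conf \<Rightarrow> ('r, 'v) conf \<Rightarrow> bool" where
  "multiplicity_one R M \<longleftrightarrow>
     (\<exists>Ns. composition_series R M Ns) \<and>
     (\<forall>Ns. composition_series R M Ns \<longrightarrow>
        (\<forall>S\<in>set (series_factors M Ns). series_multiplicity R M Ns S = 1))"


section \<open>Free modules given by structure constants\<close>

text \<open>A polynomial in \<open>\<lambda>\<close> and \<open>\<partial>\<close> is a polynomial in \<open>\<lambda>\<close> with coefficients polynomials in \<open>\<partial>\<close>.\<close>

definition lam :: "complex poly poly" where "lam = [:0, 1:]"

definition del :: "complex poly poly" where "del = [:[:0, 1:]:]"

definition cst :: "complex \<Rightarrow> complex poly poly" where "cst c = [:[:c:]:]"

definition subst_del :: "complex poly \<Rightarrow> complex poly poly \<Rightarrow> complex poly poly" where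
  "subst_del f z = poly (map_poly cst f) z"

text \<open>\<open>trm b q\<close> stands for \<open>q(\<lambda>,\<partial>) b\<close> with a basis vector \<open>b\<close>.\<close>

abbreviation trm :: "'b \<Rightarrow> complex poly poly \<Rightarrow> ('b \<Rightarrow>\<^sub>0 complex poly poly)" where
  "trm b q \<equiv> Poly_Mapping.single b q"

text \<open>The free module on the basis \<open>'b\<close>, with \<open>p\<close> giving the parities of the basis vectors and
  \<open>s a b\<close> the \<open>\<lambda>\<close>-action of basis elements. It is extended by
  \<open>(f(\<partial>) a)\<^sub>\<lambda> (g(\<partial>) b) = f(-\<lambda>) g(\<partial>+\<lambda>) (a\<^sub>\<lambda> b)\<close>.\<close>

definition free_conf ::
  "('b \<Rightarrow> bit) \<Rightarrow> ('a \<Rightarrow> 'b \<Rightarrow> ('b \<Rightarrow>\<^sub>0 complex poly poly)) \<Rightarrow>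
   ('a \<Rightarrow>\<^sub>0 complex poly, 'b \<Rightarrow>\<^sub>0 complex poly) conf" where
  "free_conf p s =
     \<lparr>carrier = UNIV, monoid.mult = undefined, one = undefined, zero = 0, add = (+),
      module.smult = (\<lambda>q v. Poly_Mapping.map ((*) q) v),
      grade = (\<lambda>e. {v. \<forall>b\<in>Poly_Mapping.keys v. p b = e}),
      lact = (\<lambda>x v n. Poly_Mapping.map (\<lambda>q. coeff q n)
        (\<Sum>a\<in>Poly_Mapping.keys x. \<Sum>b\<in>Poly_Mapping.keys v.
           Poly_Mapping.map
             ((*) (subst_del (Poly_Mapping.lookup x a) (- lam) *
                   subst_del (Poly_Mapping.lookup v b) (del + lam)))
             (s a b)))\<rparr>"

text \<open>The even one-dimensional module on which \<open>\<partial>\<close> acts by \<open>\<gamma>\<close> and every \<open>\<lambda>\<close>-action is zero.\<close>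

definition triv_conf :: "complex \<Rightarrow> ('r, complex) conf" where
  "triv_conf \<gamma> =
     \<lparr>carrier = UNIV, monoid.mult = undefined, one = undefined, zero = 0, add = (+),
      module.smult = (\<lambda>q z. poly q \<gamma> * z),
      grade = (\<lambda>e. if e = 0 then UNIV else {0}),
      lact = (\<lambda>_ _ _. 0)\<rparr>"


section \<open>The Lie conformal superalgebra \<open>K(p)\<close>\<close>

datatype gen = L nat | J nat | Gp nat | Gm nat

fun gen_parity :: "gen \<Rightarrow> bit" where
  "gen_parity (L i) = 0"
| "gen_parity (J i) = 0"
| "gen_parity (Gp i) = 1"
| "gen_parity (Gm i) = 1"

text \<open>For basis elements \<open>a\<close>, \<open>b\<close> of parities \<open>s\<close>, \<open>t\<close>, this turns \<open>[b\<^sub>\<lambda> a]\<close> into \<open>[a\<^sub>\<lambda> b]\<close> by skew-symmetry,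
  replacing \<open>\<lambda>\<close> by \<open>-\<lambda>-\<partial>\<close>.\<close>

definition skew :: "bit \<Rightarrow> bit \<Rightarrow> (gen \<Rightarrow>\<^sub>0 complex poly poly) \<Rightarrow> (gen \<Rightarrow>\<^sub>0 complex poly poly)" where
  "skew s t = Poly_Mapping.map (\<lambda>q. - cst (ksign s t) * pcompose q (- lam - del))"

fun K_given :: "complex \<Rightarrow> gen \<Rightarrow> gen \<Rightarrow> (gen \<Rightarrow>\<^sub>0 complex poly poly)" where
  "K_given p (L i) (L j) =
     trm (L (i + j)) (cst (of_nat i + p) * del + cst (of_nat i + of_nat j + 2 * p) * lam)"
| "K_given p (L i) (J j) =
     trm (J (i + j)) (cst (of_nat i + p) * del + cst (of_nat i + of_nat j + p) * lam)"
| "K_given p (L i) (Gp j) =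
     trm (Gp (i + j)) (cst (of_nat i + p) * del + cst (of_nat i + of_nat j + 3 / 2 * p) * lam)"
| "K_given p (L i) (Gm j) =
     trm (Gm (i + j)) (cst (of_nat i + p) * del + cst (of_nat i + of_nat j + 3 / 2 * p) * lam)"
| "K_given p (J i) (Gp j) = trm (Gp (i + j)) 1"
| "K_given p (J i) (Gm j) = trm (Gm (i + j)) (- 1)"
| "K_given p (Gp i) (Gm j) =
     trm (J (i + j)) (cst (2 * of_nat i + p) * del + cst (2 * (of_nat i + of_nat j + p)) * lam)
     + trm (L (i + j)) (cst 2)"
| "K_given p _ _ = 0"

fun K_bracket :: "complex \<Rightarrow> gen \<Rightarrow> gen \<Rightarrow> (gen \<Rightarrow>\<^sub>0 complex poly poly)" where
  "K_bracket p (J i) (L j) = skew 0 0 (K_given p (L j) (J i))"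
| "K_bracket p (Gp i) (L j) = skew 1 0 (K_given p (L j) (Gp i))"
| "K_bracket p (Gm i) (L j) = skew 1 0 (K_given p (L j) (Gm i))"
| "K_bracket p (Gp i) (J j) = skew 1 0 (K_given p (J j) (Gp i))"
| "K_bracket p (Gm i) (J j) = skew 1 0 (K_given p (J j) (Gm i))"
| "K_bracket p (Gm i) (Gp j) = skew 1 1 (K_given p (Gp j) (Gm i))"
| "K_bracket p a b = K_given p a b"

definition K :: "complex \<Rightarrow> (gen \<Rightarrow>\<^sub>0 complex poly, gen \<Rightarrow>\<^sub>0 complex poly) conf" where
  "K p = free_conf gen_parity (K_bracket p)"


section \<open>The conformal \<open>K(p)\<close>-modules\<close>

text \<open>In this section, \<open>r\<close> is the chosen square root of \<open>p\<close>.\<close>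

datatype basis2 = V0 | V1

fun basis2_parity :: "basis2 \<Rightarrow> bit" where
  "basis2_parity V0 = 0"
| "basis2_parity V1 = 1"

fun act1 :: "complex \<Rightarrow> complex \<Rightarrow> complex \<Rightarrow> complex \<Rightarrow> gen \<Rightarrow> basis2 \<Rightarrow> (basis2 \<Rightarrow>\<^sub>0 complex poly poly)" where
  "act1 p r \<Delta> \<alpha> (L 0) V0 = trm V0 (cst p * (del + cst \<Delta> * lam + cst \<alpha>))"
| "act1 p r \<Delta> \<alpha> (L 0) V1 = trm V1 (cst p * (del + cst (\<Delta> + 1 / 2) * lam + cst \<alpha>))"
| "act1 p r \<Delta> \<alpha> (J 0) V0 = trm V0 (cst (- 2 * \<Delta>))"
| "act1 p r \<Delta> \<alpha> (J 0) V1 = trm V1 (cst (1 - 2 * \<Delta>))"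
| "act1 p r \<Delta> \<alpha> (Gp 0) V0 = trm V1 (cst r)"
| "act1 p r \<Delta> \<alpha> (Gp 0) V1 = 0"
| "act1 p r \<Delta> \<alpha> (Gm 0) V0 = 0"
| "act1 p r \<Delta> \<alpha> (Gm 0) V1 = trm V0 (cst (2 * r) * (del + cst (2 * \<Delta>) * lam + cst \<alpha>))"
| "act1 p r \<Delta> \<alpha> (L (Suc i)) v = 0"
| "act1 p r \<Delta> \<alpha> (J (Suc i)) v = 0"
| "act1 p r \<Delta> \<alpha> (Gp (Suc i)) v = 0"
| "act1 p r \<Delta> \<alpha> (Gm (Suc i)) v = 0"

fun act2 :: "complex \<Rightarrow> complex \<Rightarrow> complex \<Rightarrow> complex \<Rightarrow> gen \<Rightarrow> basis2 \<Rightarrow> (basis2 \<Rightarrow>\<^sub>0 complex poly poly)" where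
  "act2 p r \<Delta> \<alpha> (L 0) V0 = trm V0 (cst p * (del + cst \<Delta> * lam + cst \<alpha>))"
| "act2 p r \<Delta> \<alpha> (L 0) V1 = trm V1 (cst p * (del + cst (\<Delta> + 1 / 2) * lam + cst \<alpha>))"
| "act2 p r \<Delta> \<alpha> (J 0) V0 = trm V0 (cst (2 * \<Delta>))"
| "act2 p r \<Delta> \<alpha> (J 0) V1 = trm V1 (cst (2 * \<Delta> - 1))"
| "act2 p r \<Delta> \<alpha> (Gp 0) V0 = 0"
| "act2 p r \<Delta> \<alpha> (Gp 0) V1 = trm V0 (cst (2 * r) * (del + cst (2 * \<Delta>) * lam + cst \<alpha>))"
| "act2 p r \<Delta> \<alpha> (Gm 0) V0 = trm V1 (cst r)"
| "act2 p r \<Delta> \<alpha> (Gm 0) V1 = 0"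
| "act2 p r \<Delta> \<alpha> (L (Suc i)) v = 0"
| "act2 p r \<Delta> \<alpha> (J (Suc i)) v = 0"
| "act2 p r \<Delta> \<alpha> (Gp (Suc i)) v = 0"
| "act2 p r \<Delta> \<alpha> (Gm (Suc i)) v = 0"

definition Vmod1 :: "complex \<Rightarrow> complex \<Rightarrow> complex \<Rightarrow> complex \<Rightarrow> (gen \<Rightarrow>\<^sub>0 complex poly, basis2 \<Rightarrow>\<^sub>0 complex poly) conf" where
  "Vmod1 p r \<Delta> \<alpha> = free_conf basis2_parity (act1 p r \<Delta> \<alpha>)"

definition Vmod2 :: "complex \<Rightarrow> complex \<Rightarrow> complex \<Rightarrow> complex \<Rightarrow> (gen \<Rightarrow>\<^sub>0 complex poly, basis2 \<Rightarrow>\<^sub>0 complex poly) conf" where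
  "Vmod2 p r \<Delta> \<alpha> = free_conf basis2_parity (act2 p r \<Delta> \<alpha>)"

text \<open>The first digit is the parity, the second one the upper index.\<close>

datatype basis4 = V01 | V02 | V11 | V12

fun basis4_parity :: "basis4 \<Rightarrow> bit" where
  "basis4_parity V01 = 0"
| "basis4_parity V02 = 0"
| "basis4_parity V11 = 1"
| "basis4_parity V12 = 1"

fun act4 :: "complex \<Rightarrow> complex \<Rightarrow> complex \<Rightarrow> complex \<Rightarrow> complex \<Rightarrow> gen \<Rightarrow> basis4 \<Rightarrow> (basis4 \<Rightarrow>\<^sub>0 complex poly poly)" where
  "act4 p r \<Delta> \<Lambda> \<alpha> (L 0) V01 = trm V01 (cst p * (del + cst \<Delta> * lam + cst \<alpha>))"
| "act4 p r \<Delta> \<Lambda> \<alpha> (L 0) V02 = trm V02 (cst p * (del + cst (\<Delta> + 1) * lam + cst \<alpha>))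
     + trm V01 (cst (p * (\<Delta> + \<Lambda> / 2)) * lam\<^sup>2)"
| "act4 p r \<Delta> \<Lambda> \<alpha> (L 0) V11 = trm V11 (cst p * (del + cst (\<Delta> + 1 / 2) * lam + cst \<alpha>))"
| "act4 p r \<Delta> \<Lambda> \<alpha> (L 0) V12 = trm V12 (cst p * (del + cst (\<Delta> + 1 / 2) * lam + cst \<alpha>))"
| "act4 p r \<Delta> \<Lambda> \<alpha> (J 0) V01 = trm V01 (cst \<Lambda>)"
| "act4 p r \<Delta> \<Lambda> \<alpha> (J 0) V02 = trm V02 (cst \<Lambda>) + trm V01 (cst (2 * \<Delta> + \<Lambda>) * lam)"
| "act4 p r \<Delta> \<Lambda> \<alpha> (J 0) V11 = trm V11 (cst (\<Lambda> + 1))"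
| "act4 p r \<Delta> \<Lambda> \<alpha> (J 0) V12 = trm V12 (cst (\<Lambda> - 1))"
| "act4 p r \<Delta> \<Lambda> \<alpha> (Gp 0) V01 = trm V11 (cst r)"
| "act4 p r \<Delta> \<Lambda> \<alpha> (Gp 0) V11 = 0"
| "act4 p r \<Delta> \<Lambda> \<alpha> (Gp 0) V02 = trm V11 (- cst (r * (2 * \<Delta> + \<Lambda>)) * lam)"
| "act4 p r \<Delta> \<Lambda> \<alpha> (Gp 0) V12 = trm V01 (cst (r * (2 * \<Delta> + \<Lambda>)) * lam) + trm V02 (cst r)"
| "act4 p r \<Delta> \<Lambda> \<alpha> (Gm 0) V01 = trm V12 (cst r)"
| "act4 p r \<Delta> \<Lambda> \<alpha> (Gm 0) V11 =
     trm V01 (cst r * (2 * del + cst (2 * \<Delta> - \<Lambda>) * lam + cst (2 * \<alpha>))) + trm V02 (- cst r)"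
| "act4 p r \<Delta> \<Lambda> \<alpha> (Gm 0) V02 =
     trm V12 (cst r * (2 * del + cst (2 * \<Delta> - \<Lambda> + 2) * lam + cst (2 * \<alpha>)))"
| "act4 p r \<Delta> \<Lambda> \<alpha> (Gm 0) V12 = 0"
| "act4 p r \<Delta> \<Lambda> \<alpha> (L (Suc i)) v = 0"
| "act4 p r \<Delta> \<Lambda> \<alpha> (J (Suc i)) v = 0"
| "act4 p r \<Delta> \<Lambda> \<alpha> (Gp (Suc i)) v = 0"
| "act4 p r \<Delta> \<Lambda> \<alpha> (Gm (Suc i)) v = 0"

definition Vmod4 :: "complex \<Rightarrow> complex \<Rightarrow> complex \<Rightarrow> complex \<Rightarrow> complex \<Rightarrow>
    (gen \<Rightarrow>\<^sub>0 complex poly, basis4 \<Rightarrow>\<^sub>0 complex poly) conf" where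
  "Vmod4 p r \<Delta> \<Lambda> \<alpha> = free_conf basis4_parity (act4 p r \<Delta> \<Lambda> \<alpha>)"

text \<open>Only for \<open>p = -1\<close>, so that \<open>r\<close> is the chosen square root of \<open>-1\<close>.\<close>

fun act4b :: "complex \<Rightarrow> complex \<Rightarrow> complex \<Rightarrow> complex \<Rightarrow> complex \<Rightarrow> gen \<Rightarrow> basis4 \<Rightarrow> (basis4 \<Rightarrow>\<^sub>0 complex poly poly)" where
  "act4b r \<Delta> \<Lambda> \<alpha> \<beta> (L 0) v = act4 (- 1) r \<Delta> \<Lambda> \<alpha> (L 0) v"
| "act4b r \<Delta> \<Lambda> \<alpha> \<beta> (J 0) v = act4 (- 1) r \<Delta> \<Lambda> \<alpha> (J 0) v"
| "act4b r \<Delta> \<Lambda> \<alpha> \<beta> (Gp 0) v = act4 (- 1) r \<Delta> \<Lambda> \<alpha> (Gp 0) v"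
| "act4b r \<Delta> \<Lambda> \<alpha> \<beta> (Gm 0) v = act4 (- 1) r \<Delta> \<Lambda> \<alpha> (Gm 0) v"
| "act4b r \<Delta> \<Lambda> \<alpha> \<beta> (L (Suc 0)) V01 = trm V01 (cst (- r / 2 * \<beta>))"
| "act4b r \<Delta> \<Lambda> \<alpha> \<beta> (L (Suc 0)) V02 = trm V02 (cst (- r / 2 * \<beta>)) + trm V01 (cst (- r / 2 * \<beta>) * lam)"
| "act4b r \<Delta> \<Lambda> \<alpha> \<beta> (L (Suc 0)) V11 = trm V11 (cst (- r / 2 * \<beta>))"
| "act4b r \<Delta> \<Lambda> \<alpha> \<beta> (L (Suc 0)) V12 = trm V12 (cst (- r / 2 * \<beta>))"
| "act4b r \<Delta> \<Lambda> \<alpha> \<beta> (J (Suc 0)) V02 = trm V01 (cst (r * \<beta>))"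
| "act4b r \<Delta> \<Lambda> \<alpha> \<beta> (Gp (Suc 0)) V02 = trm V11 (cst \<beta>)"
| "act4b r \<Delta> \<Lambda> \<alpha> \<beta> (Gp (Suc 0)) V12 = trm V01 (cst (- \<beta>))"
| "act4b r \<Delta> \<Lambda> \<alpha> \<beta> (Gm (Suc 0)) V11 = trm V01 (cst (- \<beta>))"
| "act4b r \<Delta> \<Lambda> \<alpha> \<beta> (Gm (Suc 0)) V02 = trm V12 (cst (- \<beta>))"
| "act4b r \<Delta> \<Lambda> \<alpha> \<beta> _ _ = 0"

definition Vmod4b :: "complex \<Rightarrow> complex \<Rightarrow> complex \<Rightarrow> complex \<Rightarrow> complex \<Rightarrow>
    (gen \<Rightarrow>\<^sub>0 complex poly, basis4 \<Rightarrow>\<^sub>0 complex poly) conf" where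
  "Vmod4b r \<Delta> \<Lambda> \<alpha> \<beta> = free_conf basis4_parity (act4b r \<Delta> \<Lambda> \<alpha> \<beta>)"

end

(* A nonzero graded submodule of V(Delta, Lambda, alpha, beta) contains a nonzero homogeneous vector, and
   the leading coefficients in lambda of the actions of G_0^+-, G_1^+- on it produce all basis vectors unless
   2 Delta + Lambda or 2 Delta - Lambda vanishes together with beta. In the latter cases explicit polynomial
   matrices give short exact sequences, and so do V^(1)_0 and V^(2)_0 over the trivial module. The factors of
   an arbitrary composition series are then determined by the Jordan-Hoelder theorem, and they are pairwise
   non-isomorphic because J_0 acts by different scalars in degree zero of lambda. All identities between
   structure constants are checked by evaluating lambda, mu and the derivation at complex numbers. *)

theory Submission
  imports Defs "HOL-Combinatorics.List_Permutation"
begin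

section \<open>The Jordan-Hoelder argument\<close>

text \<open>Simplicity rests on \<open>h(del + lam)\<close> having a scalar leading coefficient in
  lambda: one coefficient of one action strips a polynomial multiple of a basis vector down to a
  scalar multiple. Up to \<open>r\<close>, the numbers \<open>2 * \<Delta> + \<Lambda>\<close> and
  \<open>2 * \<Delta> - \<Lambda>\<close> are the coefficients of lambda with which
  \<open>Gp 0\<close> on \<open>V12\<close> and \<open>Gm 0\<close> on \<open>V11\<close> reach
  \<open>V01\<close>; \<open>Gp 1\<close> and \<open>Gm 1\<close> reach it from the same vectors
  with \<open>- \<beta>\<close>. Trivial factors appear at \<open>\<Delta> = 0\<close> because the
  lambda term of \<open>del + 2 \<Delta> lam + \<alpha>\<close> disappears there, and the cokernel
  of \<open>del + \<alpha>\<close> is one-dimensional with the derivation acting by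
  \<open>- \<alpha>\<close>. The obstacle is that the axioms concern single coefficients of powers
  of lambda and mu, with binomial sums, while the modules are polynomial data on a basis; evaluation
  bridges the two once for all free modules. The Jacobi identity is then checked for
  \<open>K p\<close> and the two rank (2+2) families. The smaller modules serve as models, compared
  through \<open>closed_conf\<close> and \<open>conf_simple\<close>, and the factors of a series
  inherit their axioms from the large module.\<close>

inductive chain :: "('a \<Rightarrow> 'a \<Rightarrow> bool) \<Rightarrow> ('a \<Rightarrow> 'a \<Rightarrow> 'c) \<Rightarrow> 'a \<Rightarrow> 'a \<Rightarrow> 'c multiset \<Rightarrow> bool"
  for C cl z where
  chain_base: "chain C cl z z {#}"
| chain_step: "chain C cl z y cs \<Longrightarrow> C y x \<Longrightarrow> chain C cl z x (add_mset (cl y x) cs)"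

text \<open>In the application, \<open>C y x\<close> says that the quotient \<open>x / y\<close> of two submodules is simple, and \<open>cl y x\<close> is its
  isomorphism class.\<close>

locale jordan_hoelder =
  fixes C :: "'a set \<Rightarrow> 'a set \<Rightarrow> bool" and cl :: "'a set \<Rightarrow> 'a set \<Rightarrow> 'c" and z :: "'a set"
  assumes bottom: "\<not> C y z"
    and diamond: "\<lbrakk>C a x; C b x; a \<noteq> b\<rbrakk> \<Longrightarrow> C (a \<inter> b) a \<and> C (a \<inter> b) b \<and>
      cl a x = cl (a \<inter> b) b \<and> cl b x = cl (a \<inter> b) a"
    and restrict: "\<lbrakk>C a x; C y y'; y \<subseteq> x; \<not> y \<subseteq> a\<rbrakk> \<Longrightarrow> C (a \<inter> y) y"
    and z_least: "C y x \<Longrightarrow> z \<subseteq> y"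
begin

text \<open>Intersecting the members of a chain below \<open>x\<close> with \<open>y\<close> gives a
  chain below \<open>y\<close> once repetitions are skipped. The premise \<open>C y y'\<close>
  certifies that \<open>y\<close> is a legitimate submodule, since the abstract setting has no
  separate predicate for that.\<close>

lemma chain_below:
  assumes "chain C cl z x cs" "C y y'" "y \<subseteq> x"
  shows "\<exists>es. chain C cl z y es"
  using assms
proof (induction arbitrary: y y' rule: chain.induct)
  case chain_base
  then have "y = z" using z_least by blast
  then show ?case by (metis chain.chain_base)
next
  case (chain_step a cs x)
  show ?case
  proof (cases "y \<subseteq> a")
    case True
    then show ?thesis using chain_step.IH[OF chain_step.prems(1)] by simp
  next
    case False
    then have c: "C (a \<inter> y) y" using restrict[OF chain_step.hyps(2)] chain_step.prems by simp
    obtain es where "chain C cl z (a \<inter> y) es" using chain_step.IH[OF c] by auto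
    from chain.chain_step[OF this c] show ?thesis by (rule exI)
  qed
qed

text \<open>The two top steps, from \<open>a\<close> and from \<open>b\<close>, are compared through
  one chain \<open>es\<close> below \<open>a \<inter> b\<close>; by the diamond the two classes on
  the left are the two on the right, exchanged. The induction is on the length of the first chain
  only, so equality of the lengths is part of the result.\<close>

lemma chain_unique:
  "chain C cl z x cs \<Longrightarrow> chain C cl z x ds \<Longrightarrow> cs = ds"
proof (induction "size cs" arbitrary: x cs ds)
  case 0
  then have "cs = {#}" "x = z" by (auto elim: chain.cases)
  then show ?case using 0(3) bottom by (auto elim: chain.cases)
next
  case (Suc n)
  obtain a as where a: "cs = add_mset (cl a x) as" "chain C cl z a as" "C a x"
    using Suc(2,3) by (auto elim: chain.cases)
  obtain b bs where b: "ds = add_mset (cl b x) bs" "chain C cl z b bs" "C b x"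
    using Suc(4) a(3) bottom by (auto elim: chain.cases)
  have n: "n = size as" using Suc(2) a(1) by simp
  show ?case
  proof (cases "a = b")
    case True
    then show ?thesis using Suc(1)[OF n a(2)] a b by auto
  next
    case False
    note d = diamond[OF a(3) b(3) False]
    obtain es where es: "chain C cl z (a \<inter> b) es"
      using chain_below[OF a(2), of "a \<inter> b" a] d by auto
    have as: "as = add_mset (cl (a \<inter> b) a) es"
      using Suc(1)[OF n a(2)] chain.chain_step[OF es] d by blast
    \<comment> \<open>The hypothesis applies below \<open>b\<close> as well: by the previous step
      \<open>es\<close> has one element fewer than \<open>as\<close>, so this chain has length
      \<open>n\<close> too.\<close>
    have "add_mset (cl (a \<inter> b) b) es = bs"
      using Suc(1)[of "add_mset (cl (a \<inter> b) b) es" b bs] chain.chain_step[OF es, of b] d b n as by simp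
    then show ?thesis using a b as d by auto
  qed
qed

end


section \<open>Submodules, quotients and homomorphisms\<close>

lemma CD_simps [simp]:
  "carrier CD = UNIV" "add CD = (+)" "zero CD = 0" "one CD = 1" "monoid.mult CD = (*)"
  by (simp_all add: CD_def)

lemma cring_CD: "cring CD"
proof (rule cringI)
  show "abelian_group CD"
    by (rule abelian_groupI) (auto simp: add.assoc add.commute intro: exI[of _ "- _"])
  show "comm_monoid CD"
    by (rule comm_monoidI) (auto simp: algebra_simps)
  show "\<And>x y z. \<lbrakk>x \<in> carrier CD; y \<in> carrier CD; z \<in> carrier CD\<rbrakk>
    \<Longrightarrow> (x \<oplus>\<^bsub>CD\<^esub> y) \<otimes>\<^bsub>CD\<^esub> z = x \<otimes>\<^bsub>CD\<^esub> z \<oplus>\<^bsub>CD\<^esub> y \<otimes>\<^bsub>CD\<^esub> z"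
    by (simp add: algebra_simps)
qed

context supermodule
begin

lemma smult_in [simp]: "v \<in> carrier M \<Longrightarrow> q \<odot> v \<in> carrier M"
  using smult_closed by simp

text \<open>Makes negation a case of scalar multiplication; this is why neither
  \<open>conf_sub\<close> nor \<open>conf_hom\<close> has a clause about negation.\<close>

lemma smult_minus_one: "v \<in> carrier M \<Longrightarrow> [:- 1:] \<odot> v = \<ominus> v"
proof -
  assume v: "v \<in> carrier M"
  have "[:- 1:] \<odot> v \<oplus> v = ([:- 1:] + 1) \<odot> v"
    using smult_l_distr[of "[:- 1:]" 1 v] smult_one[of v] v by simp
  also have "[:- 1:] + 1 = (0 :: complex poly)"
    by (simp add: one_pCons)
  also have "0 \<odot> v = \<zero>"
    using smult_l_null[of v] v by simp
  finally show ?thesis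
    using M.minus_equality[of "[:- 1:] \<odot> v" v] v by simp
qed

lemma grade_in: "v \<in> grade M s \<Longrightarrow> v \<in> carrier M"
  using grade_submodule[of s] subgroup.subset unfolding submodule_def by fastforce

lemma
  shows zero_in_grade: "\<zero> \<in> grade M s"
    and add_in_grade: "\<lbrakk>u \<in> grade M s; v \<in> grade M s\<rbrakk> \<Longrightarrow> u \<oplus> v \<in> grade M s"
    and smult_in_grade: "v \<in> grade M s \<Longrightarrow> q \<odot> v \<in> grade M s"
    and minus_in_grade: "v \<in> grade M s \<Longrightarrow> \<ominus> v \<in> grade M s"
proof -
  interpret G: submodule "grade M s" CD M by (rule grade_submodule)
  show "\<zero> \<in> grade M s" using G.one_closed by simp
  show "\<lbrakk>u \<in> grade M s; v \<in> grade M s\<rbrakk> \<Longrightarrow> u \<oplus> v \<in> grade M s" using G.m_closed by simp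
  show "q \<odot> v \<in> grade M s" if "v \<in> grade M s" for q using G.smult_closed that by simp
  then show "v \<in> grade M s \<Longrightarrow> \<ominus> v \<in> grade M s"
    using smult_minus_one[OF grade_in] by metis
qed

lemma grade_split:
  assumes "v \<in> carrier M"
  obtains v0 v1 where "v0 \<in> grade M 0" "v1 \<in> grade M 1" "v = v0 \<oplus> v1"
proof -
  have "v \<in> grade M 0 <+> grade M 1" using assms grade_sum by simp
  then show ?thesis using that unfolding set_add_def' by blast
qed

lemma grade_disjoint: "v \<in> grade M 0 \<Longrightarrow> v \<in> grade M 1 \<Longrightarrow> v = \<zero>"
  using grade_int by blast

lemma minus_swap:
  assumes "u \<in> carrier M" "v \<in> carrier M" "u' \<in> carrier M" "v' \<in> carrier M" "u \<oplus> v = u' \<oplus> v'"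
  shows "u \<ominus> u' = v' \<ominus> v"
proof -
  define w where "w = v' \<ominus> v"
  have w: "w \<in> carrier M" using assms by (simp add: w_def)
  have "u = (u \<oplus> v) \<oplus> \<ominus> v" using assms(1,2) by (simp add: M.a_assoc M.r_neg)
  also have "\<dots> = u' \<oplus> w" using assms by (simp add: M.a_assoc M.minus_eq w_def)
  finally have "u \<ominus> u' = w \<oplus> (u' \<oplus> \<ominus> u')" using assms(3) w by (simp add: M.a_ac M.minus_eq)
  then show ?thesis using assms(3) w by (simp add: M.r_neg w_def)
qed

lemma minus_eq_zero_iff: "\<lbrakk>u \<in> carrier M; v \<in> carrier M\<rbrakk> \<Longrightarrow> u \<ominus> v = \<zero> \<longleftrightarrow> u = v"
  by (metis M.a_inv_closed M.minus_eq M.minus_equality M.minus_minus M.r_neg)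

lemma grade_unique:
  assumes "u \<in> grade M 0" "u' \<in> grade M 0" "v \<in> grade M 1" "v' \<in> grade M 1" "u \<oplus> v = u' \<oplus> v'"
  shows "u = u'" "v = v'"
proof -
  have c: "u \<in> carrier M" "v \<in> carrier M" "u' \<in> carrier M" "v' \<in> carrier M"
    using assms grade_in by blast+
  have "u \<ominus> u' = v' \<ominus> v" by (rule minus_swap[OF c assms(5)])
  moreover have "u \<ominus> u' \<in> grade M 0" "v' \<ominus> v \<in> grade M 1"
    using assms by (simp_all add: M.minus_eq add_in_grade minus_in_grade)
  ultimately have "u \<ominus> u' = \<zero>" "v' \<ominus> v = \<zero>" using grade_disjoint by metis+
  then show "u = u'" "v = v'" using minus_eq_zero_iff[OF c(1,3)] minus_eq_zero_iff[OF c(4,2)] by simp_all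
qed

end

section \<open>Graded submodules\<close>

text \<open>Gradedness is put elementwise, through homogeneous components, instead of through sums
  of sets. No module axioms are included, so the notion also applies to modules for which the Jacobi
  identity is not at hand.\<close>

definition conf_sub :: "('r, 'r) conf \<Rightarrow> ('r, 'v) conf \<Rightarrow> 'v set \<Rightarrow> bool" where
  "conf_sub R M N \<longleftrightarrow>
     N \<subseteq> carrier M \<and> \<zero>\<^bsub>M\<^esub> \<in> N \<and> (\<forall>u\<in>N. \<forall>v\<in>N. u \<oplus>\<^bsub>M\<^esub> v \<in> N) \<and> (\<forall>q. \<forall>v\<in>N. q \<odot>\<^bsub>M\<^esub> v \<in> N) \<and>
     (\<forall>a\<in>carrier R. \<forall>v\<in>N. \<forall>n. lact M a v n \<in> N) \<and>
     (\<forall>u\<in>grade M 0. \<forall>v\<in>grade M 1. u \<oplus>\<^bsub>M\<^esub> v \<in> N \<longrightarrow> u \<in> N \<and> v \<in> N)"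

lemma conf_subD:
  assumes "conf_sub R M N"
  shows "v \<in> N \<Longrightarrow> v \<in> carrier M" "\<zero>\<^bsub>M\<^esub> \<in> N"
    "\<lbrakk>u \<in> N; v \<in> N\<rbrakk> \<Longrightarrow> u \<oplus>\<^bsub>M\<^esub> v \<in> N" "v \<in> N \<Longrightarrow> q \<odot>\<^bsub>M\<^esub> v \<in> N"
    "\<lbrakk>a \<in> carrier R; v \<in> N\<rbrakk> \<Longrightarrow> lact M a v n \<in> N"
    "\<lbrakk>u \<in> grade M 0; v \<in> grade M 1; u \<oplus>\<^bsub>M\<^esub> v \<in> N\<rbrakk> \<Longrightarrow> u \<in> N"
    "\<lbrakk>u \<in> grade M 0; v \<in> grade M 1; u \<oplus>\<^bsub>M\<^esub> v \<in> N\<rbrakk> \<Longrightarrow> v \<in> N"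
    "N \<subseteq> carrier M"
  using assms unfolding conf_sub_def by blast+

lemma conf_subI:
  assumes "N \<subseteq> carrier M" "\<zero>\<^bsub>M\<^esub> \<in> N" "\<And>u v. \<lbrakk>u \<in> N; v \<in> N\<rbrakk> \<Longrightarrow> u \<oplus>\<^bsub>M\<^esub> v \<in> N"
    "\<And>q v. v \<in> N \<Longrightarrow> q \<odot>\<^bsub>M\<^esub> v \<in> N" "\<And>a v n. \<lbrakk>a \<in> carrier R; v \<in> N\<rbrakk> \<Longrightarrow> lact M a v n \<in> N"
    "\<And>u v. \<lbrakk>u \<in> grade M 0; v \<in> grade M 1; u \<oplus>\<^bsub>M\<^esub> v \<in> N\<rbrakk> \<Longrightarrow> u \<in> N \<and> v \<in> N"
  shows "conf_sub R M N"
  using assms unfolding conf_sub_def by simp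

lemma (in supermodule) conf_sub_minus:
  "\<lbrakk>conf_sub R M N; v \<in> N\<rbrakk> \<Longrightarrow> \<ominus> v \<in> N"
  by (metis conf_subD(1,4) smult_minus_one)

lemma (in supermodule) conf_sub_submodule:
  assumes "conf_sub R M N"
  shows "submodule N CD M"
proof (rule submoduleI)
  show "N \<subseteq> carrier M" by (rule conf_subD(8)[OF assms])
  show "\<zero> \<in> N" by (rule conf_subD(2)[OF assms])
  show "\<And>a. a \<in> N \<Longrightarrow> \<ominus> a \<in> N" by (rule conf_sub_minus[OF assms])
  show "\<And>a b. \<lbrakk>a \<in> N; b \<in> N\<rbrakk> \<Longrightarrow> a \<oplus> b \<in> N" by (rule conf_subD(3)[OF assms])
  show "\<And>a x. \<lbrakk>a \<in> carrier CD; x \<in> N\<rbrakk> \<Longrightarrow> a \<odot> x \<in> N" by (rule conf_subD(4)[OF assms])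
qed

lemma conformal_module_supermodule: "conformal_module R M \<Longrightarrow> supermodule M"
  unfolding conformal_module_def lambda_action_def by blast

lemma set_addI: "\<lbrakk>u \<in> A; v \<in> B\<rbrakk> \<Longrightarrow> u \<oplus>\<^bsub>M\<^esub> v \<in> A <+>\<^bsub>M\<^esub> B"
  unfolding set_add_def' by blast

lemma set_addE:
  assumes "w \<in> A <+>\<^bsub>M\<^esub> B"
  obtains u v where "u \<in> A" "v \<in> B" "w = u \<oplus>\<^bsub>M\<^esub> v"
  using assms unfolding set_add_def' by blast

lemma conformal_moduleD:
  assumes "conformal_module R M"
  shows "supermodule R" "lambda_action R R" "lambda_action R M" "lie_conformal_superalgebra R"
  using assms unfolding conformal_module_def lambda_action_def lie_conformal_superalgebra_def by blast+

text \<open>Uniqueness of the decomposition into an even and an odd part translates between the sum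
  of the two intersections and membership of both components.\<close>

lemma conformal_submodule_iff:
  fixes M :: "('r, 'v) conf" (structure)
  shows "conformal_submodule R M N \<longleftrightarrow> conformal_module R M \<and> conf_sub R M N"
proof (cases "conformal_module R M")
  case True
  interpret supermodule M by (rule conformal_module_supermodule[OF True])
  show ?thesis
  proof
    assume *: "conformal_submodule R M N"
    then have sub: "submodule N CD M" and sum: "(N \<inter> grade M 0) <+> (N \<inter> grade M 1) = N"
      and act: "\<forall>a\<in>carrier R. \<forall>v\<in>N. \<forall>n. lact M a v n \<in> N"
      unfolding conformal_submodule_def by blast+
    interpret N: submodule N CD M by (rule sub)
    have split: "u \<in> N \<and> v \<in> N" if uv: "u \<in> grade M 0" "v \<in> grade M 1" "u \<oplus> v \<in> N" for u v
    proof -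
      obtain u' v' where u': "u' \<in> N \<inter> grade M 0" "v' \<in> N \<inter> grade M 1" "u \<oplus> v = u' \<oplus> v'"
        using uv(3) sum[symmetric] unfolding set_add_def' by blast
      have "u = u'" "v = v'" using grade_unique[of u u' v v'] uv u' by simp_all
      then show ?thesis using u' by blast
    qed
    have "conf_sub R M N"
      unfolding conf_sub_def
    proof (intro conjI ballI allI impI)
      show "N \<subseteq> carrier M" using N.subset by simp
      show "\<zero> \<in> N" using N.one_closed by simp
      show "\<And>u v. u \<in> N \<Longrightarrow> v \<in> N \<Longrightarrow> u \<oplus> v \<in> N" using N.m_closed by simp
      show "\<And>q v. v \<in> N \<Longrightarrow> q \<odot> v \<in> N" using N.smult_closed by simp
    qed (use act split in blast)+
    then show "conformal_module R M \<and> conf_sub R M N" using True by blast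
  next
    assume "conformal_module R M \<and> conf_sub R M N"
    then have s: "conf_sub R M N" by blast
    have "(N \<inter> grade M 0) <+> (N \<inter> grade M 1) = N"
    proof
      show "(N \<inter> grade M 0) <+> (N \<inter> grade M 1) \<subseteq> N"
        using conf_subD(3)[OF s] unfolding set_add_def' by blast
      show "N \<subseteq> (N \<inter> grade M 0) <+> (N \<inter> grade M 1)"
      proof
        fix v assume v: "v \<in> N"
        then obtain v0 v1 where w: "v0 \<in> grade M 0" "v1 \<in> grade M 1" "v = v0 \<oplus> v1"
          using grade_split conf_subD(1)[OF s] by blast
        then have "v0 \<in> N" "v1 \<in> N" using v conf_subD(6,7)[OF s] by simp_all
        then show "v \<in> (N \<inter> grade M 0) <+> (N \<inter> grade M 1)"
          unfolding w(3) using w(1,2) by (intro set_addI) auto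
      qed
    qed
    then show "conformal_submodule R M N"
      unfolding conformal_submodule_def
      using True conf_sub_submodule[OF s] conf_subD(5)[OF s] by blast
  qed
qed (simp add: conformal_submodule_def)


section \<open>Homomorphisms and isomorphisms\<close>

definition conf_hom :: "('r, 'r) conf \<Rightarrow> ('r, 'v) conf \<Rightarrow> ('r, 'w) conf \<Rightarrow> ('v \<Rightarrow> 'w) \<Rightarrow> bool" where
  "conf_hom R M N f \<longleftrightarrow>
     (\<forall>v\<in>carrier M. f v \<in> carrier N) \<and>
     (\<forall>u\<in>carrier M. \<forall>v\<in>carrier M. f (u \<oplus>\<^bsub>M\<^esub> v) = f u \<oplus>\<^bsub>N\<^esub> f v) \<and>
     (\<forall>q. \<forall>v\<in>carrier M. f (q \<odot>\<^bsub>M\<^esub> v) = q \<odot>\<^bsub>N\<^esub> f v) \<and>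
     (\<forall>s. \<forall>v\<in>grade M s. f v \<in> grade N s) \<and>
     (\<forall>a\<in>carrier R. \<forall>v\<in>carrier M. \<forall>n. f (lact M a v n) = lact N a (f v) n)"

lemma conf_homD:
  assumes "conf_hom R M N f"
  shows "v \<in> carrier M \<Longrightarrow> f v \<in> carrier N"
    "\<lbrakk>u \<in> carrier M; v \<in> carrier M\<rbrakk> \<Longrightarrow> f (u \<oplus>\<^bsub>M\<^esub> v) = f u \<oplus>\<^bsub>N\<^esub> f v"
    "v \<in> carrier M \<Longrightarrow> f (q \<odot>\<^bsub>M\<^esub> v) = q \<odot>\<^bsub>N\<^esub> f v"
    "v \<in> grade M s \<Longrightarrow> f v \<in> grade N s"
    "\<lbrakk>a \<in> carrier R; v \<in> carrier M\<rbrakk> \<Longrightarrow> f (lact M a v n) = lact N a (f v) n"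
  using assms unfolding conf_hom_def by blast+

lemma conf_iso_iff:
  "conf_iso R M N \<longleftrightarrow>
     (\<exists>f. conf_hom R M N f \<and> bij_betw f (carrier M) (carrier N) \<and> (\<forall>s. f ` grade M s = grade N s))"
  unfolding conf_iso_def Bex_def
  by (rule iff_exI) (auto simp: conf_hom_def iso_def hom_def Pi_iff, metis imageI)

lemma conf_hom_zero:
  assumes "conf_hom R M N f" "supermodule M" "supermodule N"
  shows "f \<zero>\<^bsub>M\<^esub> = \<zero>\<^bsub>N\<^esub>"
proof -
  interpret M: supermodule M by fact
  interpret N: supermodule N by fact
  have "f (0 \<odot>\<^bsub>M\<^esub> \<zero>\<^bsub>M\<^esub>) = 0 \<odot>\<^bsub>N\<^esub> f \<zero>\<^bsub>M\<^esub>" by (rule conf_homD(3)[OF assms(1)]) simp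
  then show ?thesis
    using M.smult_l_null[of "\<zero>\<^bsub>M\<^esub>"] N.smult_l_null[of "f \<zero>\<^bsub>M\<^esub>"] conf_homD(1)[OF assms(1)] by simp
qed

lemma conf_iso_refl: "conf_iso R M M"
  unfolding conf_iso_iff by (rule exI[of _ id]) (auto simp: conf_hom_def)

lemma conf_hom_comp:
  "\<lbrakk>conf_hom R M N f; conf_hom R N P g\<rbrakk> \<Longrightarrow> conf_hom R M P (g \<circ> f)"
  unfolding conf_hom_def by simp

lemma conf_iso_trans:
  assumes "conf_iso R M N" "conf_iso R N P"
  shows "conf_iso R M P"
proof -
  obtain f where f: "conf_hom R M N f" "bij_betw f (carrier M) (carrier N)" "\<And>s. f ` grade M s = grade N s"
    using assms(1) unfolding conf_iso_iff by blast
  obtain g where g: "conf_hom R N P g" "bij_betw g (carrier N) (carrier P)" "\<And>s. g ` grade N s = grade P s"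
    using assms(2) unfolding conf_iso_iff by blast
  show ?thesis
    unfolding conf_iso_iff
    using conf_hom_comp[OF f(1) g(1)] bij_betw_trans[OF f(2) g(2)] f(3) g(3)
    by (intro exI[of _ "g \<circ> f"]) (simp add: image_comp[symmetric] del: o_apply)
qed

text \<open>The fragment of the module axioms that inverses, images and preimages under
  homomorphisms rely on. For a free module it involves no identity between structure
  constants.\<close>

definition closed_conf :: "('r, 'r) conf \<Rightarrow> ('r, 'v) conf \<Rightarrow> bool" where
  "closed_conf R M \<longleftrightarrow> supermodule M \<and> (\<forall>a\<in>carrier R. \<forall>v\<in>carrier M. \<forall>n. lact M a v n \<in> carrier M)"

lemma closed_confD: "closed_conf R M \<Longrightarrow> supermodule M"
  "\<lbrakk>closed_conf R M; a \<in> carrier R; v \<in> carrier M\<rbrakk> \<Longrightarrow> lact M a v n \<in> carrier M"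
  unfolding closed_conf_def by blast+

lemma conformal_module_closed: "conformal_module R M \<Longrightarrow> closed_conf R M"
  unfolding closed_conf_def
  by (meson conformal_module_def conformal_module_supermodule lambda_action.lact_closed)

lemma conf_iso_sym:
  assumes "conf_iso R M N" and M: "closed_conf R M"
  shows "conf_iso R N M"
proof -
  interpret supermodule M by (rule closed_confD(1)[OF M])
  obtain f where f: "conf_hom R M N f" "bij_betw f (carrier M) (carrier N)" and fg: "\<And>s. f ` grade M s = grade N s"
    using assms(1) unfolding conf_iso_iff by blast
  define g where "g = inv_into (carrier M) f"
  have inj: "inj_on f (carrier M)" and im: "f ` carrier M = carrier N"
    using f(2) by (auto simp: bij_betw_def)
  have gf: "g (f v) = v" if "v \<in> carrier M" for v
    unfolding g_def using inj that by (rule inv_into_f_f)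
  have ex: "\<exists>v\<in>carrier M. w = f v" if "w \<in> carrier N" for w
    using im that by blast
  have gg: "g ` grade N s = grade M s" for s
    unfolding fg[symmetric] image_comp using gf grade_in by force
  have "conf_hom R N M g"
    unfolding conf_hom_def
  proof (intro conjI ballI allI)
    fix w assume "w \<in> carrier N"
    then obtain v where v: "v \<in> carrier M" "w = f v" using ex by blast
    show "g w \<in> carrier M" using v gf by simp
    show "g (q \<odot>\<^bsub>N\<^esub> w) = q \<odot>\<^bsub>M\<^esub> g w" for q
      using gf[of "q \<odot>\<^bsub>M\<^esub> v"] v gf[OF v(1)] conf_homD(3)[OF f(1) v(1), of q] by simp
    show "g (lact N a w n) = lact M a (g w) n" if "a \<in> carrier R" for a n
      using gf[of "lact M a v n"] v gf[OF v(1)] conf_homD(5)[OF f(1) that v(1), of n]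
        closed_confD(2)[OF M that v(1)] by simp
    fix w' assume "w' \<in> carrier N"
    then obtain v' where v': "v' \<in> carrier M" "w' = f v'" using ex by blast
    show "g (w \<oplus>\<^bsub>N\<^esub> w') = g w \<oplus>\<^bsub>M\<^esub> g w'"
      using gf[of "v \<oplus>\<^bsub>M\<^esub> v'"] v v' gf[OF v(1)] gf[OF v'(1)] conf_homD(2)[OF f(1) v(1) v'(1)] by simp
  next
    show "g w \<in> grade M s" if "w \<in> grade N s" for w s using gg that by blast
  qed
  moreover have "bij_betw g (carrier N) (carrier M)"
    unfolding g_def using f(2) by (rule bij_betw_inv_into)
  ultimately show ?thesis unfolding conf_iso_iff using gg by blast
qed

section \<open>Transport of the module axioms along a surjection\<close>

text \<open>The Jacobi axiom contains a finite sum, so transporting it requires that sums commute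
  with a map which is additive on \<open>X\<close> only.\<close>

lemma finsum_image:
  assumes M: "supermodule M" and M': "supermodule M'" and X: "conf_sub R M X"
    and f: "\<And>u. u \<in> X \<Longrightarrow> f u \<in> carrier M'"
    and add: "\<And>u v. \<lbrakk>u \<in> X; v \<in> X\<rbrakk> \<Longrightarrow> f (u \<oplus>\<^bsub>M\<^esub> v) = f u \<oplus>\<^bsub>M'\<^esub> f v"
    and zero: "f \<zero>\<^bsub>M\<^esub> = \<zero>\<^bsub>M'\<^esub>"
    and "finite A" and g: "\<And>a. a \<in> A \<Longrightarrow> g a \<in> X"
  shows "finsum M g A \<in> X \<and> f (finsum M g A) = finsum M' (\<lambda>a. f (g a)) A"
  using \<open>finite A\<close> g
proof (induction A)
  case empty
  interpret M: supermodule M by fact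
  interpret M': supermodule M' by fact
  show ?case using zero conf_subD(2)[OF X] by simp
next
  case (insert a A)
  interpret M: supermodule M by fact
  interpret M': supermodule M' by fact
  have "finsum M g (insert a A) = g a \<oplus>\<^bsub>M\<^esub> finsum M g A"
    using insert conf_subD(1)[OF X] by (intro M.M.finsum_insert) auto
  moreover have "finsum M' (\<lambda>a. f (g a)) (insert a A) = f (g a) \<oplus>\<^bsub>M'\<^esub> finsum M' (\<lambda>a. f (g a)) A"
    using insert f by (intro M'.M.finsum_insert) auto
  ultimately show ?case using insert add conf_subD(3)[OF X] by simp
qed

text \<open>The shift \<open>e\<close> of the parity makes the lemmas apply to the reversal of parity as well as to submodules
  and quotients.\<close>

lemma image_supermodule:
  fixes M :: "('r, 'v) conf" and M' :: "('r, 'w) conf"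
  assumes M: "supermodule M" and X: "conf_sub R M X"
    and carr: "carrier M' = f ` X"
    and zero: "\<zero>\<^bsub>M'\<^esub> = f \<zero>\<^bsub>M\<^esub>"
    and add: "\<And>u v. \<lbrakk>u \<in> X; v \<in> X\<rbrakk> \<Longrightarrow> f u \<oplus>\<^bsub>M'\<^esub> f v = f (u \<oplus>\<^bsub>M\<^esub> v)"
    and smult: "\<And>q v. v \<in> X \<Longrightarrow> q \<odot>\<^bsub>M'\<^esub> f v = f (q \<odot>\<^bsub>M\<^esub> v)"
    and grade: "\<And>s. grade M' s = f ` (X \<inter> grade M (s + e))"
    and inter: "\<And>u v. \<lbrakk>u \<in> X; u \<in> grade M 0; v \<in> X; v \<in> grade M 1; f u = f v\<rbrakk> \<Longrightarrow> f u = f \<zero>\<^bsub>M\<^esub>"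
  shows "supermodule M'"
    and "\<And>v. v \<in> X \<Longrightarrow> \<ominus>\<^bsub>M'\<^esub> f v = f (\<ominus>\<^bsub>M\<^esub> v)"
proof -
  interpret M: supermodule M by (rule M)
  note X' = conf_subD[OF X]
  have Xc: "\<And>v. v \<in> X \<Longrightarrow> v \<in> carrier M" by (rule X'(1))
  have Xn: "\<And>v. v \<in> X \<Longrightarrow> \<ominus>\<^bsub>M\<^esub> v \<in> X" by (rule M.conf_sub_minus[OF X])
  have ab: "abelian_group M'"
  proof (rule abelian_groupI)
    fix x y z assume "x \<in> carrier M'" "y \<in> carrier M'" "z \<in> carrier M'"
    then obtain u v w where *: "u \<in> X" "v \<in> X" "w \<in> X" "x = f u" "y = f v" "z = f w"
      unfolding carr by blast
    show "x \<oplus>\<^bsub>M'\<^esub> y \<oplus>\<^bsub>M'\<^esub> z = x \<oplus>\<^bsub>M'\<^esub> (y \<oplus>\<^bsub>M'\<^esub> z)"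
      using * X'(3) by (simp add: add M.M.a_assoc Xc)
    show "x \<oplus>\<^bsub>M'\<^esub> y = y \<oplus>\<^bsub>M'\<^esub> x"
      using * X'(3) by (simp add: add M.M.a_comm Xc)
    show "x \<oplus>\<^bsub>M'\<^esub> y \<in> carrier M'" using * X'(3) by (simp add: add carr)
    show "\<zero>\<^bsub>M'\<^esub> \<oplus>\<^bsub>M'\<^esub> x = x" using * X'(2) by (simp add: add zero Xc)
    have "f (\<ominus>\<^bsub>M\<^esub> u) \<oplus>\<^bsub>M'\<^esub> x = \<zero>\<^bsub>M'\<^esub>" using * Xn by (simp add: add zero M.M.l_neg Xc)
    then show "\<exists>y\<in>carrier M'. y \<oplus>\<^bsub>M'\<^esub> x = \<zero>\<^bsub>M'\<^esub>" using Xn[OF *(1)] unfolding carr by blast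
  next
    show "\<zero>\<^bsub>M'\<^esub> \<in> carrier M'" using X'(2) by (simp add: zero carr)
  qed
  have mod: "Module.module CD M'"
  proof (rule moduleI[OF cring_CD ab])
    fix q q' x y assume "x \<in> carrier M'" "y \<in> carrier M'"
    then obtain u v where *: "u \<in> X" "v \<in> X" "x = f u" "y = f v"
      unfolding carr by blast
    show "q \<odot>\<^bsub>M'\<^esub> x \<in> carrier M'" using * X'(4) by (simp add: smult carr)
    show "(q \<oplus>\<^bsub>CD\<^esub> q') \<odot>\<^bsub>M'\<^esub> x = q \<odot>\<^bsub>M'\<^esub> x \<oplus>\<^bsub>M'\<^esub> q' \<odot>\<^bsub>M'\<^esub> x"
      using * X'(4) M.smult_l_distr[of q q' u] Xc by (simp add: smult add)
    show "q \<odot>\<^bsub>M'\<^esub> (x \<oplus>\<^bsub>M'\<^esub> y) = q \<odot>\<^bsub>M'\<^esub> x \<oplus>\<^bsub>M'\<^esub> q \<odot>\<^bsub>M'\<^esub> y"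
      using * X'(3,4) M.smult_r_distr[of q u v] Xc by (simp add: smult add)
    show "(q \<otimes>\<^bsub>CD\<^esub> q') \<odot>\<^bsub>M'\<^esub> x = q \<odot>\<^bsub>M'\<^esub> (q' \<odot>\<^bsub>M'\<^esub> x)"
      using * X'(4) M.smult_assoc1[of q q' u] Xc by (simp add: smult)
    show "\<one>\<^bsub>CD\<^esub> \<odot>\<^bsub>M'\<^esub> x = x"
      using * M.smult_one[of u] Xc by (simp add: smult)
  qed
  interpret M'0: Module.module CD M' by (rule mod)
  show inv: "\<ominus>\<^bsub>M'\<^esub> f v = f (\<ominus>\<^bsub>M\<^esub> v)" if v: "v \<in> X" for v
  proof (rule M'0.M.minus_equality)
    show "f (\<ominus>\<^bsub>M\<^esub> v) \<oplus>\<^bsub>M'\<^esub> f v = \<zero>\<^bsub>M'\<^esub>" using v Xn by (simp add: add zero M.M.l_neg Xc)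
  qed (use v Xn carr in blast)+
  show "supermodule M'"
  proof (intro supermodule.intro[OF mod] supermodule_axioms.intro)
    fix s
    show "submodule (grade M' s) CD M'"
    proof (rule M'0.submoduleI)
      show "grade M' s \<subseteq> carrier M'" unfolding grade carr by blast
      show "\<zero>\<^bsub>M'\<^esub> \<in> grade M' s" unfolding grade zero using X'(2) M.zero_in_grade by blast
      show "\<ominus>\<^bsub>M'\<^esub> x \<in> grade M' s" if x: "x \<in> grade M' s" for x
        using x Xn M.minus_in_grade unfolding grade by (auto simp: inv)
      show "x \<oplus>\<^bsub>M'\<^esub> y \<in> grade M' s" if x: "x \<in> grade M' s" "y \<in> grade M' s" for x y
        using x X'(3) M.add_in_grade unfolding grade by (auto simp: add)
      show "q \<odot>\<^bsub>M'\<^esub> x \<in> grade M' s" if x: "x \<in> grade M' s" for q x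
        using x X'(4) M.smult_in_grade unfolding grade by (auto simp: smult)
    qed
  next
    show "grade M' 0 <+>\<^bsub>M'\<^esub> grade M' 1 = carrier M'"
    proof
      show "grade M' 0 <+>\<^bsub>M'\<^esub> grade M' 1 \<subseteq> carrier M'"
        unfolding grade carr using X'(3) by (auto simp: add elim!: set_addE)
      show "carrier M' \<subseteq> grade M' 0 <+>\<^bsub>M'\<^esub> grade M' 1"
      proof
        fix x assume "x \<in> carrier M'"
        then obtain v where v: "v \<in> X" "x = f v" unfolding carr by blast
        then obtain v0 v1 where w: "v0 \<in> grade M 0" "v1 \<in> grade M 1" "v = v0 \<oplus>\<^bsub>M\<^esub> v1"
          using M.grade_split Xc by blast
        then have "v0 \<in> X" "v1 \<in> X" using v X'(6,7) by blast+
        then show "x \<in> grade M' 0 <+>\<^bsub>M'\<^esub> grade M' 1"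
        proof (cases "e = 0")
          case True
          then show ?thesis
            unfolding grade v(2) w(3) using w(1,2) \<open>v0 \<in> X\<close> \<open>v1 \<in> X\<close> add[symmetric] by (auto intro!: set_addI)
        next
          case False
          then have "f v1 \<in> grade M' 0" "f v0 \<in> grade M' 1"
            unfolding grade using w(1,2) \<open>v0 \<in> X\<close> \<open>v1 \<in> X\<close> by auto
          from set_addI[OF this, of M'] show ?thesis
            using \<open>v0 \<in> X\<close> \<open>v1 \<in> X\<close> unfolding v(2) w(3) by (simp add: add M.M.a_comm Xc)
        qed
      qed
    qed
    show "grade M' 0 \<inter> grade M' 1 = {\<zero>\<^bsub>M'\<^esub>}"
    proof
      show "{\<zero>\<^bsub>M'\<^esub>} \<subseteq> grade M' 0 \<inter> grade M' 1"
        unfolding grade zero using X'(2) M.zero_in_grade by blast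
      show "grade M' 0 \<inter> grade M' 1 \<subseteq> {\<zero>\<^bsub>M'\<^esub>}"
      proof
        fix x assume "x \<in> grade M' 0 \<inter> grade M' 1"
        then obtain u v where "u \<in> X" "u \<in> grade M 0" "v \<in> X" "v \<in> grade M 1" "x = f u" "x = f v"
          unfolding grade by (cases "e = 0") auto
        then show "x \<in> {\<zero>\<^bsub>M'\<^esub>}" using inter[of u v] by (simp add: zero)
      qed
    qed
  qed
qed

lemma image_conformal_module:
  fixes M :: "('r, 'v) conf" and M' :: "('r, 'w) conf"
  assumes M: "conformal_module R M" and X: "conf_sub R M X"
    and carr: "carrier M' = f ` X"
    and zero: "\<zero>\<^bsub>M'\<^esub> = f \<zero>\<^bsub>M\<^esub>"
    and add: "\<And>u v. \<lbrakk>u \<in> X; v \<in> X\<rbrakk> \<Longrightarrow> f u \<oplus>\<^bsub>M'\<^esub> f v = f (u \<oplus>\<^bsub>M\<^esub> v)"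
    and smult: "\<And>q v. v \<in> X \<Longrightarrow> q \<odot>\<^bsub>M'\<^esub> f v = f (q \<odot>\<^bsub>M\<^esub> v)"
    and grade: "\<And>s. grade M' s = f ` (X \<inter> grade M (s + e))"
    and inter: "\<And>u v. \<lbrakk>u \<in> X; u \<in> grade M 0; v \<in> X; v \<in> grade M 1; f u = f v\<rbrakk> \<Longrightarrow> f u = f \<zero>\<^bsub>M\<^esub>"
    and act: "\<And>a v n. \<lbrakk>a \<in> carrier R; v \<in> X\<rbrakk> \<Longrightarrow> lact M' a (f v) n = f (lact M a v n)"
  shows "conformal_module R M'"
proof -
  interpret M: supermodule M by (rule conformal_module_supermodule[OF M])
  interpret R: supermodule R by (rule conformal_moduleD(1)[OF M])
  interpret RR: lambda_action R R by (rule conformal_moduleD(2)[OF M])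
  interpret L: lambda_action R M by (rule conformal_moduleD(3)[OF M])
  note X' = conf_subD[OF X]
  have Xc: "\<And>v. v \<in> X \<Longrightarrow> v \<in> carrier M" by (rule X'(1))
  have Xn: "\<And>v. v \<in> X \<Longrightarrow> \<ominus>\<^bsub>M\<^esub> v \<in> X" by (rule M.conf_sub_minus[OF X])
  have super: "supermodule M'"
    by (rule image_supermodule(1)[OF M.supermodule_axioms X carr zero add smult grade inter])
  have inv: "\<ominus>\<^bsub>M'\<^esub> f v = f (\<ominus>\<^bsub>M\<^esub> v)" if "v \<in> X" for v
    by (rule image_supermodule(2)[OF M.supermodule_axioms X carr zero add smult grade inter that])
  interpret M': supermodule M' by (rule super)
  have fc: "\<And>u. u \<in> X \<Longrightarrow> f u \<in> carrier M'" unfolding carr by blast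
  have L: "lambda_action R M'"
  proof (intro lambda_action.intro lambda_action_axioms.intro R.supermodule_axioms super)
    fix a x n assume a: "a \<in> carrier R" and "x \<in> carrier M'"
    then obtain v where v: "v \<in> X" "x = f v" unfolding carr by blast
    note vc = Xc[OF v(1)]
    have av: "\<And>n. lact M a v n \<in> X" using X'(5) a v by blast
    show "lact M' a x n \<in> carrier M'" using a v av fc by (simp add: act)
    have "{n. lact M' a x n \<noteq> \<zero>\<^bsub>M'\<^esub>} \<subseteq> {n. lact M a v n \<noteq> \<zero>\<^bsub>M\<^esub>}"
      using a v by (auto simp: act zero)
    then show "finite {n. lact M' a x n \<noteq> \<zero>\<^bsub>M'\<^esub>}"
      using L.lact_finite[OF a vc] finite_subset by blast
    show "lact M' (a \<oplus>\<^bsub>R\<^esub> b) x n = lact M' a x n \<oplus>\<^bsub>M'\<^esub> lact M' b x n" if b: "b \<in> carrier R" for b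
      using a b v av X'(5)[OF b v(1)] L.lact_add_left[OF a b vc] R.M.a_closed[OF a b] by (simp add: act add)
    show "lact M' a (x \<oplus>\<^bsub>M'\<^esub> y) n = lact M' a x n \<oplus>\<^bsub>M'\<^esub> lact M' a y n" if y: "y \<in> carrier M'" for y
    proof -
      obtain w where w: "w \<in> X" "y = f w" using y unfolding carr by blast
      show ?thesis
        using a v w av X'(5)[OF a w(1)] X'(3)[OF v(1) w(1)] L.lact_add_right[OF a vc Xc[OF w(1)]]
        by (simp add: act add)
    qed
    show "lact M' ([:c:] \<odot>\<^bsub>R\<^esub> a) x n = [:c:] \<odot>\<^bsub>M'\<^esub> lact M' a x n" for c
      using a v av L.lact_scale_left[OF a vc] by (simp add: act smult)
    show "lact M' a ([:c:] \<odot>\<^bsub>M'\<^esub> x) n = [:c:] \<odot>\<^bsub>M'\<^esub> lact M' a x n" for c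
      using a v av X'(4)[OF v(1)] L.lact_scale_right[OF a vc] by (simp add: act smult)
    show "lact M' ([:0, 1:] \<odot>\<^bsub>R\<^esub> a) x n = (case n of 0 \<Rightarrow> \<zero>\<^bsub>M'\<^esub> | Suc k \<Rightarrow> \<ominus>\<^bsub>M'\<^esub> lact M' a x k)"
      using a v av L.sesquilinear_left[OF a vc] by (simp add: act zero inv split: nat.split)
    show "lact M' a ([:0, 1:] \<odot>\<^bsub>M'\<^esub> x) n =
        [:0, 1:] \<odot>\<^bsub>M'\<^esub> lact M' a x n \<oplus>\<^bsub>M'\<^esub> (case n of 0 \<Rightarrow> \<zero>\<^bsub>M'\<^esub> | Suc k \<Rightarrow> lact M' a x k)"
      using a v av X'(2) X'(4)[OF v(1)] X'(4)[OF av] L.sesquilinear_right[OF a vc]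
      by (simp add: act smult add zero split: nat.split)
  next
    fix a s x t n assume a: "a \<in> grade R s" and x: "x \<in> grade M' t"
    then obtain v where v: "v \<in> X" "v \<in> grade M (t + e)" "x = f v" unfolding grade by blast
    have ac: "a \<in> carrier R" by (rule R.grade_in[OF a])
    show "lact M' a x n \<in> grade M' (s + t)"
      using L.lact_parity[OF a v(2)] X'(5)[OF ac v(1)]
      unfolding v(3) act[OF ac v(1)] grade add.assoc by blast
  next
    fix a s b t x m n assume a: "a \<in> grade R s" and b: "b \<in> grade R t" and "x \<in> carrier M'"
    then obtain v where v: "v \<in> X" "x = f v" unfolding carr by blast
    have ac: "a \<in> carrier R" and bc: "b \<in> carrier R" using a b R.grade_in by blast+
    have bra: "\<And>k. lact R a b k \<in> carrier R" using RR.lact_closed[OF ac bc] by blast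
    let ?g = "\<lambda>k. [:of_nat ((m - k + n) choose n):] \<odot>\<^bsub>M\<^esub> lact M (lact R a b k) v (m - k + n)"
    have fin: "f (finsum M ?g {..m}) = finsum M' (\<lambda>k. f (?g k)) {..m}"
      using finsum_image[OF M.supermodule_axioms super X, where f = f and A = "{..m}" and g = ?g] fc X'(4,5) bra v
      by (simp add: add zero)
    have ab: "lact M a (lact M b v n) m \<in> X" "lact M b (lact M a v m) n \<in> X"
      using X'(5) ac bc v by blast+
    have "finsum M' (\<lambda>k. [:of_nat ((m - k + n) choose n):] \<odot>\<^bsub>M'\<^esub> lact M' (lact R a b k) x (m - k + n)) {..m}
        = finsum M' (\<lambda>k. f (?g k)) {..m}"
      using X'(5)[OF bra v(1)] by (simp add: v(2) act[OF bra v(1)] smult)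
    also have "\<dots> = f (lact M a (lact M b v n) m \<ominus>\<^bsub>M\<^esub> [:ksign s t:] \<odot>\<^bsub>M\<^esub> lact M b (lact M a v m) n)"
      unfolding fin[symmetric] L.jacobi[OF a b Xc[OF v(1)]] ..
    also have "\<dots> = lact M' a (lact M' b x n) m \<ominus>\<^bsub>M'\<^esub> [:ksign s t:] \<odot>\<^bsub>M'\<^esub> lact M' b (lact M' a x m) n"
      using ab v X'(4)[OF ab(2)] Xn X'(5)[OF ac v(1)] X'(5)[OF bc v(1)]
      by (simp add: M.M.minus_eq M'.M.minus_eq add[symmetric] inv[symmetric] smult act ac bc)
    finally show "finsum M' (\<lambda>k. [:of_nat ((m - k + n) choose n):] \<odot>\<^bsub>M'\<^esub> lact M' (lact R a b k) x (m - k + n)) {..m}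
        = lact M' a (lact M' b x n) m \<ominus>\<^bsub>M'\<^esub> [:ksign s t:] \<odot>\<^bsub>M'\<^esub> lact M' b (lact M' a x m) n" .
  qed
  show ?thesis
    unfolding conformal_module_def using conformal_moduleD(4)[OF M] L by blast
qed

section \<open>Submodules and quotients as modules\<close>

lemma sub_conf_simps [simp]:
  "carrier (sub_conf M N) = N" "zero (sub_conf M N) = zero M" "add (sub_conf M N) = add M"
  "module.smult (sub_conf M N) = module.smult M" "grade (sub_conf M N) s = N \<inter> grade M s"
  "lact (sub_conf M N) = lact M"
  by (simp_all add: sub_conf_def)

lemma conformal_module_sub_conf:
  "conformal_module R M \<Longrightarrow> conf_sub R M X \<Longrightarrow> conformal_module R (sub_conf M X)"
  by (rule image_conformal_module[of R M X _ "\<lambda>v. v" 0])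
     (auto dest: supermodule.grade_disjoint[OF conformal_module_supermodule])

lemma conf_sub_sub_conf:
  assumes X: "conf_sub R M X"
  shows "conf_sub R (sub_conf M X) Z \<longleftrightarrow> conf_sub R M Z \<and> Z \<subseteq> X"
proof
  assume Z: "conf_sub R (sub_conf M X) Z"
  note Z' = conf_subD[OF Z, unfolded sub_conf_simps]
  have "conf_sub R M Z"
  proof (rule conf_subI)
    show "Z \<subseteq> carrier M" using Z'(8) conf_subD(8)[OF X] by simp
    fix u v assume uv: "u \<in> grade M 0" "v \<in> grade M 1" "u \<oplus>\<^bsub>M\<^esub> v \<in> Z"
    then have "u \<oplus>\<^bsub>M\<^esub> v \<in> X" using Z'(1) by simp
    then have "u \<in> X" "v \<in> X" using conf_subD(6,7)[OF X uv(1,2)] by simp_all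
    then show "u \<in> Z \<and> v \<in> Z" using Z'(6,7)[of u v] uv by simp
  qed (rule Z'(2-5); assumption)+
  then show "conf_sub R M Z \<and> Z \<subseteq> X" using Z'(8) by simp
next
  assume "conf_sub R M Z \<and> Z \<subseteq> X"
  then have Z: "conf_sub R M Z" "Z \<subseteq> X" by simp_all
  show "conf_sub R (sub_conf M X) Z"
  proof (rule conf_subI)
    show "u \<in> Z \<and> v \<in> Z" if "u \<in> grade (sub_conf M X) 0" "v \<in> grade (sub_conf M X) 1"
      "u \<oplus>\<^bsub>sub_conf M X\<^esub> v \<in> Z" for u v
      using that conf_subD(6,7)[OF Z(1), of u v] by simp
  qed (unfold sub_conf_simps, rule Z(2) conf_subD(2-5)[OF Z(1)]; assumption)+
qed

lemma (in supermodule) coset_eq_iff: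
  assumes N: "conf_sub R M N" and "u \<in> carrier M" "v \<in> carrier M"
  shows "N +> u = N +> v \<longleftrightarrow> u \<ominus> v \<in> N"
proof -
  interpret N: submodule N CD M by (rule conf_sub_submodule[OF N])
  interpret A: abelian_subgroup N M
    by (rule abelian_subgroupI3) (simp_all add: additive_subgroup_def N.subgroup_axioms M.abelian_group_axioms)
  have "u \<in> N +> v \<longleftrightarrow> u \<ominus> v \<in> N"
    using A.a_rcos_module[of v u] assms by (simp add: M.minus_eq)
  moreover have "u \<in> N +> v \<longleftrightarrow> N +> u = N +> v"
    using A.a_repr_independence'[of u v] A.a_rcos_self[of u] assms by auto
  ultimately show ?thesis by simp
qed

text \<open>The operations on cosets are defined as unions over representatives. Each union
  collapses to a single coset because the operation sends differences in \<open>N\<close> to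
  differences in \<open>N\<close>; from here on cosets are handled through representatives.\<close>

lemma (in supermodule)
  assumes N: "conf_sub R M N"
  shows carrier_quot_conf: "carrier (quot_conf M N) = (\<lambda>v. N +> v) ` carrier M"
    and zero_quot_conf: "\<zero>\<^bsub>quot_conf M N\<^esub> = N +> \<zero>"
    and add_quot_conf: "\<lbrakk>u \<in> carrier M; v \<in> carrier M\<rbrakk>
      \<Longrightarrow> (N +> u) \<oplus>\<^bsub>quot_conf M N\<^esub> (N +> v) = N +> (u \<oplus> v)"
    and smult_quot_conf: "v \<in> carrier M \<Longrightarrow> q \<odot>\<^bsub>quot_conf M N\<^esub> (N +> v) = N +> (q \<odot> v)"
    and lact_quot_conf: "\<lbrakk>lambda_action R M; a \<in> carrier R; v \<in> carrier M\<rbrakk>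
      \<Longrightarrow> lact (quot_conf M N) a (N +> v) n = N +> lact M a v n"
    and grade_quot_conf: "grade (quot_conf M N) s = (\<lambda>v. N +> v) ` grade M s"
proof -
  interpret N: submodule N CD M by (rule conf_sub_submodule[OF N])
  interpret A: abelian_subgroup N M
    by (rule abelian_subgroupI3) (simp_all add: additive_subgroup_def N.subgroup_axioms M.abelian_group_axioms)
  show "carrier (quot_conf M N) = (\<lambda>v. N +> v) ` carrier M"
    by (auto simp: quot_conf_def A_RCOSETS_def' a_r_coset_def')
  show "\<zero>\<^bsub>quot_conf M N\<^esub> = N +> \<zero>"
    using conf_subD(8)[OF N] by (simp add: quot_conf_def)
  show "\<lbrakk>u \<in> carrier M; v \<in> carrier M\<rbrakk> \<Longrightarrow> (N +> u) \<oplus>\<^bsub>quot_conf M N\<^esub> (N +> v) = N +> (u \<oplus> v)"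
    by (simp add: quot_conf_def A.a_rcos_sum)
  show "grade (quot_conf M N) s = (\<lambda>v. N +> v) ` grade M s"
    by (simp add: quot_conf_def)
  have self: "u \<in> N +> u" if "u \<in> carrier M" for u by (rule A.a_rcos_self[OF that])
  have mem: "w \<in> carrier M \<and> w \<ominus> v \<in> N" if "w \<in> N +> v" "v \<in> carrier M" for v w
    using that A.a_elemrcos_carrier coset_eq_iff[OF N] A.a_repr_independence'
    by (metis)
  have const: "(\<Union>w\<in>N +> v. N +> g w) = N +> g v"
    if v: "v \<in> carrier M" and g: "\<And>w. w \<in> carrier M \<Longrightarrow> g w \<in> carrier M"
      "\<And>w. \<lbrakk>w \<in> carrier M; w \<ominus> v \<in> N\<rbrakk> \<Longrightarrow> g w \<ominus> g v \<in> N" for g v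
  proof -
    have "N +> g w = N +> g v" if "w \<in> N +> v" for w
      using mem[OF that v] g v coset_eq_iff[OF N] by blast
    then show ?thesis using self[OF v] by blast
  qed
  have minus: "u \<oplus> [:- 1:] \<odot> v = u \<ominus> v" if "v \<in> carrier M" for u v
    using that by (simp add: smult_minus_one M.minus_eq)
  show "v \<in> carrier M \<Longrightarrow> q \<odot>\<^bsub>quot_conf M N\<^esub> (N +> v) = N +> (q \<odot> v)"
  proof -
    assume v: "v \<in> carrier M"
    have "q \<odot> w \<ominus> q \<odot> v \<in> N" if "w \<in> carrier M" "w \<ominus> v \<in> N" for w
    proof -
      have "q \<odot> (w \<oplus> \<ominus> v) = q \<odot> w \<ominus> q \<odot> v"
        using that(1) v smult_r_distr[of q w "\<ominus> v"] smult_r_minus[of q v] by (simp add: M.minus_eq)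
      then show ?thesis using conf_subD(4)[OF N that(2), of q] by (simp add: M.minus_eq)
    qed
    then show ?thesis using const[OF v, of "\<lambda>w. q \<odot> w"] by (simp add: quot_conf_def)
  qed
  show "lact (quot_conf M N) a (N +> v) n = N +> lact M a v n"
    if L: "lambda_action R M" and a: "a \<in> carrier R" and v: "v \<in> carrier M"
  proof -
    interpret L: lambda_action R M by (rule L)
    have "lact M a w n \<ominus> lact M a v n \<in> N" if w: "w \<in> carrier M" "w \<ominus> v \<in> N" for w
    proof -
      have "lact M a (w \<oplus> [:- 1:] \<odot> v) n = lact M a w n \<oplus> [:- 1:] \<odot> lact M a v n"
        using L.lact_add_right[OF a w(1), of "[:- 1:] \<odot> v"] L.lact_scale_right[OF a v, of "- 1"] v by simp
      then have "lact M a (w \<ominus> v) n = lact M a w n \<ominus> lact M a v n"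
        using minus v L.lact_closed[OF a v] by simp
      then show ?thesis using conf_subD(5)[OF N a w(2), of n] by simp
    qed
    then show ?thesis
      using const[OF v, of "\<lambda>w. lact M a w n"] L.lact_closed[OF a] by (simp add: quot_conf_def)
  qed
qed

lemma conformal_module_quot_conf:
  assumes M: "conformal_module R M" and N: "conf_sub R M N"
  shows "conformal_module R (quot_conf M N)"
proof -
  interpret supermodule M by (rule conformal_module_supermodule[OF M])
  have c: "conf_sub R M (carrier M)"
    unfolding conf_sub_def using grade_in conformal_module_closed[OF M] closed_confD(2) by auto
  show ?thesis
  proof (rule image_conformal_module[OF M c, where f = "\<lambda>v. N +>\<^bsub>M\<^esub> v" and e = 0])
    fix u v assume uv: "u \<in> carrier M" "u \<in> grade M 0" "v \<in> carrier M" "v \<in> grade M 1"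
      "N +>\<^bsub>M\<^esub> u = N +>\<^bsub>M\<^esub> v"
    then have "u \<oplus>\<^bsub>M\<^esub> \<ominus>\<^bsub>M\<^esub> v \<in> N" using coset_eq_iff[OF N] by (simp add: M.minus_eq)
    \<comment> \<open>If an even \<open>u\<close> and an odd \<open>v\<close> represent the same
      coset, then \<open>u\<close> is the even component of \<open>u - v\<close>, and gradedness of
      \<open>N\<close> puts it into \<open>N\<close>: a coset that is both even and odd is
      zero.\<close>
    then have "u \<in> N" using conf_subD(6)[OF N uv(2)] minus_in_grade[OF uv(4)] by blast
    moreover have "u \<oplus>\<^bsub>M\<^esub> \<ominus>\<^bsub>M\<^esub> \<zero>\<^bsub>M\<^esub> = u" using uv(1) by (simp add: M.add.inv_one)
    ultimately show "N +>\<^bsub>M\<^esub> u = N +>\<^bsub>M\<^esub> \<zero>\<^bsub>M\<^esub>" using coset_eq_iff[OF N uv(1)] by (simp add: M.minus_eq)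
  next
    show "grade (quot_conf M N) s = (\<lambda>v. N +>\<^bsub>M\<^esub> v) ` (carrier M \<inter> grade M (s + 0))" for s
      using grade_quot_conf[OF N] grade_in by (auto simp: image_def)
  qed (use carrier_quot_conf[OF N] zero_quot_conf[OF N] add_quot_conf[OF N] smult_quot_conf[OF N]
         lact_quot_conf[OF N conformal_moduleD(3)[OF M]] in simp_all)
qed

lemma conf_hom_minus:
  assumes "conf_hom R M N f" "supermodule M" "supermodule N" "u \<in> carrier M" "v \<in> carrier M"
  shows "f (u \<ominus>\<^bsub>M\<^esub> v) = f u \<ominus>\<^bsub>N\<^esub> f v"
proof -
  interpret M: supermodule M by fact
  interpret N: supermodule N by fact
  have "f (u \<oplus>\<^bsub>M\<^esub> [:- 1:] \<odot>\<^bsub>M\<^esub> v) = f u \<oplus>\<^bsub>N\<^esub> [:- 1:] \<odot>\<^bsub>N\<^esub> f v"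
    using conf_homD(2,3)[OF assms(1)] assms(4,5) by simp
  then show ?thesis
    using conf_homD(1)[OF assms(1)] assms(4,5)
    by (simp add: M.smult_minus_one N.smult_minus_one M.M.minus_eq N.M.minus_eq)
qed

lemma conf_sub_vimage:
  assumes h: "conf_hom R M S h" and M: "closed_conf R M" and S: "supermodule S" and Z: "conf_sub R S Z"
  shows "conf_sub R M {v \<in> carrier M. h v \<in> Z}"
proof -
  interpret M: supermodule M by (rule closed_confD(1)[OF M])
  interpret S: supermodule S by (rule S)
  note h' = conf_homD[OF h]
  show ?thesis
  proof (rule conf_subI)
    show "\<zero>\<^bsub>M\<^esub> \<in> {v \<in> carrier M. h v \<in> Z}"
      using conf_hom_zero[OF h M.supermodule_axioms S] conf_subD(2)[OF Z] by simp
    fix u v assume uv: "u \<in> grade M 0" "v \<in> grade M 1" "u \<oplus>\<^bsub>M\<^esub> v \<in> {v \<in> carrier M. h v \<in> Z}"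
    then have c: "u \<in> carrier M" "v \<in> carrier M" using M.grade_in by blast+
    show "u \<in> {v \<in> carrier M. h v \<in> Z} \<and> v \<in> {v \<in> carrier M. h v \<in> Z}"
      using conf_subD(6,7)[OF Z h'(4)[OF uv(1)] h'(4)[OF uv(2)]] h'(2)[OF c] uv(3) c by simp
  qed (use h' conf_subD(3-5)[OF Z] closed_confD(2)[OF M] in auto)
qed

lemma conf_sub_zero:
  assumes "lambda_action R M"
  shows "conf_sub R M {\<zero>\<^bsub>M\<^esub>}"
proof -
  interpret M: supermodule M using assms unfolding lambda_action_def by blast
  interpret L: lambda_action R M by (rule assms)
  show ?thesis
  proof (rule conf_subI)
    fix a v n assume a: "a \<in> carrier R" and v: "v \<in> {\<zero>\<^bsub>M\<^esub>}"
    \<comment> \<open>Zero is written as a zero multiple of itself, so that linearity makes every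
      coefficient of its action vanish.\<close>
    have "lact M a ([:0:] \<odot>\<^bsub>M\<^esub> \<zero>\<^bsub>M\<^esub>) n = [:0:] \<odot>\<^bsub>M\<^esub> lact M a \<zero>\<^bsub>M\<^esub> n"
      by (rule L.lact_scale_right[OF a]) simp
    then show "lact M a v n \<in> {\<zero>\<^bsub>M\<^esub>}"
      using v M.smult_l_null[of "\<zero>\<^bsub>M\<^esub>"] M.smult_l_null[of "lact M a \<zero>\<^bsub>M\<^esub> n"] L.lact_closed[OF a] by simp
  next
    fix u v assume uv: "u \<in> grade M 0" "v \<in> grade M 1" "u \<oplus>\<^bsub>M\<^esub> v \<in> {\<zero>\<^bsub>M\<^esub>}"
    show "u \<in> {\<zero>\<^bsub>M\<^esub>} \<and> v \<in> {\<zero>\<^bsub>M\<^esub>}"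
      using M.grade_unique[OF uv(1) M.zero_in_grade uv(2) M.zero_in_grade] uv(3) by simp
  next
    show "q \<odot>\<^bsub>M\<^esub> v \<in> {\<zero>\<^bsub>M\<^esub>}" if "v \<in> {\<zero>\<^bsub>M\<^esub>}" for q v
      using that M.smult_r_null[of q] by simp
  qed simp_all
qed

lemma conf_sub_carrier:
  assumes "closed_conf R M"
  shows "conf_sub R M (carrier M)"
proof -
  interpret supermodule M by (rule closed_confD(1)[OF assms])
  show ?thesis
    by (rule conf_subI) (use grade_in closed_confD(2)[OF assms] in auto)
qed

text \<open>Gradedness survives because \<open>h\<close> sends the components of \<open>w\<close> to
  the components of \<open>h w\<close>, and these are unique in \<open>S\<close>.\<close>

lemma conf_sub_image:
  assumes h: "conf_hom R M S h" and M: "closed_conf R M" and S: "supermodule S" and Z: "conf_sub R M Z"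
  shows "conf_sub R S (h ` Z)"
proof -
  interpret M: supermodule M by (rule closed_confD(1)[OF M])
  interpret S: supermodule S by (rule S)
  note h' = conf_homD[OF h] and Z' = conf_subD[OF Z]
  show ?thesis
  proof (rule conf_subI)
    show "h ` Z \<subseteq> carrier S" using h'(1) Z'(1) by blast
    show "\<zero>\<^bsub>S\<^esub> \<in> h ` Z"
      using conf_hom_zero[OF h M.supermodule_axioms S] Z'(2) by (metis imageI)
  next
    fix x y assume "x \<in> h ` Z" "y \<in> h ` Z"
    then obtain u v where uv: "u \<in> Z" "v \<in> Z" "x = h u" "y = h v" by blast
    then have "x \<oplus>\<^bsub>S\<^esub> y = h (u \<oplus>\<^bsub>M\<^esub> v)" using h'(2) Z'(1) by simp
    then show "x \<oplus>\<^bsub>S\<^esub> y \<in> h ` Z" using Z'(3)[OF uv(1,2)] by simp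
  next
    fix q x assume "x \<in> h ` Z"
    then obtain u where u: "u \<in> Z" "x = h u" by blast
    then have "q \<odot>\<^bsub>S\<^esub> x = h (q \<odot>\<^bsub>M\<^esub> u)" using h'(3) Z'(1) by simp
    then show "q \<odot>\<^bsub>S\<^esub> x \<in> h ` Z" using Z'(4)[OF u(1)] by simp
  next
    fix a x n assume a: "a \<in> carrier R" and "x \<in> h ` Z"
    then obtain u where u: "u \<in> Z" "x = h u" by blast
    then have "lact S a x n = h (lact M a u n)" using h'(5)[OF a] Z'(1) by simp
    then show "lact S a x n \<in> h ` Z" using Z'(5)[OF a u(1)] by simp
  next
    fix x y assume x: "x \<in> grade S 0" and y: "y \<in> grade S 1" and xy: "x \<oplus>\<^bsub>S\<^esub> y \<in> h ` Z"
    obtain w where w: "w \<in> Z" "x \<oplus>\<^bsub>S\<^esub> y = h w" using xy by blast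
    obtain u v where uv: "u \<in> grade M 0" "v \<in> grade M 1" "w = u \<oplus>\<^bsub>M\<^esub> v"
      using M.grade_split[OF Z'(1)[OF w(1)]] .
    have uZ: "u \<in> Z" "v \<in> Z" using Z'(6,7)[OF uv(1,2)] w(1) uv(3) by simp_all
    have g: "h u \<in> grade S 0" "h v \<in> grade S 1" using h'(4) uv by blast+
    have "x \<oplus>\<^bsub>S\<^esub> y = h u \<oplus>\<^bsub>S\<^esub> h v" using w uv h'(2) Z'(1) uZ by simp
    then have "x = h u" "y = h v" using S.grade_unique[OF x g(1) y g(2)] by simp_all
    then show "x \<in> h ` Z \<and> y \<in> h ` Z" using uZ by blast
  qed
qed

section \<open>Kernels, simplicity and the isomorphism theorems\<close>

definition conf_ker :: "('r, 'v) conf \<Rightarrow> ('r, 'w) conf \<Rightarrow> ('v \<Rightarrow> 'w) \<Rightarrow> 'v set" where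
  "conf_ker M S h = {v \<in> carrier M. h v = \<zero>\<^bsub>S\<^esub>}"

definition conf_onto :: "('r, 'r) conf \<Rightarrow> ('r, 'v) conf \<Rightarrow> ('r, 'w) conf \<Rightarrow> ('v \<Rightarrow> 'w) \<Rightarrow> bool" where
  "conf_onto R M S h \<longleftrightarrow> conf_hom R M S h \<and> h ` carrier M = carrier S"

lemma conf_sub_ker:
  assumes h: "conf_hom R M S h" and L: "lambda_action R M" and S: "supermodule S"
  shows "conf_sub R M (conf_ker M S h)"
proof -
  interpret L: lambda_action R M by (rule L)
  have M: "closed_conf R M"
    unfolding closed_conf_def using L.M.supermodule_axioms L.lact_closed by blast
  have "conf_sub R S (h ` {\<zero>\<^bsub>M\<^esub>})" by (rule conf_sub_image[OF h M S conf_sub_zero[OF L]])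
  then have "conf_sub R S {\<zero>\<^bsub>S\<^esub>}" using conf_hom_zero[OF h L.M.supermodule_axioms S] by simp
  from conf_sub_vimage[OF h M S this] show ?thesis by (simp add: conf_ker_def)
qed

text \<open>Simplicity as a property of the graded submodules alone, so that it can be asserted of
  an explicit model before the model is identified with a factor of a series.\<close>

definition conf_simple :: "('r, 'r) conf \<Rightarrow> ('r, 'v) conf \<Rightarrow> bool" where
  "conf_simple R S \<longleftrightarrow>
     carrier S \<noteq> {\<zero>\<^bsub>S\<^esub>} \<and> (\<forall>N. conf_sub R S N \<longrightarrow> N = {\<zero>\<^bsub>S\<^esub>} \<or> N = carrier S)"

lemma simple_module_iff: "simple_module R M \<longleftrightarrow> conformal_module R M \<and> conf_simple R M"
  unfolding simple_module_def conf_simple_def conformal_submodule_iff by blast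

lemma ker_coset:
  assumes h: "conf_hom R M S h" and M: "supermodule M" and S: "supermodule S"
    and uv: "u \<in> carrier M" "v \<in> carrier M"
  shows "u \<ominus>\<^bsub>M\<^esub> v \<in> conf_ker M S h \<longleftrightarrow> h u = h v"
proof -
  interpret M: supermodule M by (rule M)
  interpret S: supermodule S by (rule S)
  show ?thesis
    using conf_hom_minus[OF h M S uv] S.minus_eq_zero_iff conf_homD(1)[OF h] uv
    by (simp add: conf_ker_def)
qed

text \<open>Correspondence theorem: submodules of \<open>S\<close> pull back to the submodules of
  \<open>M\<close> above the kernel, and a submodule above the kernel is recovered from its
  image.\<close>

lemma onto_simple_iff:
  assumes h: "conf_onto R M S h" and M: "conformal_module R M" and S: "supermodule S"
  shows "conf_simple R S \<longleftrightarrow> conf_ker M S h \<noteq> carrier M \<and>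
    (\<forall>Z. conf_sub R M Z \<longrightarrow> conf_ker M S h \<subseteq> Z \<longrightarrow> Z = conf_ker M S h \<or> Z = carrier M)"
proof -
  have h1: "conf_hom R M S h" and h2: "h ` carrier M = carrier S"
    using h unfolding conf_onto_def by blast+
  interpret M: supermodule M by (rule conformal_module_supermodule[OF M])
  interpret S: supermodule S by (rule S)
  note Mc = conformal_module_closed[OF M]
  have ne: "carrier S = {\<zero>\<^bsub>S\<^esub>} \<longleftrightarrow> conf_ker M S h = carrier M"
  proof
    assume "carrier S = {\<zero>\<^bsub>S\<^esub>}"
    then show "conf_ker M S h = carrier M" using conf_homD(1)[OF h1] by (auto simp: conf_ker_def)
  next
    assume "conf_ker M S h = carrier M"
    then have "\<forall>v\<in>carrier M. h v = \<zero>\<^bsub>S\<^esub>" unfolding conf_ker_def by blast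
    then have "carrier S \<subseteq> {\<zero>\<^bsub>S\<^esub>}" unfolding h2[symmetric] by (simp add: image_subset_iff)
    then show "carrier S = {\<zero>\<^bsub>S\<^esub>}" using S.M.zero_closed by (simp add: subset_singleton_iff) blast
  qed
  show ?thesis
  proof
    assume simple: "conf_simple R S"
    have "Z = conf_ker M S h \<or> Z = carrier M" if Z: "conf_sub R M Z" "conf_ker M S h \<subseteq> Z" for Z
    proof -
      have "h ` Z = {\<zero>\<^bsub>S\<^esub>} \<or> h ` Z = carrier S"
        using conf_sub_image[OF h1 Mc S Z(1)] simple unfolding conf_simple_def by blast
      then show ?thesis
      proof
        assume "h ` Z = {\<zero>\<^bsub>S\<^esub>}"
        then have "Z \<subseteq> conf_ker M S h" using conf_subD(1)[OF Z(1)] by (auto simp: conf_ker_def)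
        then show ?thesis using Z(2) by blast
      next
        assume hZ: "h ` Z = carrier S"
        have "v \<in> Z" if v: "v \<in> carrier M" for v
        proof -
          have "h v \<in> h ` Z" using hZ conf_homD(1)[OF h1 v] by simp
          then obtain z where z: "z \<in> Z" "h v = h z" by blast
          have zc: "z \<in> carrier M" using conf_subD(1)[OF Z(1) z(1)] .
          have "v \<ominus>\<^bsub>M\<^esub> z \<in> Z" using ker_coset[OF h1 M.supermodule_axioms S v zc] z(2) Z(2) by blast
          then have "(v \<ominus>\<^bsub>M\<^esub> z) \<oplus>\<^bsub>M\<^esub> z \<in> Z" using conf_subD(3)[OF Z(1)] z(1) by blast
          then show "v \<in> Z" using v zc by (simp add: M.M.minus_eq M.M.a_assoc M.M.l_neg)
        qed
        then show ?thesis using conf_subD(1)[OF Z(1)] by blast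
      qed
    qed
    then show "conf_ker M S h \<noteq> carrier M \<and>
      (\<forall>Z. conf_sub R M Z \<longrightarrow> conf_ker M S h \<subseteq> Z \<longrightarrow> Z = conf_ker M S h \<or> Z = carrier M)"
      using simple ne unfolding conf_simple_def by blast
  next
    assume *: "conf_ker M S h \<noteq> carrier M \<and>
      (\<forall>Z. conf_sub R M Z \<longrightarrow> conf_ker M S h \<subseteq> Z \<longrightarrow> Z = conf_ker M S h \<or> Z = carrier M)"
    have "N = {\<zero>\<^bsub>S\<^esub>} \<or> N = carrier S" if N: "conf_sub R S N" for N
    proof -
      let ?Z = "{v \<in> carrier M. h v \<in> N}"
      have im: "h ` ?Z = N"
      proof
        show "N \<subseteq> h ` ?Z"
        proof
          fix x assume x: "x \<in> N"
          then have "x \<in> h ` carrier M" using conf_subD(1)[OF N] h2 by simp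
          then show "x \<in> h ` ?Z" using x by blast
        qed
      qed blast
      have "conf_ker M S h \<subseteq> ?Z" using conf_subD(2)[OF N] by (auto simp: conf_ker_def)
      then have "?Z = conf_ker M S h \<or> ?Z = carrier M" using * conf_sub_vimage[OF h1 Mc S N] by blast
      then show ?thesis
      proof
        assume "?Z = conf_ker M S h"
        then have "N \<subseteq> {\<zero>\<^bsub>S\<^esub>}" using im by (auto simp: conf_ker_def)
        then show ?thesis using conf_subD(2)[OF N] by blast
      next
        assume "?Z = carrier M"
        then show ?thesis using im h2 by simp
      qed
    qed
    then show "conf_simple R S" using * ne unfolding conf_simple_def by blast
  qed
qed

lemma conf_onto_quot:
  assumes M: "conformal_module R M" and N: "conf_sub R M N"
  shows "conf_onto R M (quot_conf M N) (\<lambda>v. N +>\<^bsub>M\<^esub> v)"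
    and "conf_ker M (quot_conf M N) (\<lambda>v. N +>\<^bsub>M\<^esub> v) = N"
proof -
  interpret supermodule M by (rule conformal_module_supermodule[OF M])
  show "conf_onto R M (quot_conf M N) (\<lambda>v. N +>\<^bsub>M\<^esub> v)"
    unfolding conf_onto_def conf_hom_def
    using carrier_quot_conf[OF N] add_quot_conf[OF N] smult_quot_conf[OF N] grade_quot_conf[OF N]
      lact_quot_conf[OF N conformal_moduleD(3)[OF M]] by simp
  have "u \<ominus>\<^bsub>M\<^esub> \<zero>\<^bsub>M\<^esub> = u" if "u \<in> carrier M" for u
    using that by (simp add: M.minus_eq M.add.inv_one)
  then have "N +>\<^bsub>M\<^esub> u = N +>\<^bsub>M\<^esub> \<zero>\<^bsub>M\<^esub> \<longleftrightarrow> u \<in> N" if "u \<in> carrier M" for u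
    using coset_eq_iff[OF N that M.zero_closed] that by simp
  then show "conf_ker M (quot_conf M N) (\<lambda>v. N +>\<^bsub>M\<^esub> v) = N"
    unfolding conf_ker_def zero_quot_conf[OF N] using conf_subD(8)[OF N] by blast
qed

text \<open>A homomorphism sends components to components, so surjectivity passes to each parity.
  This links \<open>conf_onto\<close>, which speaks of the carrier, with \<open>conf_iso\<close>,
  which speaks of every graded part.\<close>

lemma onto_grade:
  assumes h: "conf_onto R M S h" and M: "supermodule M" and S: "supermodule S"
  shows "h ` grade M s = grade S s"
proof
  interpret M: supermodule M by (rule M)
  interpret S: supermodule S by (rule S)
  have h1: "conf_hom R M S h" and h2: "h ` carrier M = carrier S"
    using h unfolding conf_onto_def by blast+
  note h' = conf_homD[OF h1]
  show "h ` grade M s \<subseteq> grade S s" using h'(4) by blast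
  show "grade S s \<subseteq> h ` grade M s"
  proof
    fix x assume x: "x \<in> grade S s"
    then obtain w where w: "w \<in> carrier M" "x = h w" using h2 S.grade_in by blast
    obtain u v where uv: "u \<in> grade M 0" "v \<in> grade M 1" "w = u \<oplus>\<^bsub>M\<^esub> v"
      using M.grade_split[OF w(1)] .
    have c: "u \<in> carrier M" "v \<in> carrier M" using uv M.grade_in by blast+
    have g: "h u \<in> grade S 0" "h v \<in> grade S 1" using h'(4) uv by blast+
    have hx: "x \<oplus>\<^bsub>S\<^esub> \<zero>\<^bsub>S\<^esub> = h u \<oplus>\<^bsub>S\<^esub> h v" "\<zero>\<^bsub>S\<^esub> \<oplus>\<^bsub>S\<^esub> x = h u \<oplus>\<^bsub>S\<^esub> h v"
      using h'(2)[OF c] uv(3) w(2) S.grade_in[OF x] by simp_all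
    show "x \<in> h ` grade M s"
    proof (cases "s = 0")
      case True
      then have "x = h u" using S.grade_unique(1)[OF _ g(1) S.zero_in_grade g(2) hx(1)] x by simp
      then show ?thesis using uv(1) True by blast
    next
      case False
      then have "x = h v" using S.grade_unique(2)[OF S.zero_in_grade g(1) _ g(2) hx(2)] x by simp
      then show ?thesis using uv(2) False by auto
    qed
  qed
qed

lemma first_iso:
  assumes h: "conf_onto R M S h" and M: "conformal_module R M" and S: "supermodule S"
  shows "conf_iso R (quot_conf M (conf_ker M S h)) S"
proof -
  interpret M: supermodule M by (rule conformal_module_supermodule[OF M])
  have h1: "conf_hom R M S h" and h2: "h ` carrier M = carrier S"
    using h unfolding conf_onto_def by blast+
  note h' = conf_homD[OF h1]
  let ?N = "conf_ker M S h"
  let ?p = "\<lambda>v. ?N +>\<^bsub>M\<^esub> v"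
  have N: "conf_sub R M ?N" by (rule conf_sub_ker[OF h1 conformal_moduleD(3)[OF M] S])
  have eq: "?p u = ?p v \<longleftrightarrow> h u = h v" if "u \<in> carrier M" "v \<in> carrier M" for u v
    using M.coset_eq_iff[OF N that] ker_coset[OF h1 M.supermodule_axioms S that] by simp
  \<comment> \<open>Any representative will do: by \<open>eq\<close>, the map \<open>h\<close> is
    constant on the cosets of its kernel and separates them.\<close>
  define f where "f A = h (SOME v. v \<in> carrier M \<and> ?p v = A)" for A
  have f: "f (?p v) = h v" if v: "v \<in> carrier M" for v
  proof -
    have "(SOME u. u \<in> carrier M \<and> ?p u = ?p v) \<in> carrier M \<and> ?p (SOME u. u \<in> carrier M \<and> ?p u = ?p v) = ?p v"
      by (rule someI[of _ v]) (use v in simp)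
    then show ?thesis unfolding f_def using eq v by blast
  qed
  note q = M.carrier_quot_conf[OF N] M.add_quot_conf[OF N] M.smult_quot_conf[OF N]
    M.lact_quot_conf[OF N conformal_moduleD(3)[OF M]] M.grade_quot_conf[OF N]
  have gr: "f ` grade (quot_conf M ?N) s = grade S s" for s
    unfolding q(5) image_image onto_grade[OF h M.supermodule_axioms S, symmetric]
    by (rule image_cong) (simp_all add: f M.grade_in)
  have "conf_hom R (quot_conf M ?N) S f"
    unfolding conf_hom_def q(1)
    using h' closed_confD(2)[OF conformal_module_closed[OF M]] M.grade_in by (auto simp: q f)
  moreover have "bij_betw f (carrier (quot_conf M ?N)) (carrier S)"
    unfolding bij_betw_def q(1) h2[symmetric] inj_on_def
    by (auto simp: f eq image_image)
  ultimately show ?thesis unfolding conf_iso_iff using gr by blast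
qed

lemma conf_sub_inter:
  assumes A: "conf_sub R M A" and B: "conf_sub R M B"
  shows "conf_sub R M (A \<inter> B)"
proof (rule conf_subI)
  show "A \<inter> B \<subseteq> carrier M" using conf_subD(8)[OF A] by blast
  show "\<zero>\<^bsub>M\<^esub> \<in> A \<inter> B" using conf_subD(2)[OF A] conf_subD(2)[OF B] by blast
  show "u \<oplus>\<^bsub>M\<^esub> v \<in> A \<inter> B" if "u \<in> A \<inter> B" "v \<in> A \<inter> B" for u v
    using that conf_subD(3)[OF A] conf_subD(3)[OF B] by blast
  show "q \<odot>\<^bsub>M\<^esub> v \<in> A \<inter> B" if "v \<in> A \<inter> B" for q v
    using that conf_subD(4)[OF A] conf_subD(4)[OF B] by blast
  show "lact M a v n \<in> A \<inter> B" if "a \<in> carrier R" "v \<in> A \<inter> B" for a v n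
    using that conf_subD(5)[OF A] conf_subD(5)[OF B] by blast
  show "u \<in> A \<inter> B \<and> v \<in> A \<inter> B" if "u \<in> grade M 0" "v \<in> grade M 1" "u \<oplus>\<^bsub>M\<^esub> v \<in> A \<inter> B" for u v
    using that conf_subD(6,7)[OF A] conf_subD(6,7)[OF B] by blast
qed

lemma (in supermodule) conf_sub_sum:
  assumes L: "lambda_action R M" and A: "conf_sub R M A" and B: "conf_sub R M B"
  shows "conf_sub R M (A <+>\<^bsub>M\<^esub> B)" "A \<subseteq> A <+>\<^bsub>M\<^esub> B" "B \<subseteq> A <+>\<^bsub>M\<^esub> B"
proof -
  interpret L: lambda_action R M by (rule L)
  note A' = conf_subD[OF A] and B' = conf_subD[OF B]
  show "conf_sub R M (A <+>\<^bsub>M\<^esub> B)"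
  proof (rule conf_subI)
    show "A <+>\<^bsub>M\<^esub> B \<subseteq> carrier M" using A'(1) B'(1) by (auto elim!: set_addE)
    show "\<zero> \<in> A <+>\<^bsub>M\<^esub> B" using set_addI[OF A'(2) B'(2), of M] by simp
  next
    fix u v assume "u \<in> A <+>\<^bsub>M\<^esub> B" "v \<in> A <+>\<^bsub>M\<^esub> B"
    then obtain a b a' b' where *: "a \<in> A" "b \<in> B" "a' \<in> A" "b' \<in> B" "u = a \<oplus> b" "v = a' \<oplus> b'"
      by (metis set_addE)
    have "u \<oplus> v = (a \<oplus> a') \<oplus> (b \<oplus> b')" using * A'(1) B'(1) by (simp add: M.a_ac)
    then show "u \<oplus> v \<in> A <+>\<^bsub>M\<^esub> B" using * A'(3) B'(3) by (auto intro!: set_addI)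
  next
    fix q v assume "v \<in> A <+>\<^bsub>M\<^esub> B"
    then obtain a b where *: "a \<in> A" "b \<in> B" "v = a \<oplus> b" by (metis set_addE)
    have "q \<odot> v = q \<odot> a \<oplus> q \<odot> b" using * A'(1) B'(1) smult_r_distr[of q a b] by simp
    then show "q \<odot> v \<in> A <+>\<^bsub>M\<^esub> B" using * A'(4) B'(4) by (auto intro!: set_addI)
  next
    fix r v n assume r: "r \<in> carrier R" and "v \<in> A <+>\<^bsub>M\<^esub> B"
    then obtain a b where *: "a \<in> A" "b \<in> B" "v = a \<oplus> b" by (metis set_addE)
    have "lact M r v n = lact M r a n \<oplus> lact M r b n" using * A'(1) B'(1) L.lact_add_right[OF r] by simp
    then show "lact M r v n \<in> A <+>\<^bsub>M\<^esub> B" using * A'(5)[OF r] B'(5)[OF r] by (auto intro!: set_addI)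
  next
    fix u v assume uv: "u \<in> grade M 0" "v \<in> grade M 1" "u \<oplus> v \<in> A <+>\<^bsub>M\<^esub> B"
    then obtain a b where *: "a \<in> A" "b \<in> B" "u \<oplus> v = a \<oplus> b" by (metis set_addE)
    obtain a0 a1 where a: "a0 \<in> grade M 0" "a1 \<in> grade M 1" "a = a0 \<oplus> a1" using grade_split A'(1) * by metis
    obtain b0 b1 where b: "b0 \<in> grade M 0" "b1 \<in> grade M 1" "b = b0 \<oplus> b1" using grade_split B'(1) * by metis
    have m: "a0 \<in> A" "a1 \<in> A" "b0 \<in> B" "b1 \<in> B"
      using A'(6,7)[OF a(1,2)] B'(6,7)[OF b(1,2)] a(3) b(3) *(1,2) by simp_all
    have "u \<oplus> v = (a0 \<oplus> b0) \<oplus> (a1 \<oplus> b1)" using * a b m A'(1) B'(1) by (simp add: M.a_ac)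
    then have "u = a0 \<oplus> b0" "v = a1 \<oplus> b1"
      using grade_unique[of u "a0 \<oplus> b0" v "a1 \<oplus> b1"] uv a b add_in_grade by simp_all
    then show "u \<in> A <+>\<^bsub>M\<^esub> B \<and> v \<in> A <+>\<^bsub>M\<^esub> B" using m by (auto intro!: set_addI)
  qed
  show "A \<subseteq> A <+>\<^bsub>M\<^esub> B"
  proof
    fix a assume "a \<in> A"
    then show "a \<in> A <+>\<^bsub>M\<^esub> B" using set_addI[of a A "\<zero>" B M] A'(1) B'(2) by simp
  qed
  show "B \<subseteq> A <+>\<^bsub>M\<^esub> B"
  proof
    fix b assume "b \<in> B"
    then show "b \<in> A <+>\<^bsub>M\<^esub> B" using set_addI[of "\<zero>" A b B M] A'(2) B'(1) by simp
  qed
qed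

text \<open>Defined through the simple quotient, as in a composition series;
  \<open>conf_cover_iff\<close> supplies the lattice form, that nothing lies strictly in between, on
  which the Jordan-Hoelder axioms are checked.\<close>

definition conf_cover :: "('r, 'r) conf \<Rightarrow> ('r, 'v) conf \<Rightarrow> 'v set \<Rightarrow> 'v set \<Rightarrow> bool" where
  "conf_cover R M Y X \<longleftrightarrow>
     conf_sub R M Y \<and> conf_sub R M X \<and> Y \<subseteq> X \<and> conf_simple R (quot_conf (sub_conf M X) Y)"

text \<open>All subquotients of \<open>M\<close> live on the type of sets of elements of
  \<open>M\<close>, so an isomorphism class can be a set of records on that one type, and classes
  can be compared by equality.\<close>

definition conf_class ::
  "('r, 'r) conf \<Rightarrow> ('r, 'v) conf \<Rightarrow> 'v set \<Rightarrow> 'v set \<Rightarrow> ('r, 'v set) conf set" where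
  "conf_class R M Y X = {Q. conf_iso R (quot_conf (sub_conf M X) Y) Q}"

lemma subquotient:
  assumes M: "conformal_module R M" and X: "conf_sub R M X" and Y: "conf_sub R M Y" "Y \<subseteq> X"
  shows "conformal_module R (quot_conf (sub_conf M X) Y)"
    and "conf_onto R (sub_conf M X) (quot_conf (sub_conf M X) Y) (\<lambda>v. Y +>\<^bsub>sub_conf M X\<^esub> v)"
    and "conf_ker (sub_conf M X) (quot_conf (sub_conf M X) Y) (\<lambda>v. Y +>\<^bsub>sub_conf M X\<^esub> v) = Y"
proof -
  have c: "conformal_module R (sub_conf M X)" by (rule conformal_module_sub_conf[OF M X])
  have y: "conf_sub R (sub_conf M X) Y" using conf_sub_sub_conf[OF X] Y by blast
  show "conformal_module R (quot_conf (sub_conf M X) Y)" by (rule conformal_module_quot_conf[OF c y])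
  show "conf_onto R (sub_conf M X) (quot_conf (sub_conf M X) Y) (\<lambda>v. Y +>\<^bsub>sub_conf M X\<^esub> v)"
    by (rule conf_onto_quot(1)[OF c y])
  show "conf_ker (sub_conf M X) (quot_conf (sub_conf M X) Y) (\<lambda>v. Y +>\<^bsub>sub_conf M X\<^esub> v) = Y"
    by (rule conf_onto_quot(2)[OF c y])
qed

lemma onto_sub_simple_iff:
  assumes M: "conformal_module R M" and X: "conf_sub R M X" and S: "supermodule S"
    and h: "conf_onto R (sub_conf M X) S h"
  shows "conf_simple R S \<longleftrightarrow> conf_ker (sub_conf M X) S h \<noteq> X \<and>
    (\<forall>Z. conf_sub R M Z \<longrightarrow> conf_ker (sub_conf M X) S h \<subseteq> Z \<longrightarrow> Z \<subseteq> X \<longrightarrow>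
       Z = conf_ker (sub_conf M X) S h \<or> Z = X)"
  using onto_simple_iff[OF h conformal_module_sub_conf[OF M X] S] conf_sub_sub_conf[OF X] by auto

lemma conf_cover_iff:
  assumes M: "conformal_module R M"
  shows "conf_cover R M Y X \<longleftrightarrow> conf_sub R M Y \<and> conf_sub R M X \<and> Y \<subseteq> X \<and> Y \<noteq> X \<and>
    (\<forall>Z. conf_sub R M Z \<longrightarrow> Y \<subseteq> Z \<longrightarrow> Z \<subseteq> X \<longrightarrow> Z = Y \<or> Z = X)"
proof (cases "conf_sub R M Y \<and> conf_sub R M X \<and> Y \<subseteq> X")
  case True
  then have X: "conf_sub R M X" and Y: "conf_sub R M Y" "Y \<subseteq> X" by blast+
  note q = subquotient[OF M X Y]
  show ?thesis
    using onto_sub_simple_iff[OF M X conformal_module_supermodule[OF q(1)] q(2)] X Y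
    unfolding q(3) conf_cover_def by blast
qed (auto simp: conf_cover_def)

text \<open>First isomorphism theorem inside \<open>M\<close>: an explicit model is recognized as
  the factor \<open>X / Y\<close> once \<open>X\<close> maps onto it with kernel
  \<open>Y\<close>.\<close>

lemma conf_factor:
  assumes M: "conformal_module R M" and X: "conf_sub R M X" and S: "supermodule S"
    and h: "conf_onto R (sub_conf M X) S h" and Y: "Y = conf_ker (sub_conf M X) S h"
  shows "conf_sub R M Y" "conf_iso R (quot_conf (sub_conf M X) Y) S"
    "conf_simple R S \<longleftrightarrow> conf_cover R M Y X"
proof -
  have c: "conformal_module R (sub_conf M X)" by (rule conformal_module_sub_conf[OF M X])
  have "conf_sub R (sub_conf M X) Y"
    unfolding Y using conf_sub_ker[OF _ conformal_moduleD(3)[OF c] S] h by (auto simp: conf_onto_def)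
  then have y: "conf_sub R M Y" "Y \<subseteq> X" using conf_sub_sub_conf[OF X] by blast+
  show "conf_sub R M Y" by (rule y)
  show "conf_iso R (quot_conf (sub_conf M X) Y) S" unfolding Y by (rule first_iso[OF h c S])
  show "conf_simple R S \<longleftrightarrow> conf_cover R M Y X"
    using onto_sub_simple_iff[OF M X S h] y X unfolding conf_cover_iff[OF M] Y by blast
qed

text \<open>The coset map of \<open>(A + B) / A\<close> stays onto when restricted to
  \<open>B\<close>, because it kills the summand from \<open>A\<close>; the kernel of the
  restriction is \<open>A \<inter> B\<close>.\<close>

lemma second_iso:
  assumes M: "conformal_module R M" and A: "conf_sub R M A" and B: "conf_sub R M B"
    and X: "conf_sub R M (A <+>\<^bsub>M\<^esub> B)"
  shows "conf_iso R (quot_conf (sub_conf M B) (A \<inter> B)) (quot_conf (sub_conf M (A <+>\<^bsub>M\<^esub> B)) A)"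
    and "conf_cover R M A (A <+>\<^bsub>M\<^esub> B) \<longleftrightarrow> conf_cover R M (A \<inter> B) B"
proof -
  interpret M: supermodule M by (rule conformal_module_supermodule[OF M])
  let ?X = "A <+>\<^bsub>M\<^esub> B"
  have AX: "A \<subseteq> ?X" and BX: "B \<subseteq> ?X" using M.conf_sub_sum[OF conformal_moduleD(3)[OF M] A B] by blast+
  let ?N = "sub_conf M ?X"
  let ?Q = "quot_conf ?N A"
  let ?p = "\<lambda>v. A +>\<^bsub>?N\<^esub> v"
  have AN: "conf_sub R ?N A" using conf_sub_sub_conf[OF X] A AX by blast
  have N: "conformal_module R ?N" by (rule conformal_module_sub_conf[OF M X])
  interpret N: supermodule ?N by (rule conformal_module_supermodule[OF N])
  note q = subquotient[OF M X A AX]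
  have h: "conf_hom R ?N ?Q ?p" and onto: "?p ` ?X = carrier ?Q"
    using q(2) by (auto simp: conf_onto_def)
  have "?p ` B = carrier ?Q"
  proof
    show "?p ` B \<subseteq> carrier ?Q" using onto BX by blast
    show "carrier ?Q \<subseteq> ?p ` B"
    proof
      fix x assume "x \<in> carrier ?Q"
      then obtain v where "v \<in> ?X" "x = ?p v" using onto by blast
      then obtain a b where ab: "a \<in> A" "b \<in> B" "x = ?p (a \<oplus>\<^bsub>M\<^esub> b)" by (metis set_addE)
      have c: "a \<in> carrier M" "b \<in> carrier M" "a \<in> ?X" "b \<in> ?X" "a \<oplus>\<^bsub>M\<^esub> b \<in> ?X"
        using conf_subD(1)[OF A ab(1)] conf_subD(1)[OF B ab(2)] subsetD[OF AX ab(1)] subsetD[OF BX ab(2)]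
          set_addI[of a A b B M] ab(1,2) by simp_all
      have "?p (a \<oplus>\<^bsub>?N\<^esub> b) = ?p a \<oplus>\<^bsub>?Q\<^esub> ?p b"
        by (rule conf_homD(2)[OF h]) (use c in simp_all)
      also have "?p a = \<zero>\<^bsub>?Q\<^esub>" using q(3) ab(1) by (auto simp: conf_ker_def)
      also have "\<zero>\<^bsub>?Q\<^esub> \<oplus>\<^bsub>?Q\<^esub> ?p b = ?p b"
      proof -
        interpret Q: supermodule ?Q by (rule conformal_module_supermodule[OF q(1)])
        show ?thesis using conf_homD(1)[OF h, of b] c by simp
      qed
      finally show "x \<in> ?p ` B" using ab by simp
    qed
  qed
  then have hB: "conf_onto R (sub_conf M B) ?Q ?p"
    using h BX unfolding conf_onto_def conf_hom_def by (simp add: subset_iff)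
  have "v \<in> A \<longleftrightarrow> ?p v = \<zero>\<^bsub>?Q\<^esub>" if "v \<in> ?X" for v
    using that eqset_imp_iff[OF q(3), of v] by (simp add: conf_ker_def)
  then have k: "A \<inter> B = conf_ker (sub_conf M B) ?Q ?p"
    unfolding conf_ker_def sub_conf_simps using BX by blast
  note f = conf_factor[OF M B conformal_module_supermodule[OF q(1)] hB k]
  show "conf_iso R (quot_conf (sub_conf M B) (A \<inter> B)) ?Q" by (rule f(2))
  show "conf_cover R M A ?X \<longleftrightarrow> conf_cover R M (A \<inter> B) B"
    using f(3) A X AX unfolding conf_cover_def by blast
qed

text \<open>Maximality of \<open>a\<close> in \<open>x\<close> forces \<open>a + y = x\<close> for
  every submodule \<open>y\<close> of \<open>x\<close> not inside \<open>a\<close>, and the second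
  isomorphism theorem then identifies \<open>x / a\<close> with \<open>y / (a \<inter> y)\<close>.
  Both axioms about intersections are instances of this.\<close>

lemma jordan_hoelder_conf:
  assumes M: "conformal_module R M"
  shows "jordan_hoelder (conf_cover R M) (conf_class R M) {\<zero>\<^bsub>M\<^esub>}"
proof
  interpret M: supermodule M by (rule conformal_module_supermodule[OF M])
  note C = conf_cover_iff[OF M]
  note L = conformal_moduleD(3)[OF M]
  have join: "a <+>\<^bsub>M\<^esub> y = x"
    if ax: "conf_cover R M a x" and y: "conf_sub R M y" "y \<subseteq> x" "\<not> y \<subseteq> a" for a x y
  proof -
    have a: "conf_sub R M a" "conf_sub R M x" "a \<subseteq> x" using ax unfolding C by blast+
    note s = M.conf_sub_sum[OF L a(1) y(1)]
    have "a <+>\<^bsub>M\<^esub> y \<subseteq> x"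
      using a(3) y(2) conf_subD(3)[OF a(2)] by (auto elim!: set_addE)
    then have "a <+>\<^bsub>M\<^esub> y = a \<or> a <+>\<^bsub>M\<^esub> y = x" using ax s unfolding C by blast
    then show ?thesis using s(3) y(3) by blast
  qed
  have second: "conf_cover R M (a \<inter> y) y \<and> conf_class R M a x = conf_class R M (a \<inter> y) y"
    if ax: "conf_cover R M a x" and y: "conf_sub R M y" "y \<subseteq> x" "\<not> y \<subseteq> a" for a x y
  proof -
    have a: "conf_sub R M a" "conf_sub R M x" "a \<subseteq> x" using ax unfolding C by blast+
    note j = join[OF ax y]
    note i = second_iso[OF M a(1) y(1), unfolded j, OF a(2)]
    have q: "closed_conf R (quot_conf (sub_conf M y) (a \<inter> y))"
      by (intro conformal_module_closed subquotient(1) M y(1) conf_sub_inter a(1)) blast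
    have "conf_class R M a x = conf_class R M (a \<inter> y) y"
      unfolding conf_class_def
      using i(1) conf_iso_sym[OF i(1) q] conf_iso_trans by blast
    then show ?thesis using i(2) ax by blast
  qed
  show "\<not> conf_cover R M y {\<zero>\<^bsub>M\<^esub>}" for y
  proof
    assume c: "conf_cover R M y {\<zero>\<^bsub>M\<^esub>}"
    then have "conf_sub R M y" by (simp add: conf_cover_def)
    then have "\<zero>\<^bsub>M\<^esub> \<in> y" by (rule conf_subD(2))
    with c show False unfolding C by blast
  qed
  show "{\<zero>\<^bsub>M\<^esub>} \<subseteq> y" if "conf_cover R M y x" for y x
  proof -
    have "conf_sub R M y" using that by (simp add: conf_cover_def)
    from conf_subD(2)[OF this] show ?thesis by simp
  qed
  show "conf_cover R M (a \<inter> y) y"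
    if "conf_cover R M a x" "conf_cover R M y y'" "y \<subseteq> x" "\<not> y \<subseteq> a" for a x y y'
  proof -
    have "conf_sub R M y" using that(2) by (simp add: conf_cover_def)
    then show ?thesis using second[OF that(1)] that(3,4) by blast
  qed
  show "conf_cover R M (a \<inter> b) a \<and> conf_cover R M (a \<inter> b) b \<and>
      conf_class R M a x = conf_class R M (a \<inter> b) b \<and> conf_class R M b x = conf_class R M (a \<inter> b) a"
    if a: "conf_cover R M a x" and b: "conf_cover R M b x" and ne: "a \<noteq> b" for a b x
  proof -
    have "conf_sub R M a" "a \<subseteq> x" "conf_sub R M b" "b \<subseteq> x" using a b unfolding C by blast+
    moreover have "\<not> a \<subseteq> b" "\<not> b \<subseteq> a" using a b ne unfolding C by blast+
    ultimately show ?thesis using second[OF a, of b] second[OF b, of a] by (simp add: Int_commute)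
  qed
qed

section \<open>Composition series and multiplicities\<close>

lemma composition_series_chain:
  assumes "composition_series R M Ns" "k < length Ns"
  shows "chain (conf_cover R M) (conf_class R M) {\<zero>\<^bsub>M\<^esub>} (Ns ! k)
    (mset (map (\<lambda>i. conf_class R M (Ns ! i) (Ns ! Suc i)) [0..<k]))"
  using assms(2)
proof (induction k)
  case 0
  have "Ns ! 0 = {\<zero>\<^bsub>M\<^esub>}" using assms(1) hd_conv_nth[of Ns] by (simp add: composition_series_def)
  then show ?case by (simp add: chain_base)
next
  case (Suc k)
  have "quot_conf (sub_conf M (Ns ! Suc k)) (Ns ! k) \<in> set (series_factors M Ns)"
    using Suc(2) by (auto simp: series_factors_def)
  then have "conf_cover R M (Ns ! k) (Ns ! Suc k)"
    using assms(1) Suc(2)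
    by (auto simp: composition_series_def conf_cover_def conformal_submodule_iff simple_module_iff)
  then show ?case using chain_step[OF Suc(1)] Suc(2) by simp
qed

theorem composition_series_unique:
  fixes M :: "('r, 'v) conf"
  assumes "composition_series R M Ns" "composition_series R M Ms"
  shows "mset (map (\<lambda>Q. {P :: ('r, 'v set) conf. conf_iso R Q P}) (series_factors M Ns)) =
    mset (map (\<lambda>Q. {P :: ('r, 'v set) conf. conf_iso R Q P}) (series_factors M Ms))"
proof -
  have M: "conformal_module R M"
    using assms(1) hd_in_set by (fastforce simp: composition_series_def conformal_submodule_iff)
  interpret jordan_hoelder "conf_cover R M" "conf_class R M" "{\<zero>\<^bsub>M\<^esub>}"
    by (rule jordan_hoelder_conf[OF M])
  have *: "chain (conf_cover R M) (conf_class R M) {\<zero>\<^bsub>M\<^esub>} (carrier M)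
      (mset (map (\<lambda>Q. {P :: ('r, 'v set) conf. conf_iso R Q P}) (series_factors M Ns)))" if "composition_series R M Ns" for Ns
  proof -
    have "Ns \<noteq> []" and l: "Ns ! (length Ns - 1) = carrier M"
      using that by (auto simp: composition_series_def last_conv_nth)
    then have "length Ns - 1 < length Ns" by simp
    from composition_series_chain[OF that this] show ?thesis
      by (simp add: l[simplified] series_factors_def conf_class_def comp_def)
  qed
  show ?thesis by (rule chain_unique[OF *[OF assms(1)] *[OF assms(2)]])
qed

text \<open>One explicit series suffices: \<open>f\<close> matches an arbitrary series with it by
  isomorphism classes, and \<open>g\<close> reorders the list \<open>Gs\<close> read off from it
  into the required list \<open>Fs\<close>. The stability assumed in \<open>iso\<close> holds for
  predicates of the form \<open>conf_iso R A\<close> by transitivity.\<close>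

lemma composition_factors_areI:
  fixes M :: "('r, 'v) conf"
  assumes Ns: "composition_series R M Ns" and len: "length (series_factors M Ns) = length Gs"
    and G: "\<And>i. i < length Gs \<Longrightarrow> (Gs ! i) (series_factors M Ns ! i)"
    and iso: "\<And>F Q Q'. \<lbrakk>F \<in> set Gs; F Q; conf_iso R Q Q'\<rbrakk> \<Longrightarrow> F Q'"
    and perm: "mset Gs = mset Fs"
  shows "composition_factors_are R M Fs"
  unfolding composition_factors_are_def
proof (intro conjI allI impI)
  show "\<exists>Ns. composition_series R M Ns" using Ns by blast
  fix Ms assume Ms: "composition_series R M Ms"
  let ?c = "\<lambda>Q. {P :: ('r, 'v set) conf. conf_iso R Q P}"
  obtain f where f: "bij_betw f {..<length (series_factors M Ms)} {..<length (series_factors M Ns)}"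
    "\<And>i. i < length (series_factors M Ms) \<Longrightarrow> ?c (series_factors M Ms ! i) = ?c (series_factors M Ns ! f i)"
  proof -
    from permutation_Ex_bij[OF composition_series_unique[OF Ms Ns]]
    obtain f where *: "bij_betw f {..<length (series_factors M Ms)} {..<length (series_factors M Ns)}"
      "\<forall>i<length (series_factors M Ms). map ?c (series_factors M Ms) ! i = map ?c (series_factors M Ns) ! f i"
      by auto
    have "f i < length (series_factors M Ns)" if "i < length (series_factors M Ms)" for i
      using bij_betwE[OF *(1)] that by blast
    then show ?thesis using that[OF *(1)] *(2) by simp
  qed
  obtain g where g: "bij_betw g {..<length Gs} {..<length Fs}" "\<And>i. i < length Gs \<Longrightarrow> Gs ! i = Fs ! g i"
    using permutation_Ex_bij[OF perm] by auto
  show "\<exists>\<pi>. bij_betw \<pi> {..<length (series_factors M Ms)} {..<length Fs} \<and>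
    (\<forall>i<length (series_factors M Ms). (Fs ! \<pi> i) (series_factors M Ms ! i))"
  proof (intro exI[of _ "g \<circ> f"] conjI allI impI)
    show "bij_betw (g \<circ> f) {..<length (series_factors M Ms)} {..<length Fs}"
      by (rule bij_betw_trans[OF f(1)]) (use g(1) len in simp)
    fix i assume i: "i < length (series_factors M Ms)"
    then have fi: "f i < length Gs" using bij_betwE[OF f(1)] len by auto
    have "conf_iso R (series_factors M Ns ! f i) (series_factors M Ms ! i)"
      using f(2)[OF i] conf_iso_refl by blast
    then have "(Gs ! f i) (series_factors M Ms ! i)"
      using iso[of "Gs ! f i" "series_factors M Ns ! f i"] G[OF fi] nth_mem[OF fi] by simp
    then show "(Fs ! (g \<circ> f) i) (series_factors M Ms ! i)" using g(2)[OF fi] by simp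
  qed
qed

text \<open>If the factors at two positions were isomorphic, one of them would satisfy the
  predicates assigned to both positions, which \<open>disj\<close> excludes.\<close>

lemma multiplicity_oneI:
  assumes F: "composition_factors_are R M Fs"
    and disj: "\<And>i j Q. \<lbrakk>i < length Fs; j < length Fs; i \<noteq> j; (Fs ! i) Q; (Fs ! j) Q; conformal_module R Q\<rbrakk> \<Longrightarrow> False"
    and iso: "\<And>F Q Q'. \<lbrakk>F \<in> set Fs; F Q; conf_iso R Q Q'\<rbrakk> \<Longrightarrow> F Q'"
  shows "multiplicity_one R M"
  unfolding multiplicity_one_def
proof (intro conjI allI impI ballI)
  show "\<exists>Ns. composition_series R M Ns" using F unfolding composition_factors_are_def by blast
  fix Ns S assume Ns: "composition_series R M Ns" and "S \<in> set (series_factors M Ns)"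
  let ?S = "series_factors M Ns"
  obtain i where i: "i < length ?S" "S = ?S ! i" using \<open>S \<in> set ?S\<close> by (auto simp: in_set_conv_nth)
  obtain \<pi> where \<pi>: "bij_betw \<pi> {..<length ?S} {..<length Fs}" "\<And>i. i < length ?S \<Longrightarrow> (Fs ! \<pi> i) (?S ! i)"
    using F Ns unfolding composition_factors_are_def by blast
  have "j = i" if j: "j < length ?S" "conf_iso R S (?S ! j)" for j
  proof (rule ccontr)
    assume "j \<noteq> i"
    then have ne: "\<pi> i \<noteq> \<pi> j" using bij_betw_imp_inj_on[OF \<pi>(1)] i j by (auto dest: inj_onD)
    have len: "\<pi> i < length Fs" "\<pi> j < length Fs" using bij_betwE[OF \<pi>(1)] i j by blast+
    have "(Fs ! \<pi> i) (?S ! j)" 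
      using iso[of "Fs ! \<pi> i" "?S ! i"] nth_mem[OF len(1)] \<pi>(2)[OF i(1)] j(2) i(2) by simp
    moreover have "conformal_module R (?S ! j)"
      using Ns nth_mem[OF j(1)] by (auto simp: composition_series_def simple_module_iff)
    ultimately show False using disj[OF len ne] \<pi>(2)[OF j(1)] by blast
  qed
  then have "{j. j < length ?S \<and> conf_iso R S (?S ! j)} = {i}" using i conf_iso_refl by auto
  then show "series_multiplicity R M Ns S = 1" by (simp add: series_multiplicity_def)
qed

section \<open>Reversal of parity\<close>

lemma rev_parity_simps [simp]:
  "carrier (rev_parity M) = carrier M" "zero (rev_parity M) = zero M" "add (rev_parity M) = add M"
  "module.smult (rev_parity M) = module.smult M" "grade (rev_parity M) s = grade M (s + 1)"
  "lact (rev_parity M) = lact M"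
  by (simp_all add: rev_parity_def)

lemma bit_add_one_one: "(s :: bit) + 1 + 1 = s"
  by (simp only: add.assoc one_add_one bit_2_eq_0 add_0_right)

lemma rev_parity_rev_parity [simp]: "rev_parity (rev_parity M) = M"
proof -
  have "(\<lambda>s. grade M (s + 1 + 1)) = grade M" by (simp only: bit_add_one_one)
  then show ?thesis unfolding rev_parity_def by simp
qed

lemma conf_hom_rev_parity: "conf_hom R (rev_parity M) (rev_parity N) f \<longleftrightarrow> conf_hom R M N f"
proof -
  have "(\<forall>s. \<forall>v\<in>grade M (s + 1). f v \<in> grade N (s + 1)) \<longleftrightarrow> (\<forall>s. \<forall>v\<in>grade M s. f v \<in> grade N s)"
    by (metis bit_add_one_one)
  then show ?thesis unfolding conf_hom_def by simp
qed


lemma conf_onto_rev_parity: "conf_onto R (rev_parity M) (rev_parity N) f \<longleftrightarrow> conf_onto R M N f"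
  by (simp add: conf_onto_def conf_hom_rev_parity)

lemma closed_conf_rev_parity:
  assumes "closed_conf R M"
  shows "closed_conf R (rev_parity M)"
proof -
  interpret supermodule M by (rule closed_confD(1)[OF assms])
  have "supermodule (rev_parity M)"
    by (rule image_supermodule(1)[OF supermodule_axioms conf_sub_carrier[OF assms], where f = "\<lambda>v. v" and e = 1])
       (use grade_in grade_disjoint in auto)
  then show ?thesis using closed_confD(2)[OF assms] by (simp add: closed_conf_def)
qed

lemma conformal_module_rev_parity:
  assumes M: "conformal_module R M"
  shows "conformal_module R (rev_parity M)"
proof -
  interpret supermodule M by (rule conformal_module_supermodule[OF M])
  show ?thesis
    by (rule image_conformal_module[OF M conf_sub_carrier[OF conformal_module_closed[OF M]], where f = "\<lambda>v. v" and e = 1])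
       (use grade_in grade_disjoint in auto)
qed

lemma conf_sub_rev_parity:
  assumes "supermodule M"
  shows "conf_sub R (rev_parity M) N \<longleftrightarrow> conf_sub R M N"
proof -
  interpret supermodule M by fact
  have "(\<forall>u\<in>grade M 1. \<forall>v\<in>grade M 0. u \<oplus>\<^bsub>M\<^esub> v \<in> N \<longrightarrow> u \<in> N \<and> v \<in> N) \<longleftrightarrow>
      (\<forall>u\<in>grade M 0. \<forall>v\<in>grade M 1. u \<oplus>\<^bsub>M\<^esub> v \<in> N \<longrightarrow> u \<in> N \<and> v \<in> N)"
    using M.a_comm grade_in by metis
  then show ?thesis unfolding conf_sub_def by simp
qed

lemma conf_simple_rev_parity:
  "supermodule M \<Longrightarrow> conf_simple R (rev_parity M) \<longleftrightarrow> conf_simple R M"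
  unfolding conf_simple_def by (simp add: conf_sub_rev_parity)

text \<open>Cosets depend on the addition only, so this, like its analogue for submodules, is an
  equality of records and not just an isomorphism.\<close>

lemma quot_conf_rev_parity: "quot_conf (rev_parity M) N = rev_parity (quot_conf M N)"
  by (simp add: quot_conf_def rev_parity_def A_RCOSETS_def' a_r_coset_def' set_add_def' fun_eq_iff)

lemma sub_conf_rev_parity: "sub_conf (rev_parity M) N = rev_parity (sub_conf M N)"
  by (simp add: sub_conf_def rev_parity_def)

lemma simple_module_rev_parity:
  "simple_module R (rev_parity M) \<longleftrightarrow> simple_module R M"
  unfolding simple_module_iff
  by (metis conf_simple_rev_parity conformal_module_rev_parity conformal_module_supermodule
      rev_parity_rev_parity)

lemma conf_iso_rev_parity:
  "conf_iso R (rev_parity M) (rev_parity N) \<longleftrightarrow> conf_iso R M N"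
proof -
  have "(\<forall>s. f ` grade M (s + 1) = grade N (s + 1)) \<longleftrightarrow> (\<forall>s. f ` grade M s = grade N s)" for f
    by (metis bit_add_one_one)
  then show ?thesis unfolding conf_iso_iff conf_hom_rev_parity by simp
qed

lemma series_factors_rev_parity:
  "series_factors (rev_parity M) Ns = map rev_parity (series_factors M Ns)"
  by (simp add: series_factors_def sub_conf_rev_parity quot_conf_rev_parity)

text \<open>One implication is enough, because reversing the parity twice is the identity.\<close>

lemma composition_series_rev_parity:
  assumes "composition_series R (rev_parity M) Ns"
  shows "composition_series R M Ns"
proof -
  have M': "conformal_module R (rev_parity M)"
    using assms hd_in_set by (fastforce simp: composition_series_def conformal_submodule_iff)
  have M: "conformal_module R M" using conformal_module_rev_parity[OF M'] by simp
  show ?thesis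
    using assms M conf_sub_rev_parity[OF conformal_module_supermodule[OF M]]
    unfolding composition_series_def conformal_submodule_iff series_factors_rev_parity
    by (simp add: simple_module_rev_parity)
qed

lemma multiplicity_one_rev_parity:
  assumes "multiplicity_one R M"
  shows "multiplicity_one R (rev_parity M)"
  unfolding multiplicity_one_def
proof (intro conjI allI impI ballI)
  show "\<exists>Ns. composition_series R (rev_parity M) Ns"
    using assms composition_series_rev_parity[of R "rev_parity M"]
    unfolding multiplicity_one_def by auto
  fix Ns S assume Ns: "composition_series R (rev_parity M) Ns" and S: "S \<in> set (series_factors (rev_parity M) Ns)"
  obtain T where T: "T \<in> set (series_factors M Ns)" "S = rev_parity T"
    using S by (auto simp: series_factors_rev_parity)
  have "series_multiplicity R (rev_parity M) Ns S = series_multiplicity R M Ns T"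
    unfolding series_multiplicity_def series_factors_rev_parity T(2)
    by (rule arg_cong[of _ _ card]) (auto simp: conf_iso_rev_parity)
  then show "series_multiplicity R (rev_parity M) Ns S = 1"
    using assms T(1) composition_series_rev_parity[OF Ns] unfolding multiplicity_one_def by simp
qed

section \<open>Short exact sequences and the series built from them\<close>

definition conf_ses ::
  "('r, 'r) conf \<Rightarrow> ('r, 'a) conf \<Rightarrow> ('a \<Rightarrow> 'v) \<Rightarrow> ('r, 'v) conf \<Rightarrow> ('v \<Rightarrow> 'b) \<Rightarrow> ('r, 'b) conf \<Rightarrow> bool" where
  "conf_ses R A f M g B \<longleftrightarrow> closed_conf R A \<and> closed_conf R M \<and> closed_conf R B \<and>
     conf_hom R A M f \<and> inj_on f (carrier A) \<and> conf_onto R M B g \<and> f ` carrier A = conf_ker M B g"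

lemma conf_sesD:
  assumes "conf_ses R A f M g B"
  shows "closed_conf R A" "closed_conf R M" "closed_conf R B" "conf_hom R A M f" "inj_on f (carrier A)"
    "conf_onto R M B g" "conf_hom R M B g" "g ` carrier M = carrier B" "f ` carrier A = conf_ker M B g"
    "supermodule A" "supermodule M" "supermodule B"
  using assms unfolding conf_ses_def conf_onto_def closed_conf_def by simp_all

lemma conf_ses_rev_parity:
  "conf_ses R A f M g B \<Longrightarrow> conf_ses R (rev_parity A) f (rev_parity M) g (rev_parity B)"
  unfolding conf_ses_def conf_onto_rev_parity conf_hom_rev_parity
  by (simp add: closed_conf_rev_parity conf_ker_def)

text \<open>Realizes a submodule \<open>l(D)\<close> of a quotient \<open>B\<close> inside
  \<open>M\<close>: its full preimage \<open>X\<close> is mapped onto \<open>D\<close> by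
  \<open>g\<close> followed by the inverse of \<open>l\<close>, with the same kernel as
  \<open>g\<close>. For \<open>g\<close> the identity it inverts an embedding.\<close>

lemma conf_hom_inv_into:
  assumes l: "conf_hom R D B l" "inj_on l (carrier D)" and D: "closed_conf R D"
    and g: "conf_hom R M B g" and M: "closed_conf R M" and B: "supermodule B"
    and X: "X = {v \<in> carrier M. g v \<in> l ` carrier D}" and sub: "l ` carrier D \<subseteq> g ` carrier M"
  defines "h \<equiv> \<lambda>v. inv_into (carrier D) l (g v)"
  shows "conf_onto R (sub_conf M X) D h" "conf_sub R M X"
    "\<And>v. v \<in> X \<Longrightarrow> l (h v) = g v" "conf_ker (sub_conf M X) D h = conf_ker M B g"
proof -
  interpret M: supermodule M by (rule closed_confD(1)[OF M])
  interpret D: supermodule D by (rule closed_confD(1)[OF D])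
  note l' = conf_homD[OF l(1)] and g' = conf_homD[OF g]
  have im: "conf_sub R B (l ` carrier D)"
    by (rule conf_sub_image[OF l(1) D B conf_sub_carrier[OF D]])
  show XX: "conf_sub R M X" unfolding X by (rule conf_sub_vimage[OF g M B im])
  note X' = conf_subD[OF XX]
  show lh: "l (h v) = g v" if "v \<in> X" for v
    using that unfolding h_def X by (simp add: f_inv_into_f)
  have hD: "h v \<in> carrier D" if "v \<in> X" for v
    using that unfolding h_def X by (simp add: inv_into_into)
  have hI: "h v = d" if "v \<in> X" "d \<in> carrier D" "l d = g v" for v d
    using inj_onD[OF l(2)] lh[OF that(1)] hD[OF that(1)] that by simp
  \<comment> \<open>\<open>l\<close> preserves parity; that its inverse does so too follows from the
    uniqueness of the homogeneous components of \<open>g v\<close>.\<close>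
  have gr: "h v \<in> grade D s" if v: "v \<in> X" "v \<in> grade M s" for v s
  proof -
    interpret B: supermodule B by (rule B)
    obtain d0 d1 where d: "d0 \<in> grade D 0" "d1 \<in> grade D 1" "h v = d0 \<oplus>\<^bsub>D\<^esub> d1"
      using D.grade_split[OF hD[OF v(1)]] .
    have dc: "d0 \<in> carrier D" "d1 \<in> carrier D" using d D.grade_in by blast+
    have e: "g v = l d0 \<oplus>\<^bsub>B\<^esub> l d1" using lh[OF v(1)] d(3) l'(2)[OF dc] by simp
    have lg: "l d0 \<in> grade B 0" "l d1 \<in> grade B 1" using l'(4) d by blast+
    have gv: "g v \<in> grade B s" by (rule g'(4)[OF v(2)])
    have e': "g v \<oplus>\<^bsub>B\<^esub> \<zero>\<^bsub>B\<^esub> = l d0 \<oplus>\<^bsub>B\<^esub> l d1" "\<zero>\<^bsub>B\<^esub> \<oplus>\<^bsub>B\<^esub> g v = l d0 \<oplus>\<^bsub>B\<^esub> l d1"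
      using e B.grade_in[OF gv] by simp_all
    show ?thesis
    proof (cases "s = 0")
      case True
      then have "g v = l d0" using B.grade_unique(1)[OF _ lg(1) B.zero_in_grade lg(2) e'(1)] gv by simp
      then show ?thesis using hI[OF v(1) dc(1)] d(1) True by simp
    next
      case False
      then have "g v = l d1" using B.grade_unique(2)[OF B.zero_in_grade lg(1) _ lg(2) e'(2)] gv by simp
      then show ?thesis using hI[OF v(1) dc(2)] d(2) False by simp
    qed
  qed
  have hom: "conf_hom R (sub_conf M X) D h"
    unfolding conf_hom_def sub_conf_simps
  proof (intro conjI ballI allI)
    fix v assume v: "v \<in> X"
    show "h v \<in> carrier D" by (rule hD[OF v])
    show "h (v \<oplus>\<^bsub>M\<^esub> w) = h v \<oplus>\<^bsub>D\<^esub> h w" if w: "w \<in> X" for w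
      by (rule hI) (use v w X'(1,3) hD lh l'(2) g'(2) in simp_all)
    show "h (q \<odot>\<^bsub>M\<^esub> v) = q \<odot>\<^bsub>D\<^esub> h v" for q
      by (rule hI) (use v X'(1,4) hD lh l'(3) g'(3) in simp_all)
    show "h (lact M a v n) = lact D a (h v) n" if a: "a \<in> carrier R" for a n
      by (rule hI) (use v a X'(1,5) hD lh l'(5) g'(5) closed_confD(2)[OF D] in simp_all)
  qed (use gr in blast)
  have "carrier D \<subseteq> h ` X"
  proof
    fix d assume d: "d \<in> carrier D"
    then have "l d \<in> g ` carrier M" using sub by blast
    then obtain v where v: "v \<in> carrier M" "g v = l d" by auto
    then have "v \<in> X" unfolding X using d by simp
    then have "h v = d" using hI d v(2) by simp
    then show "d \<in> h ` X" using \<open>v \<in> X\<close> by blast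
  qed
  then show "conf_onto R (sub_conf M X) D h"
    using hom hD unfolding conf_onto_def by auto
  have z: "l \<zero>\<^bsub>D\<^esub> = \<zero>\<^bsub>B\<^esub>" by (rule conf_hom_zero[OF l(1) D.supermodule_axioms B])
  have "h v = \<zero>\<^bsub>D\<^esub> \<longleftrightarrow> g v = \<zero>\<^bsub>B\<^esub>" if "v \<in> X" for v
    using lh[OF that] hI[OF that D.M.zero_closed] z by metis
  moreover have "\<zero>\<^bsub>B\<^esub> \<in> l ` carrier D" using z D.M.zero_closed by (metis imageI)
  ultimately show "conf_ker (sub_conf M X) D h = conf_ker M B g"
    unfolding conf_ker_def X by auto
qed

lemma conf_hom_id: "conf_hom R M M id"
  unfolding conf_hom_def by simp

lemma conf_ker_id: "supermodule M \<Longrightarrow> conf_ker M M id = {\<zero>\<^bsub>M\<^esub>}"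
  using abelian_monoid.zero_closed unfolding conf_ker_def supermodule_def Module.module_def abelian_group_def
  by auto

lemma conf_onto_comp:
  assumes "conf_onto R M B g" "conf_onto R B C k"
  shows "conf_onto R M C (k \<circ> g)"
  using assms conf_hom_comp[of R M B g C k] unfolding conf_onto_def
  by (simp add: image_comp[symmetric] del: o_apply)

text \<open>This and the next three lemmas produce single steps of a series: a quotient at the top,
  a submodule mapping onto a model, the preimage of a submodule of a quotient, and an embedded
  submodule at the bottom.\<close>

lemma cover_onto:
  assumes M: "conformal_module R M" and g: "conf_onto R M S g" and S: "supermodule S" "conf_simple R S"
  shows "conf_cover R M (conf_ker M S g) (carrier M)"
    "conf_iso R S (quot_conf (sub_conf M (carrier M)) (conf_ker M S g))"
proof -
  have c: "conf_sub R M (carrier M)" by (rule conf_sub_carrier[OF conformal_module_closed[OF M]])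
  interpret M: supermodule M by (rule conformal_module_supermodule[OF M])
  have g': "conf_onto R (sub_conf M (carrier M)) S g"
    using g unfolding conf_onto_def conf_hom_def by simp
  have k: "conf_ker M S g = conf_ker (sub_conf M (carrier M)) S g" unfolding conf_ker_def by simp
  note f = conf_factor[OF M c S(1) g' k]
  show "conf_cover R M (conf_ker M S g) (carrier M)" using f(3) S(2) by blast
  have "closed_conf R (quot_conf (sub_conf M (carrier M)) (conf_ker M S g))"
    by (intro conformal_module_closed subquotient(1) M c f(1)) (auto simp: conf_ker_def)
  then show "conf_iso R S (quot_conf (sub_conf M (carrier M)) (conf_ker M S g))"
    by (rule conf_iso_sym[OF f(2)])
qed

lemma cover_sub:
  assumes M: "conformal_module R M" and X: "conf_sub R M X" and h: "conf_onto R (sub_conf M X) S h"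
    and S: "supermodule S" "conf_simple R S" and Y: "Y = conf_ker (sub_conf M X) S h"
  shows "conf_cover R M Y X" "conf_iso R S (quot_conf (sub_conf M X) Y)"
proof -
  note f = conf_factor[OF M X S(1) h Y]
  show "conf_cover R M Y X" using f(3) S(2) by blast
  have "closed_conf R (quot_conf (sub_conf M X) Y)"
    by (intro conformal_module_closed subquotient(1) M X f(1)) (auto simp: conf_ker_def Y)
  then show "conf_iso R S (quot_conf (sub_conf M X) Y)" by (rule conf_iso_sym[OF f(2)])
qed

lemma cover_vimage:
  assumes M: "conformal_module R M" and g: "conf_hom R M B g" and B: "supermodule B"
    and l: "conf_hom R D B l" "inj_on l (carrier D)" and D: "closed_conf R D" "conf_simple R D"
    and X: "X = {v \<in> carrier M. g v \<in> l ` carrier D}" and sub: "l ` carrier D \<subseteq> g ` carrier M"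
    and Y: "Y = conf_ker M B g"
  shows "conf_cover R M Y X" "conf_iso R D (quot_conf (sub_conf M X) Y)"
proof -
  note h = conf_hom_inv_into[OF l D(1) g conformal_module_closed[OF M] B X sub]
  have "Y = conf_ker (sub_conf M X) D (\<lambda>v. inv_into (carrier D) l (g v))" using h(4) Y by simp
  note c = cover_sub[OF M h(2) h(1) closed_confD(1)[OF D(1)] D(2) this]
  show "conf_cover R M Y X" "conf_iso R D (quot_conf (sub_conf M X) Y)" by (fact c)+
qed

lemma cover_embed:
  assumes M: "conformal_module R M"
    and l: "conf_hom R D M l" "inj_on l (carrier D)" and D: "closed_conf R D" "conf_simple R D"
  shows "conf_cover R M {\<zero>\<^bsub>M\<^esub>} (l ` carrier D)" "conf_iso R D (quot_conf (sub_conf M (l ` carrier D)) {\<zero>\<^bsub>M\<^esub>})"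
proof -
  have "l ` carrier D = {v \<in> carrier M. id v \<in> l ` carrier D}" "l ` carrier D \<subseteq> id ` carrier M"
    using conf_homD(1)[OF l(1)] by auto
  note c = cover_vimage[OF M conf_hom_id conformal_module_supermodule[OF M] l D this
      conf_ker_id[OF conformal_module_supermodule[OF M], symmetric]]
  show "conf_cover R M {\<zero>\<^bsub>M\<^esub>} (l ` carrier D)"
    "conf_iso R D (quot_conf (sub_conf M (l ` carrier D)) {\<zero>\<^bsub>M\<^esub>})" by (fact c)+
qed

lemma composition_seriesI:
  assumes M: "conformal_module R M" and "Ns \<noteq> []" "hd Ns = {\<zero>\<^bsub>M\<^esub>}" "last Ns = carrier M"
    and cover: "\<And>i. Suc i < length Ns \<Longrightarrow> conf_cover R M (Ns ! i) (Ns ! Suc i)"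
  shows "composition_series R M Ns"
proof -
  have "conf_sub R M N" if N: "N \<in> set Ns" for N
  proof -
    obtain i where i: "i < length Ns" "N = Ns ! i" using N by (auto simp: in_set_conv_nth)
    show ?thesis
    proof (cases i)
      case 0
      then have "N = {\<zero>\<^bsub>M\<^esub>}" using assms(2,3) i by (simp add: hd_conv_nth)
      then show ?thesis using conf_sub_zero[OF conformal_moduleD(3)[OF M]] by simp
    next
      case (Suc k)
      then show ?thesis using cover[of k] i by (simp add: conf_cover_def)
    qed
  qed
  moreover have "simple_module R Q" if Q: "Q \<in> set (series_factors M Ns)" for Q
  proof -
    obtain i where "Suc i < length Ns" "Q = quot_conf (sub_conf M (Ns ! Suc i)) (Ns ! i)"
      using Q by (auto simp: series_factors_def less_diff_conv)
    then show ?thesis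
      using cover[of i] subquotient(1)[OF M] by (simp add: conf_cover_def simple_module_iff)
  qed
  ultimately show ?thesis
    using assms by (simp add: composition_series_def conformal_submodule_iff conf_cover_def)
qed

text \<open>The predicate is vacuous on purpose: only the number of factors is recorded. With a
  single factor there are no two positions to tell apart, which yields multiplicity one for simple
  modules.\<close>

lemma composition_factors_are_simple:
  assumes "simple_module R M"
  shows "composition_factors_are R M [\<lambda>Q. True]"
proof (rule composition_factors_areI[of R M "[{\<zero>\<^bsub>M\<^esub>}, carrier M]" "[\<lambda>Q. True]"])
  have M: "conformal_module R M" "conf_simple R M" using assms unfolding simple_module_iff by blast+
  note s = conformal_module_supermodule[OF M(1)]
  have "conf_onto R M M id" by (simp add: conf_onto_def conf_hom_id)
  from cover_onto(1)[OF M(1) this s M(2)]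
  show "composition_series R M [{\<zero>\<^bsub>M\<^esub>}, carrier M]"
    by (intro composition_seriesI M(1)) (simp_all add: conf_ker_id[OF s])
qed (auto simp: series_factors_def)

context
  fixes R :: "('r, 'r) conf" and M :: "('r, 'v) conf" and A :: "('r, 'a) conf" and B :: "('r, 'b) conf" and f g
  assumes M: "conformal_module R M" and ses: "conf_ses R A f M g B"
begin

lemma composition_factors_are_ses:
  assumes "conf_simple R A" "conf_simple R B" "mset [conf_iso R A, conf_iso R B] = mset Fs"
  shows "composition_factors_are R M Fs"
proof (rule composition_factors_areI[OF _ _ _ _ assms(3)])
  note s = conf_sesD[OF ses]
  note c1 = cover_embed[OF M s(4,5) s(1) assms(1), unfolded s(9)]
  note c2 = cover_onto[OF M s(6) s(12) assms(2)]
  let ?Ns = "[{\<zero>\<^bsub>M\<^esub>}, conf_ker M B g, carrier M]"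
  show "composition_series R M ?Ns"
    by (rule composition_seriesI[OF M]) (use c1(1) c2(1) in \<open>auto simp: less_Suc_eq\<close>)
  show "([conf_iso R A, conf_iso R B] ! i) (series_factors M ?Ns ! i)" if "i < length [conf_iso R A, conf_iso R B]" for i
    using that c1(2) c2(2) by (auto simp: series_factors_def less_Suc_eq)
qed (auto simp: series_factors_def intro: conf_iso_trans)

text \<open>For a quotient \<open>B\<close> that is itself an extension of \<open>C\<close> by
  \<open>D\<close>: the new member of the series is the preimage of \<open>D\<close>, which is the
  kernel of the composite from \<open>M\<close> through \<open>B\<close> to
  \<open>C\<close>.\<close>

lemma composition_factors_are_ses_quot:
  assumes "conf_simple R A" and ses': "conf_ses R D l B k C" and "conf_simple R D" "conf_simple R C"
    and "mset [conf_iso R A, conf_iso R D, conf_iso R C] = mset Fs"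
  shows "composition_factors_are R M Fs"
proof (rule composition_factors_areI[OF _ _ _ _ assms(5)])
  note s = conf_sesD[OF ses] and t = conf_sesD[OF ses']
  note c1 = cover_embed[OF M s(4,5) s(1) assms(1), unfolded s(9)]
  have X: "conf_ker M C (k \<circ> g) = {v \<in> carrier M. g v \<in> l ` carrier D}"
    unfolding t(9) conf_ker_def using conf_homD(1)[OF s(7)] by auto
  have sub: "l ` carrier D \<subseteq> g ` carrier M" unfolding t(9) s(8) conf_ker_def by blast
  note c2 = cover_vimage[OF M s(7) s(12) t(4,5) t(1) assms(3) X sub refl]
  note c3 = cover_onto[OF M conf_onto_comp[OF s(6) t(6)] t(12) assms(4)]
  let ?Ns = "[{\<zero>\<^bsub>M\<^esub>}, conf_ker M B g, conf_ker M C (k \<circ> g), carrier M]"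
  show "composition_series R M ?Ns"
    by (rule composition_seriesI[OF M]) (use c1(1) c2(1) c3(1) in \<open>auto simp: less_Suc_eq\<close>)
  show "([conf_iso R A, conf_iso R D, conf_iso R C] ! i) (series_factors M ?Ns ! i)"
    if "i < length [conf_iso R A, conf_iso R D, conf_iso R C]" for i
    using that c1(2) c2(2) c3(2) by (auto simp: series_factors_def less_Suc_eq numeral_2_eq_2)
qed (auto simp: series_factors_def intro: conf_iso_trans)

text \<open>For a submodule \<open>A\<close> that is itself an extension: \<open>D\<close> is
  embedded through \<open>A\<close>, and \<open>C\<close> is reached from the kernel of
  \<open>g\<close> by inverting \<open>f\<close> and then applying \<open>k\<close>.\<close>

lemma composition_factors_are_ses_sub:
  assumes ses': "conf_ses R D l A k C" and "conf_simple R D" "conf_simple R C" "conf_simple R B"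
    and "mset [conf_iso R D, conf_iso R C, conf_iso R B] = mset Fs"
  shows "composition_factors_are R M Fs"
proof (rule composition_factors_areI[OF _ _ _ _ assms(5)])
  note s = conf_sesD[OF ses] and t = conf_sesD[OF ses']
  have inj: "inj_on (f \<circ> l) (carrier D)"
    by (rule comp_inj_on[OF t(5)], rule inj_on_subset[OF s(5)]) (use conf_homD(1)[OF t(4)] in blast)
  note c1 = cover_embed[OF M conf_hom_comp[OF t(4) s(4)] inj t(1) assms(2)]
  have X: "conf_ker M B g = {v \<in> carrier M. id v \<in> f ` carrier A}" "f ` carrier A \<subseteq> id ` carrier M"
    unfolding s(9) conf_ker_def by auto
  note h = conf_hom_inv_into[OF s(4,5) s(1) conf_hom_id s(2,11) X]
  have h1: "conf_onto R (sub_conf M (conf_ker M B g)) C (k \<circ> (\<lambda>v. inv_into (carrier A) f (id v)))"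
    by (rule conf_onto_comp[OF h(1) t(6)])
  have "(f \<circ> l) ` carrier D = f ` conf_ker A C k" by (simp add: image_comp[symmetric] t(9) del: o_apply)
  also have "\<dots> = conf_ker (sub_conf M (conf_ker M B g)) C (k \<circ> (\<lambda>v. inv_into (carrier A) f (id v)))"
    unfolding conf_ker_def[of "sub_conf M (conf_ker M B g)"] sub_conf_simps s(9)[symmetric]
    using s(5) by (auto simp: conf_ker_def image_iff)
  finally have k: "(f \<circ> l) ` carrier D =
    conf_ker (sub_conf M (conf_ker M B g)) C (k \<circ> (\<lambda>v. inv_into (carrier A) f (id v)))" .
  note c2 = cover_sub[OF M h(2) h1 t(12) assms(3) k]
  note c3 = cover_onto[OF M s(6) s(12) assms(4)]
  let ?Ns = "[{\<zero>\<^bsub>M\<^esub>}, (f \<circ> l) ` carrier D, conf_ker M B g, carrier M]"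
  show "composition_series R M ?Ns"
    by (rule composition_seriesI[OF M]) (use c1(1) c2(1) c3(1) in \<open>auto simp: less_Suc_eq\<close>)
  show "([conf_iso R D, conf_iso R C, conf_iso R B] ! i) (series_factors M ?Ns ! i)"
    if "i < length [conf_iso R D, conf_iso R C, conf_iso R B]" for i
    using that c1(2) c2(2) c3(2) by (auto simp: series_factors_def less_Suc_eq numeral_2_eq_2)
qed (auto simp: series_factors_def intro: conf_iso_trans)

lemma has_sub_quot_ses: "has_sub_quot R M A B"
  unfolding has_sub_quot_def
proof (intro exI[of _ "conf_ker M B g"] conjI)
  note s = conf_sesD[OF ses]
  show "conformal_submodule R M (conf_ker M B g)"
    using M conf_sub_ker[OF s(7) conformal_moduleD(3)[OF M] s(12)] by (simp add: conformal_submodule_iff)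
  show "conf_iso R (quot_conf M (conf_ker M B g)) B" by (rule first_iso[OF s(6) M s(12)])
  have X: "conf_ker M B g = {v \<in> carrier M. id v \<in> f ` carrier A}" "f ` carrier A \<subseteq> id ` carrier M"
    unfolding s(9) conf_ker_def by auto
  note h = conf_hom_inv_into[OF s(4,5) s(1) conf_hom_id s(2,11) X]
  have sup: "supermodule (sub_conf M (conf_ker M B g))"
    by (rule conformal_module_supermodule[OF conformal_module_sub_conf[OF M h(2)]])
  have "inj_on (\<lambda>v. inv_into (carrier A) f (id v)) (conf_ker M B g)"
    unfolding s(9)[symmetric] using s(5) by (auto simp: inj_on_def)
  then show "conf_iso R (sub_conf M (conf_ker M B g)) A"
    unfolding conf_iso_iff using h(1) onto_grade[OF h(1) sup s(10)]
    by (auto simp: conf_onto_def bij_betw_def)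
qed

lemma not_simple_ses:
  assumes "carrier A \<noteq> {\<zero>\<^bsub>A\<^esub>}" "carrier B \<noteq> {\<zero>\<^bsub>B\<^esub>}"
  shows "\<not> simple_module R M"
proof
  note s = conf_sesD[OF ses]
  interpret A: supermodule A by (rule s(10))
  interpret B: supermodule B by (rule s(12))
  assume "simple_module R M"
  then have "conf_ker M B g = {\<zero>\<^bsub>M\<^esub>} \<or> conf_ker M B g = carrier M"
    using conf_sub_ker[OF s(7) conformal_moduleD(3)[OF M] s(12)]
    unfolding simple_module_iff conf_simple_def by blast
  then show False
  proof
    assume "conf_ker M B g = {\<zero>\<^bsub>M\<^esub>}"
    then have "f ` carrier A = f ` {\<zero>\<^bsub>A\<^esub>}" using s(9) conf_hom_zero[OF s(4) s(10,11)] by simp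
    then show False using inj_on_image_eq_iff[OF s(5), of "carrier A" "{\<zero>\<^bsub>A\<^esub>}"] assms(1) by simp
  next
    assume "conf_ker M B g = carrier M"
    then have "\<forall>v\<in>carrier M. g v = \<zero>\<^bsub>B\<^esub>" by (auto simp: conf_ker_def)
    then have "carrier B \<subseteq> {\<zero>\<^bsub>B\<^esub>}" unfolding s(8)[symmetric] by (simp add: image_subset_iff)
    then show False using assms(2) by auto
  qed
qed

end

text \<open>The invariant that tells the composition factors apart: the scalar by which the \<open>\<lambda>\<^sup>0\<close>-coefficient
  of a fixed element acts on a graded part, and \<open>None\<close> if this part is zero.\<close>

definition grade_charge :: "'r \<Rightarrow> ('r, 'v) conf \<Rightarrow> bit \<Rightarrow> complex option \<Rightarrow> bool" where
  "grade_charge a M s c \<longleftrightarrow> (case c of None \<Rightarrow> grade M s = {\<zero>\<^bsub>M\<^esub>}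
     | Some \<kappa> \<Rightarrow> grade M s \<noteq> {\<zero>\<^bsub>M\<^esub>} \<and> (\<forall>v\<in>grade M s. lact M a v 0 = [:\<kappa>:] \<odot>\<^bsub>M\<^esub> v))"

lemma grade_charge_iso:
  assumes "conf_iso R S Q" "supermodule S" "supermodule Q" "a \<in> carrier R" "grade_charge a S s c"
  shows "grade_charge a Q s c"
proof -
  interpret S: supermodule S by fact
  interpret Q: supermodule Q by fact
  obtain f where f: "conf_hom R S Q f" "bij_betw f (carrier S) (carrier Q)" "\<And>s. f ` grade S s = grade Q s"
    using assms(1) unfolding conf_iso_iff by blast
  note f' = conf_homD[OF f(1)]
  have z: "f ` {\<zero>\<^bsub>S\<^esub>} = {\<zero>\<^bsub>Q\<^esub>}" using conf_hom_zero[OF f(1) assms(2,3)] by simp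
  have g: "grade Q s = {\<zero>\<^bsub>Q\<^esub>} \<longleftrightarrow> grade S s = {\<zero>\<^bsub>S\<^esub>}"
    unfolding f(3)[symmetric] z[symmetric]
    by (rule inj_on_image_eq_iff[OF bij_betw_imp_inj_on[OF f(2)]]) (use S.grade_in in auto)
  show ?thesis
  proof (cases c)
    case None
    then show ?thesis using assms(5) g by (simp add: grade_charge_def)
  next
    case (Some \<kappa>)
    have "lact Q a w 0 = [:\<kappa>:] \<odot>\<^bsub>Q\<^esub> w" if "w \<in> grade Q s" for w
    proof -
      have "w \<in> f ` grade S s" using that f(3)[of s] by simp
      then obtain v where v: "v \<in> grade S s" "w = f v" by auto
      have "lact S a v 0 = [:\<kappa>:] \<odot>\<^bsub>S\<^esub> v" using v(1) assms(5) Some by (simp add: grade_charge_def)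
      then show ?thesis
        using f'(3)[OF S.grade_in[OF v(1)], of "[:\<kappa>:]"] f'(5)[OF assms(4) S.grade_in[OF v(1)], of 0] v(2)
        by simp
    qed
    then show ?thesis using assms(5) g Some by (simp add: grade_charge_def)
  qed
qed

text \<open>On a nonzero part two different scalars cannot both occur, since their difference would
  annihilate it and is invertible; a zero part admits only \<open>None\<close>.\<close>

lemma grade_charge_unique:
  assumes "supermodule M" "grade_charge a M s c" "grade_charge a M s d"
  shows "c = d"
proof -
  interpret supermodule M by fact
  have "\<kappa> = \<mu>" if k: "grade_charge a M s (Some \<kappa>)" "grade_charge a M s (Some \<mu>)" for \<kappa> \<mu>
  proof (rule ccontr)
    assume ne: "\<kappa> \<noteq> \<mu>"
    have "v = \<zero>\<^bsub>M\<^esub>" if v: "v \<in> grade M s" for v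
    proof -
      have c: "v \<in> carrier M" by (rule grade_in[OF v])
      have e: "[:\<kappa>:] \<odot>\<^bsub>M\<^esub> v = [:\<mu>:] \<odot>\<^bsub>M\<^esub> v" using k v by (auto simp: grade_charge_def)
      have "[:\<kappa> - \<mu>:] \<odot>\<^bsub>M\<^esub> v = [:\<kappa>:] \<odot>\<^bsub>M\<^esub> v \<oplus>\<^bsub>M\<^esub> [:- \<mu>:] \<odot>\<^bsub>M\<^esub> v"
        using smult_l_distr[of "[:\<kappa>:]" "[:- \<mu>:]" v] c by simp
      also have "\<dots> = [:\<mu>:] \<odot>\<^bsub>M\<^esub> v \<oplus>\<^bsub>M\<^esub> [:- \<mu>:] \<odot>\<^bsub>M\<^esub> v" using e by simp
      also have "\<dots> = 0 \<odot>\<^bsub>M\<^esub> v"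
        using smult_l_distr[of "[:\<mu>:]" "[:- \<mu>:]" v] c by simp
      also have "\<dots> = \<zero>\<^bsub>M\<^esub>" using smult_l_null[of v] c by simp
      finally have "[:1 / (\<kappa> - \<mu>):] \<odot>\<^bsub>M\<^esub> ([:\<kappa> - \<mu>:] \<odot>\<^bsub>M\<^esub> v) = \<zero>\<^bsub>M\<^esub>"
        using smult_r_null[of "[:1 / (\<kappa> - \<mu>):]"] by simp
      then show ?thesis
        using smult_assoc1[of "[:1 / (\<kappa> - \<mu>):]" "[:\<kappa> - \<mu>:]" v] smult_one[of v] c ne by (simp add: one_pCons)
    qed
    then have "grade M s = {\<zero>\<^bsub>M\<^esub>}" using zero_in_grade by blast
    then show False using k by (simp add: grade_charge_def)
  qed
  then show ?thesis using assms(2,3) by (cases c; cases d) (auto simp: grade_charge_def)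
qed

lemma multiplicity_one_charges:
  assumes F: "composition_factors_are R M Fs" and len: "length cs = length Fs" and dist: "distinct cs"
    and charge: "\<And>i Q. \<lbrakk>i < length Fs; (Fs ! i) Q; conformal_module R Q\<rbrakk> 
      \<Longrightarrow> grade_charge a Q 0 (fst (cs ! i)) \<and> grade_charge a Q 1 (snd (cs ! i))"
    and iso: "\<And>F Q Q'. \<lbrakk>F \<in> set Fs; F Q; conf_iso R Q Q'\<rbrakk> \<Longrightarrow> F Q'"
  shows "multiplicity_one R M"
proof (rule multiplicity_oneI[OF F])
  fix i j Q assume *: "i < length Fs" "j < length Fs" "i \<noteq> j" "(Fs ! i) Q" "(Fs ! j) Q" "conformal_module R Q"
  then have "cs ! i = cs ! j"
    using grade_charge_unique[OF conformal_module_supermodule[OF *(6)]] charge by (metis prod_eqI)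
  then show False using * dist len by (simp add: nth_eq_iff_index_eq)
qed (rule iso)

section \<open>Free conformal modules\<close>

definition ev :: "complex poly poly \<Rightarrow> complex \<Rightarrow> complex \<Rightarrow> complex" where
  "ev q l d = poly (poly q [:l:]) d"

lemma ev_simps [simp]:
  "ev 0 l d = 0" "ev 1 l d = 1" "ev (q + q') l d = ev q l d + ev q' l d" "ev (- q) l d = - ev q l d"
  "ev (q - q') l d = ev q l d - ev q' l d" "ev (q * q') l d = ev q l d * ev q' l d"
  "ev (q ^ n) l d = ev q l d ^ n" "ev (numeral m) l d = numeral m" "ev lam l d = l" "ev del l d = d" "ev (cst c) l d = c"
  by (simp_all add: ev_def lam_def del_def cst_def poly_power)

lemma ev_sum [simp]: "ev (sum f A) l d = (\<Sum>a\<in>A. ev (f a) l d)"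
  by (simp add: ev_def poly_sum)

lemma ev_subst_del [simp]: "ev (subst_del f z) l d = poly f (ev z l d)"
  by (induction f) (simp_all add: subst_del_def map_poly_pCons cst_def, simp_all add: ev_def)

lemma ev_pcompose [simp]: "ev (pcompose q z) l d = ev q (ev z l d) d"
  by (induction q) (simp_all add: pcompose_pCons, simp_all add: ev_def)

text \<open>The constants \<open>[:l:]\<close> form an infinite set of roots of the difference, read
  as a polynomial in lambda over the integral domain of polynomials in the derivation.\<close>

lemma ev_eqI:
  assumes "\<And>l d. ev q l d = ev q' l d"
  shows "q = q'"
proof (rule ccontr)
  assume "q \<noteq> q'"
  then have "finite {x. poly (q - q') x = 0}" by (intro poly_roots_finite) simp
  moreover have "range (\<lambda>l. [:l:]) \<subseteq> {x. poly (q - q') x = 0}"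
    using assms by (auto simp: ev_def poly_eq_poly_eq_iff[symmetric] fun_eq_iff)
  ultimately have "finite (range (\<lambda>l :: complex. [:l:]))" by (rule rev_finite_subset)
  then have "finite (UNIV :: complex set)" by (rule finite_imageD) (simp add: inj_on_def)
  then show False using infinite_UNIV_char_0 by blast
qed

lemma ev_altdef:
  assumes "\<And>n. N < n \<Longrightarrow> poly (coeff q n) d = 0"
  shows "ev q l d = (\<Sum>n\<le>N. l ^ n * poly (coeff q n) d)"
proof -
  have "ev q l d = (\<Sum>n\<le>degree q. l ^ n * poly (coeff q n) d)"
    unfolding ev_def poly_altdef[of q] by (simp add: poly_sum poly_power mult.commute poly_const_pow)
  also have "\<dots> = (\<Sum>n\<le>max N (degree q). l ^ n * poly (coeff q n) d)"
    by (rule sum.mono_neutral_left) (auto simp: coeff_eq_0)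
  also have "\<dots> = (\<Sum>n\<le>N. l ^ n * poly (coeff q n) d)"
    using assms by (intro sum.mono_neutral_right) auto
  finally show ?thesis .
qed

abbreviation "lookup \<equiv> Poly_Mapping.lookup"

abbreviation "keys \<equiv> Poly_Mapping.keys"

section \<open>The lambda-action on a free module\<close>

lemma lookup_map: "g 0 = 0 \<Longrightarrow> lookup (Poly_Mapping.map g m) k = g (lookup m k)"
  by (simp add: Poly_Mapping.map.rep_eq when_def)

lemma free_conf_simps [simp]:
  "carrier (free_conf p s) = UNIV" "zero (free_conf p s) = 0" "add (free_conf p s) = (+)"
  "module.smult (free_conf p s) q v = Poly_Mapping.map ((*) q) v"
  "grade (free_conf p s) e = {v. \<forall>b\<in>keys v. p b = e}"
  by (simp_all add: free_conf_def)

text \<open>Keeps all powers of lambda together, one coordinate of the result at a time, so that the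
  action can be evaluated; \<open>lact\<close> consists of its coefficients.\<close>

definition lactp where
  "lactp s x v c = (\<Sum>a\<in>keys x. \<Sum>b\<in>keys v.
     subst_del (lookup x a) (- lam) * subst_del (lookup v b) (del + lam) * lookup (s a b) c)"

lemma lookup_lact: "lookup (lact (free_conf p s) x v n) c = coeff (lactp s x v c) n"
  by (simp add: free_conf_def lactp_def lookup_map lookup_sum)

text \<open>The index sets may exceed the supports, so that elements with different supports can be
  summed over a common set.\<close>

lemma ev_lactp:
  assumes "finite A" "keys x \<subseteq> A" "finite B" "keys v \<subseteq> B"
  shows "ev (lactp s x v c) l d =
    (\<Sum>a\<in>A. \<Sum>b\<in>B. poly (lookup x a) (- l) * poly (lookup v b) (d + l) * ev (lookup (s a b) c) l d)"
proof -
  have "ev (lactp s x v c) l d = (\<Sum>a\<in>keys x. \<Sum>b\<in>keys v.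
      poly (lookup x a) (- l) * poly (lookup v b) (d + l) * ev (lookup (s a b) c) l d)"
    by (simp add: lactp_def)
  also have "\<dots> = (\<Sum>a\<in>keys x. \<Sum>b\<in>B.
      poly (lookup x a) (- l) * poly (lookup v b) (d + l) * ev (lookup (s a b) c) l d)"
    by (intro sum.cong refl sum.mono_neutral_left) (use assms in \<open>auto simp: in_keys_iff\<close>)
  also have "\<dots> = (\<Sum>a\<in>A. \<Sum>b\<in>B. poly (lookup x a) (- l) * poly (lookup v b) (d + l) * ev (lookup (s a b) c) l d)"
    by (intro sum.mono_neutral_left) (use assms in \<open>auto simp: in_keys_iff\<close>)
  finally show ?thesis .
qed

lemma keys_map_subset: "keys (Poly_Mapping.map g v) \<subseteq> keys v"
  by (auto simp: in_keys_iff Poly_Mapping.map.rep_eq)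

lemma ev_lactp_add_left: "ev (lactp s (x + y) v c) l d = ev (lactp s x v c) l d + ev (lactp s y v c) l d"
proof -
  let ?A = "keys x \<union> keys y" and ?B = "keys v"
  have "keys (x + y) \<subseteq> ?A" by (rule keys_add)
  then show ?thesis
    by (simp add: ev_lactp[of ?A _ ?B] lookup_add algebra_simps sum.distrib)
qed

lemma ev_lactp_add_right: "ev (lactp s x (v + w) c) l d = ev (lactp s x v c) l d + ev (lactp s x w c) l d"
proof -
  let ?A = "keys x" and ?B = "keys v \<union> keys w"
  have "keys (v + w) \<subseteq> ?B" by (rule keys_add)
  then show ?thesis
    by (simp add: ev_lactp[of ?A _ ?B] lookup_add algebra_simps sum.distrib)
qed

lemma ev_lactp_smult_left:
  "ev (lactp s (Poly_Mapping.map ((*) q) x) v c) l d = poly q (- l) * ev (lactp s x v c) l d"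
  by (simp add: ev_lactp[of "keys x" _ "keys v"] keys_map_subset lookup_map
      sum_distrib_left mult.assoc)

lemma ev_lactp_smult_right:
  "ev (lactp s x (Poly_Mapping.map ((*) q) v) c) l d = poly q (d + l) * ev (lactp s x v c) l d"
  by (simp add: ev_lactp[of "keys x" _ "keys v"] keys_map_subset lookup_map
      sum_distrib_left mult_ac)

lemma supermodule_free_conf: "supermodule (free_conf p s)"
proof -
  let ?M = "free_conf p s"
  have ab: "abelian_group ?M"
    by (rule abelian_groupI) (auto simp: add.assoc add.commute intro: exI[of _ "- _"])
  have mod: "Module.module CD ?M"
    by (rule moduleI[OF cring_CD ab])
       (auto intro!: poly_mapping_eqI simp: lookup_map lookup_add algebra_simps)
  interpret M: Module.module CD ?M by (rule mod)
  have inv: "\<ominus>\<^bsub>?M\<^esub> v = - v" for v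
    by (rule M.M.minus_equality) simp_all
  show ?thesis
  proof (intro supermodule.intro[OF mod] supermodule_axioms.intro)
    show "submodule (grade ?M e) CD ?M" for e
    proof (rule M.submoduleI)
      show "a \<oplus>\<^bsub>?M\<^esub> b \<in> grade ?M e" if "a \<in> grade ?M e" "b \<in> grade ?M e" for a b
        using that keys_add[of a b] by auto
      show "q \<odot>\<^bsub>?M\<^esub> a \<in> grade ?M e" if "a \<in> grade ?M e" for q a
        using that keys_map_subset[of "(*) q" a] by auto
    qed (simp_all add: inv in_keys_iff)
    show "grade ?M 0 <+>\<^bsub>?M\<^esub> grade ?M 1 = carrier ?M"
    proof -
      have "v \<in> grade ?M 0 <+>\<^bsub>?M\<^esub> grade ?M 1" for v
      proof -
        define v0 v1 where "v0 = Abs_poly_mapping (\<lambda>b. if p b = 0 then lookup v b else 0)"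
          and "v1 = Abs_poly_mapping (\<lambda>b. if p b = 0 then 0 else lookup v b)"
        have f: "finite {b. (if p b = 0 then lookup v b else 0) \<noteq> 0}"
          "finite {b. (if p b = 0 then 0 else lookup v b) \<noteq> 0}"
          by (rule finite_subset[OF _ finite_lookup[of v]]; auto)+
        have l: "lookup v0 b = (if p b = 0 then lookup v b else 0)"
          "lookup v1 b = (if p b = 0 then 0 else lookup v b)" for b
          unfolding v0_def v1_def using f by simp_all
        have "v0 \<in> grade ?M 0" "v1 \<in> grade ?M 1" by (auto simp: in_keys_iff l split: if_splits)
        moreover have "v = v0 + v1" by (rule poly_mapping_eqI) (simp add: lookup_add l)
        ultimately show ?thesis using set_addI[of v0 "grade ?M 0" v1 "grade ?M 1" ?M] by simp
      qed
      then show ?thesis by auto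
    qed
    have "v = 0" if "\<forall>b\<in>keys v. p b = 0" "\<forall>b\<in>keys v. p b = 1" for v
    proof -
      have "keys v = {}" using that by fastforce
      then show ?thesis by simp
    qed
    then show "grade ?M 0 \<inter> grade ?M 1 = {\<zero>\<^bsub>?M\<^esub>}" by auto
  qed
qed

lemma minus_free_conf: "\<ominus>\<^bsub>free_conf p s\<^esub> v = - v" "u \<ominus>\<^bsub>free_conf p s\<^esub> v = u - v"
proof -
  interpret supermodule "free_conf p s" by (rule supermodule_free_conf)
  show *: "\<ominus>\<^bsub>free_conf p s\<^esub> v = - v" for v by (rule M.minus_equality) simp_all
  show "u \<ominus>\<^bsub>free_conf p s\<^esub> v = u - v" unfolding M.minus_eq * by simp
qed

lemma finsum_free_conf: "finite A \<Longrightarrow> finsum (free_conf p s) g A = sum g A"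
proof (induction A rule: finite_induct)
  case empty
  interpret supermodule "free_conf p s" by (rule supermodule_free_conf)
  show ?case by simp
next
  case (insert a A)
  interpret supermodule "free_conf p s" by (rule supermodule_free_conf)
  show ?case using insert by (subst M.finsum_insert) auto
qed

lemma finite_lact_free_conf: "finite {n. lact (free_conf p s) x v n \<noteq> 0}"
proof -
  let ?T = "\<Sum>a\<in>keys x. \<Sum>b\<in>keys v.
     Poly_Mapping.map ((*) (subst_del (lookup x a) (- lam) * subst_del (lookup v b) (del + lam))) (s a b)"
  have "{n. lact (free_conf p s) x v n \<noteq> 0} \<subseteq> (\<Union>c\<in>keys ?T. {..degree (lookup ?T c)})"
  proof
    fix n assume "n \<in> {n. lact (free_conf p s) x v n \<noteq> 0}"
    then obtain c where "lookup (lact (free_conf p s) x v n) c \<noteq> 0"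
      using poly_mapping_eqI[of "lact (free_conf p s) x v n" 0] by auto
    then have "coeff (lookup ?T c) n \<noteq> 0" by (simp add: free_conf_def lookup_map)
    then have "lookup ?T c \<noteq> 0" "n \<le> degree (lookup ?T c)" by (auto intro: le_degree)
    then show "n \<in> (\<Union>c\<in>keys ?T. {..degree (lookup ?T c)})" by (auto simp: in_keys_iff)
  qed
  then show ?thesis by (rule finite_subset) simp
qed

text \<open>The binomial theorem, used in three roles: for \<open>h(del + lam)\<close>, for powers
  of \<open>lambda + mu\<close> with \<open>del\<close> in place of mu, and for the substitution in
  skew-symmetry.\<close>

lemma coeff_lam_del_power:
  "coeff ((lam + del) ^ j) i = (if i \<le> j then of_nat (j choose i) * [:0, 1:] ^ (j - i) else 0)"
proof -
  have "(lam + del) ^ j = (\<Sum>k\<le>j. of_nat (j choose k) * lam ^ k * del ^ (j - k))"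
    by (rule binomial_ring)
  also have "\<dots> = (\<Sum>k\<le>j. monom (of_nat (j choose k) * [:0, 1:] ^ (j - k)) k)"
  proof (rule sum.cong[OF refl])
    fix k assume "k \<in> {..j}"
    have "of_nat (j choose k) * lam ^ k * del ^ (j - k) = Polynomial.smult (of_nat (j choose k) * [:0, 1:] ^ (j - k)) (lam ^ k)"
      by (simp add: del_def poly_const_pow of_nat_poly mult.commute)
    then show "of_nat (j choose k) * lam ^ k * del ^ (j - k) = monom (of_nat (j choose k) * [:0, 1:] ^ (j - k)) k"
      by (simp add: monom_altdef lam_def)
  qed
  finally show ?thesis by (simp add: coeff_sum sum.delta)
qed

text \<open>The hypothesis is the Jacobi identity at \<open>\<lambda> = l\<close>, \<open>\<mu> = u\<close>, with \<open>F k j\<close> and \<open>G m n\<close> standing for the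
  coefficients of its two sides.\<close>

lemma jacobi_coefficients:
  fixes F G :: "nat \<Rightarrow> nat \<Rightarrow> complex"
  assumes F: "\<And>k j. N < k \<or> N < j \<Longrightarrow> F k j = 0" and G: "\<And>m n. N < m \<or> N < n \<Longrightarrow> G m n = 0"
    and eq: "\<And>l u. (\<Sum>k\<le>N. \<Sum>j\<le>N. l ^ k * (l + u) ^ j * F k j) = (\<Sum>m\<le>N. \<Sum>n\<le>N. l ^ m * u ^ n * G m n)"
  shows "(\<Sum>k\<le>m. of_nat ((m - k + n) choose n) * F k (m - k + n)) = G m n"
proof -
  \<comment> \<open>Here \<open>del\<close> stands in for mu. Both sides of the identity become
    polynomials in two variables, and the claim compares their coefficients at
    \<open>lam^m del^n\<close>; the binomial number is the one from
    \<open>(lam + del)^j\<close>.\<close>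
  define P where "P = (\<Sum>k\<le>N. \<Sum>j\<le>N. lam ^ k * (lam + del) ^ j * cst (F k j))"
  define Q where "Q = (\<Sum>m\<le>N. \<Sum>n\<le>N. lam ^ m * del ^ n * cst (G m n))"
  have "P = Q" by (rule ev_eqI) (simp add: P_def Q_def eq)
  have lamk: "coeff (lam ^ k * q) m = (if k \<le> m then coeff q (m - k) else 0)" for k q m
  proof -
    have "lam ^ k * q = monom 1 k * q" by (simp add: lam_def monom_altdef)
    show ?thesis unfolding \<open>lam ^ k * q = monom 1 k * q\<close> by (simp add: coeff_monom_mult)
  qed
  have cstc: "coeff (q * cst c) m = coeff q m * [:c:]" for q c m
    by (simp add: cst_def mult.commute)
  have ld: "coeff (coeff ((lam + del) ^ j) i) n = (if j = i + n then of_nat (j choose i) else 0)" for j i n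
  proof -
    have "[:0, 1 :: complex:] ^ (j - i) = monom 1 (j - i)" by (simp add: monom_altdef)
    then show ?thesis by (auto simp: coeff_lam_del_power of_nat_poly)
  qed
  have cc: "coeff (q * [:c:]) n = coeff q n * c" for q :: "complex poly" and c n
    by (simp add: mult.commute)
  have PP: "coeff (coeff P m) n = (\<Sum>k\<le>m. of_nat ((m - k + n) choose n) * F k (m - k + n))"
  proof -
    have "coeff (coeff P m) n =
        (\<Sum>k\<le>N. \<Sum>j\<le>N. if k \<le> m \<and> j = m - k + n then of_nat (j choose (m - k)) * F k j else 0)"
      unfolding P_def by (auto simp: coeff_sum cstc lamk cc ld mult.assoc intro!: sum.cong)
    also have "\<dots> = (\<Sum>k\<le>N. if k \<le> m then of_nat ((m - k + n) choose (m - k)) * F k (m - k + n) else 0)"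
      by (intro sum.cong refl) (auto simp: F)
    also have "\<dots> = (\<Sum>k\<le>max N m. if k \<le> m then of_nat ((m - k + n) choose (m - k)) * F k (m - k + n) else 0)"
      by (rule sum.mono_neutral_left) (auto simp: F)
    also have "\<dots> = (\<Sum>k\<le>m. if k \<le> m then of_nat ((m - k + n) choose (m - k)) * F k (m - k + n) else 0)"
      by (rule sum.mono_neutral_right) auto
    also have "\<dots> = (\<Sum>k\<le>m. of_nat ((m - k + n) choose n) * F k (m - k + n))"
    proof (intro sum.cong refl)
      fix k
      have "((m - k + n) choose (m - k)) = ((m - k + n) choose n)"
        by (subst binomial_symmetric) simp_all
      then show "(if k \<le> m then of_nat ((m - k + n) choose (m - k)) * F k (m - k + n) else 0) =
          of_nat ((m - k + n) choose n) * F k (m - k + n)" if "k \<in> {..m}"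
        using that by simp
    qed
    finally show ?thesis .
  qed
  have QQ: "coeff (coeff Q m) n = G m n"
  proof -
    have "lam ^ i * del ^ j * cst (G i j) = monom (monom (G i j) j) i" for i j
      by (simp add: lam_def del_def cst_def poly_const_pow smult_monom monom_altdef mult.commute)
    then have "coeff (coeff Q m) n = (\<Sum>i\<le>N. \<Sum>j\<le>N. if i = m \<and> j = n then G i j else 0)"
      unfolding Q_def by (auto simp: coeff_sum intro!: sum.cong)
    also have "\<dots> = (\<Sum>i\<le>N. if i = m then (\<Sum>j\<le>N. if j = n then G m j else 0) else 0)"
      by (intro sum.cong refl) auto
    also have "\<dots> = G m n" by (auto simp: G)
    finally show ?thesis .
  qed
  show ?thesis using PP QQ \<open>P = Q\<close> by simp
qed


lemma map_smult: "Poly_Mapping.map (Polynomial.smult c) v = Poly_Mapping.map ((*) [:c:]) v"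
  by (rule poly_mapping_eqI) (simp add: lookup_map)

lemma ev_lactp_scale:
  "ev (lactp s (Poly_Mapping.map (Polynomial.smult e) x) v c) l d = e * ev (lactp s x v c) l d"
  "ev (lactp s x (Poly_Mapping.map (Polynomial.smult e) v) c) l d = e * ev (lactp s x v c) l d"
  unfolding map_smult ev_lactp_smult_left ev_lactp_smult_right by simp_all

lemma ev_lactp_sum_left:
  "ev (lactp s (\<Sum>k\<le>N. Poly_Mapping.map ((*) [:h k:]) (x k)) v c) l d = (\<Sum>k\<le>(N::nat). h k * ev (lactp s (x k) v c) l d)"
  by (induction N) (simp_all add: ev_lactp_add_left ev_lactp_scale)

lemma ev_lactp_sum_right:
  "ev (lactp s x (\<Sum>k\<le>N. Poly_Mapping.map ((*) [:h k:]) (v k)) c) l d = (\<Sum>k\<le>(N::nat). h k * ev (lactp s x (v k) c) l d)"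
  by (induction N) (simp_all add: ev_lactp_add_right ev_lactp_scale)

text \<open>The action \<open>x\<^sub>\<lambda> v\<close> at the complex number \<open>\<lambda> = l\<close>, again an element of the module.\<close>

definition vact where
  "vact s x v l = Poly_Mapping.map (\<lambda>q. poly q [:l:])
     (\<Sum>a\<in>keys x. \<Sum>b\<in>keys v. Poly_Mapping.map
        ((*) (subst_del (lookup x a) (- lam) * subst_del (lookup v b) (del + lam))) (s a b))"

lemma poly_lookup_vact: "poly (lookup (vact s x v l) c) d = ev (lactp s x v c) l d"
  by (simp add: vact_def lookup_map lookup_sum lactp_def ev_def)

lemma poly_lookup_eqI:
  fixes v w :: "'c \<Rightarrow>\<^sub>0 complex poly"
  assumes "\<And>c d. poly (lookup v c) d = poly (lookup w c) d"
  shows "v = w"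
proof (rule poly_mapping_eqI)
  fix c
  have "poly (lookup v c) = poly (lookup w c)" by (rule ext) (rule assms)
  then show "lookup v c = lookup w c" by (simp add: poly_eq_poly_eq_iff)
qed

lemma vact_altdef:
  assumes "\<And>n. N < n \<Longrightarrow> lact (free_conf p s) x v n = 0"
  shows "vact s x v l = (\<Sum>n\<le>N. Poly_Mapping.map ((*) [:l ^ n:]) (lact (free_conf p s) x v n))"
proof (rule poly_lookup_eqI)
  fix c d
  have "poly (coeff (lactp s x v c) n) d = 0" if "N < n" for n
    using assms[OF that] by (simp add: lookup_lact[of p s, symmetric])
  then show "poly (lookup (vact s x v l) c) d =
      poly (lookup (\<Sum>n\<le>N. Poly_Mapping.map ((*) [:l ^ n:]) (lact (free_conf p s) x v n)) c) d"
    unfolding poly_lookup_vact by (simp add: ev_altdef lookup_sum lookup_map lookup_lact poly_sum)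
qed

lemma keys_vact: "keys (vact s x v l) \<subseteq> (\<Union>a\<in>keys x. \<Union>b\<in>keys v. keys (s a b))"
proof
  fix c assume "c \<in> keys (vact s x v l)"
  then have "lactp s x v c \<noteq> 0" by (auto simp: in_keys_iff vact_def lookup_map lookup_sum lactp_def)
  then obtain a where a: "a \<in> keys x" "(\<Sum>b\<in>keys v.
      subst_del (lookup x a) (- lam) * subst_del (lookup v b) (del + lam) * lookup (s a b) c) \<noteq> 0"
    unfolding lactp_def by (meson sum.not_neutral_contains_not_neutral)
  then obtain b where b: "b \<in> keys v" "lookup (s a b) c \<noteq> 0"
    by (metis (no_types, lifting) mult_zero_right sum.not_neutral_contains_not_neutral)
  then have "c \<in> keys (s a b)" by (simp add: in_keys_iff)
  then show "c \<in> (\<Union>a\<in>keys x. \<Union>b\<in>keys v. keys (s a b))" using a(1) b(1) by blast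
qed

section \<open>Reduction of the Jacobi identity to basis elements\<close>

lemma sum_rotate: "(\<Sum>a\<in>A. \<Sum>b\<in>B. \<Sum>c\<in>C. f a b c) = (\<Sum>b\<in>B. \<Sum>c\<in>C. \<Sum>a\<in>A. f a b c)"
proof -
  have "(\<Sum>a\<in>A. \<Sum>b\<in>B. \<Sum>c\<in>C. f a b c) = (\<Sum>b\<in>B. \<Sum>a\<in>A. \<Sum>c\<in>C. f a b c)" by (rule sum.swap)
  also have "\<dots> = (\<Sum>b\<in>B. \<Sum>c\<in>C. \<Sum>a\<in>A. f a b c)" by (rule sum.cong[OF refl], rule sum.swap)
  finally show ?thesis .
qed

text \<open>The values of the derivation come from sesquilinearity: polynomials in it on the
  bracket, which then acts with \<open>lambda + mu\<close>, are taken at \<open>- l - u\<close>,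
  while inside an action with lambda (or mu) they are shifted to \<open>d + l\<close> (or
  \<open>d + u\<close>).\<close>

definition jacobi_on_basis where
  "jacobi_on_basis pR sR sM \<longleftrightarrow> (\<forall>i j k c l u d.
     (\<Sum>i'\<in>keys (sR i j). ev (lookup (sR i j) i') l (- l - u) * ev (lookup (sM i' k) c) (l + u) d) =
     (\<Sum>b\<in>keys (sM j k). ev (lookup (sM j k) b) u (d + l) * ev (lookup (sM i b) c) l d) -
     ksign (pR i) (pR j) * (\<Sum>b\<in>keys (sM i k). ev (lookup (sM i k) b) l (d + u) * ev (lookup (sM j b) c) u d))"

text \<open>The coefficients of \<open>x\<close>, \<open>y\<close> and \<open>v\<close> split off as
  one product, taken at \<open>- l\<close>, \<open>- u\<close> and \<open>d + l + u\<close>. The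
  same product splits off in \<open>ev_lactp_vact_left\<close> and, up to renaming, when
  \<open>x\<close> and \<open>y\<close> are exchanged, so the general identity is a combination of
  those on basis elements.\<close>

lemma ev_lactp_vact_right:
  "ev (lactp s x (vact s y v u) c) l d =
    (\<Sum>i\<in>keys x. \<Sum>j\<in>keys y. \<Sum>k\<in>keys v. poly (lookup x i) (- l) * poly (lookup y j) (- u) * poly (lookup v k) (d + l + u) *
      (\<Sum>b\<in>keys (s j k). ev (lookup (s j k) b) u (d + l) * ev (lookup (s i b) c) l d))"
proof -
  let ?m = "\<lambda>i j k. poly (lookup x i) (- l) * poly (lookup y j) (- u) * poly (lookup v k) (d + l + u)"
  define B where "B = (\<Union>j\<in>keys y. \<Union>k\<in>keys v. keys (s j k))"
  have B: "finite B" "keys (vact s y v u) \<subseteq> B" unfolding B_def by (simp, rule keys_vact)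
  have "ev (lactp s x (vact s y v u) c) l d = (\<Sum>i\<in>keys x. \<Sum>b\<in>B. \<Sum>j\<in>keys y. \<Sum>k\<in>keys v.
      ?m i j k *
      (ev (lookup (s j k) b) u (d + l) * ev (lookup (s i b) c) l d))"
    by (simp add: ev_lactp[OF finite_keys order_refl B] poly_lookup_vact
        ev_lactp[OF finite_keys order_refl finite_keys order_refl, of s y v]
        sum_distrib_left sum_distrib_right mult_ac)
  also have "\<dots> = (\<Sum>i\<in>keys x. \<Sum>j\<in>keys y. \<Sum>k\<in>keys v. \<Sum>b\<in>B.
      ?m i j k *
      (ev (lookup (s j k) b) u (d + l) * ev (lookup (s i b) c) l d))"
    by (rule sum.cong[OF refl], rule sum_rotate)
  also have "\<dots> = (\<Sum>i\<in>keys x. \<Sum>j\<in>keys y. \<Sum>k\<in>keys v. ?m i j k *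
      (\<Sum>b\<in>B. ev (lookup (s j k) b) u (d + l) * ev (lookup (s i b) c) l d))"
    by (simp only: sum_distrib_left)
  also have "\<dots> = (\<Sum>i\<in>keys x. \<Sum>j\<in>keys y. \<Sum>k\<in>keys v. ?m i j k *
      (\<Sum>b\<in>keys (s j k). ev (lookup (s j k) b) u (d + l) * ev (lookup (s i b) c) l d))"
  proof (rule sum.cong[OF refl], rule sum.cong[OF refl], rule sum.cong[OF refl],
      rule arg_cong2[of _ _ _ _ "(*)", OF refl])
    fix i j k assume "i \<in> keys x" "j \<in> keys y" "k \<in> keys v"
    then have "keys (s j k) \<subseteq> B" unfolding B_def by blast
    then show "(\<Sum>b\<in>B. ev (lookup (s j k) b) u (d + l) * ev (lookup (s i b) c) l d) =
        (\<Sum>b\<in>keys (s j k). ev (lookup (s j k) b) u (d + l) * ev (lookup (s i b) c) l d)"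
      using B(1) by (intro sum.mono_neutral_right) (auto simp: not_in_keys_iff_lookup_eq_zero)
  qed
  finally show ?thesis .
qed

lemma ev_lactp_vact_left:
  "ev (lactp s (vact sR x y l) v c) (l + u) d =
    (\<Sum>i\<in>keys x. \<Sum>j\<in>keys y. \<Sum>k\<in>keys v. poly (lookup x i) (- l) * poly (lookup y j) (- u) * poly (lookup v k) (d + l + u) *
      (\<Sum>a\<in>keys (sR i j). ev (lookup (sR i j) a) l (- l - u) * ev (lookup (s a k) c) (l + u) d))"
proof -
  let ?m = "\<lambda>i j k. poly (lookup x i) (- l) * poly (lookup y j) (- u) * poly (lookup v k) (d + l + u)"
  define A where "A = (\<Union>i\<in>keys x. \<Union>j\<in>keys y. keys (sR i j))"
  have A: "finite A" "keys (vact sR x y l) \<subseteq> A" unfolding A_def by (simp, rule keys_vact)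
  have "ev (lactp s (vact sR x y l) v c) (l + u) d = (\<Sum>a\<in>A. \<Sum>k\<in>keys v. \<Sum>i\<in>keys x. \<Sum>j\<in>keys y.
      ?m i j k *
      (ev (lookup (sR i j) a) l (- l - u) * ev (lookup (s a k) c) (l + u) d))"
    by (simp add: ev_lactp[OF A finite_keys order_refl] poly_lookup_vact
        ev_lactp[OF finite_keys order_refl finite_keys order_refl, of sR x y]
        sum_distrib_left sum_distrib_right mult_ac add.assoc)
  also have "\<dots> = (\<Sum>k\<in>keys v. \<Sum>i\<in>keys x. \<Sum>a\<in>A. \<Sum>j\<in>keys y.
      ?m i j k *
      (ev (lookup (sR i j) a) l (- l - u) * ev (lookup (s a k) c) (l + u) d))"
    by (rule sum_rotate)
  also have "\<dots> = (\<Sum>i\<in>keys x. \<Sum>a\<in>A. \<Sum>k\<in>keys v. \<Sum>j\<in>keys y.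
      ?m i j k *
      (ev (lookup (sR i j) a) l (- l - u) * ev (lookup (s a k) c) (l + u) d))"
    by (rule sum_rotate)
  also have "\<dots> = (\<Sum>i\<in>keys x. \<Sum>j\<in>keys y. \<Sum>k\<in>keys v. \<Sum>a\<in>A.
      ?m i j k *
      (ev (lookup (sR i j) a) l (- l - u) * ev (lookup (s a k) c) (l + u) d))"
    by (rule sum.cong[OF refl], subst sum_rotate, subst sum.swap, rule refl)
  also have "\<dots> = (\<Sum>i\<in>keys x. \<Sum>j\<in>keys y. \<Sum>k\<in>keys v. ?m i j k *
      (\<Sum>a\<in>A. ev (lookup (sR i j) a) l (- l - u) * ev (lookup (s a k) c) (l + u) d))"
    by (simp only: sum_distrib_left)
  also have "\<dots> = (\<Sum>i\<in>keys x. \<Sum>j\<in>keys y. \<Sum>k\<in>keys v. ?m i j k *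
      (\<Sum>a\<in>keys (sR i j). ev (lookup (sR i j) a) l (- l - u) * ev (lookup (s a k) c) (l + u) d))"
  proof (rule sum.cong[OF refl], rule sum.cong[OF refl], rule sum.cong[OF refl],
      rule arg_cong2[of _ _ _ _ "(*)", OF refl])
    fix i j k assume "i \<in> keys x" "j \<in> keys y" "k \<in> keys v"
    then have "keys (sR i j) \<subseteq> A" unfolding A_def by blast
    then show "(\<Sum>a\<in>A. ev (lookup (sR i j) a) l (- l - u) * ev (lookup (s a k) c) (l + u) d) =
        (\<Sum>a\<in>keys (sR i j). ev (lookup (sR i j) a) l (- l - u) * ev (lookup (s a k) c) (l + u) d)"
      using A(1) by (intro sum.mono_neutral_right) (auto simp: not_in_keys_iff_lookup_eq_zero)
  qed
  finally show ?thesis .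
qed

lemma jacobi_vact:
  assumes J: "jacobi_on_basis pR sR sM" and x: "\<forall>i\<in>keys x. pR i = s" and y: "\<forall>j\<in>keys y. pR j = t"
  shows "ev (lactp sM (vact sR x y l) v c) (l + u) d =
    ev (lactp sM x (vact sM y v u) c) l d - ksign s t * ev (lactp sM y (vact sM x v l) c) u d"
proof -
  let ?m = "\<lambda>i j k. poly (lookup x i) (- l) * poly (lookup y j) (- u) * poly (lookup v k) (d + l + u)"
  let ?r = "\<lambda>i j k. \<Sum>b\<in>keys (sM i k). ev (lookup (sM i k) b) l (d + u) * ev (lookup (sM j b) c) u d"
  have "ev (lactp sM y (vact sM x v l) c) u d = (\<Sum>i\<in>keys x. \<Sum>j\<in>keys y. \<Sum>k\<in>keys v. ?m i j k * ?r i j k)"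
    unfolding ev_lactp_vact_right by (subst sum.swap) (simp add: mult_ac add_ac)
  then have "ksign s t * ev (lactp sM y (vact sM x v l) c) u d =
      (\<Sum>i\<in>keys x. \<Sum>j\<in>keys y. \<Sum>k\<in>keys v. ?m i j k * (ksign (pR i) (pR j) * ?r i j k))"
    using x y by (simp add: sum_distrib_left mult_ac)
  then show ?thesis
    unfolding ev_lactp_vact_left ev_lactp_vact_right[of sM x y] sum_subtractf[symmetric] right_diff_distrib[symmetric]
    using J unfolding jacobi_on_basis_def by (simp add: sum_subtractf[symmetric] right_diff_distrib[symmetric])
qed

lemma lact_free_conf_zero_left: "lact (free_conf p s) 0 v n = 0"
  by (rule poly_mapping_eqI) (simp add: lookup_lact lactp_def)

lemma lact_free_conf_zero_right: "lact (free_conf p s) x 0 n = 0"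
  by (rule poly_mapping_eqI) (simp add: lookup_lact lactp_def)

text \<open>Linearity and sesquilinearity are read off from the factors \<open>f(- lambda)\<close>
  and \<open>g(del + lambda)\<close> by evaluation. The Jacobi identity goes from the basis to
  evaluated general elements by \<open>jacobi_vact\<close>, and from there to coefficients by
  \<open>jacobi_coefficients\<close>, which requires a common degree bound.\<close>

lemma lambda_action_free_conf:
  assumes par: "\<And>a b c. lookup (sM a b) c \<noteq> 0 \<Longrightarrow> pM c = pR a + pM b"
    and J: "jacobi_on_basis pR sR sM"
  shows "lambda_action (free_conf pR sR) (free_conf pM sM)"
proof (intro lambda_action.intro lambda_action_axioms.intro supermodule_free_conf)
  let ?R = "free_conf pR sR" and ?M = "free_conf pM sM"
  show "finite {n. lact ?M a v n \<noteq> \<zero>\<^bsub>?M\<^esub>}" for a v by (simp add: finite_lact_free_conf)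
  show "lact ?M (a \<oplus>\<^bsub>?R\<^esub> b) v n = lact ?M a v n \<oplus>\<^bsub>?M\<^esub> lact ?M b v n" for a b v n
  proof -
    have "lactp sM (a + b) v c = lactp sM a v c + lactp sM b v c" for c
      by (rule ev_eqI) (simp add: ev_lactp_add_left)
    then show ?thesis by (intro poly_mapping_eqI) (simp add: lookup_add lookup_lact)
  qed
  show "lact ?M a (v \<oplus>\<^bsub>?M\<^esub> w) n = lact ?M a v n \<oplus>\<^bsub>?M\<^esub> lact ?M a w n" for a v w n
  proof -
    have "lactp sM a (v + w) c = lactp sM a v c + lactp sM a w c" for c
      by (rule ev_eqI) (simp add: ev_lactp_add_right)
    then show ?thesis by (intro poly_mapping_eqI) (simp add: lookup_add lookup_lact)
  qed
  show "lact ?M ([:e:] \<odot>\<^bsub>?R\<^esub> a) v n = [:e:] \<odot>\<^bsub>?M\<^esub> lact ?M a v n" for e a v n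
  proof -
    have "lactp sM (Poly_Mapping.map ((*) [:e:]) a) v c = cst e * lactp sM a v c" for c
      by (rule ev_eqI) (simp add: ev_lactp_smult_left)
    then show ?thesis by (intro poly_mapping_eqI) (simp add: lookup_map lookup_lact cst_def)
  qed
  show "lact ?M a ([:e:] \<odot>\<^bsub>?M\<^esub> v) n = [:e:] \<odot>\<^bsub>?M\<^esub> lact ?M a v n" for e a v n
  proof -
    have "lactp sM a (Poly_Mapping.map ((*) [:e:]) v) c = cst e * lactp sM a v c" for c
      by (rule ev_eqI) (simp add: ev_lactp_smult_right)
    then show ?thesis by (intro poly_mapping_eqI) (simp add: lookup_map lookup_lact cst_def)
  qed
  show "lact ?M ([:0, 1:] \<odot>\<^bsub>?R\<^esub> a) v n = (case n of 0 \<Rightarrow> \<zero>\<^bsub>?M\<^esub> | Suc k \<Rightarrow> \<ominus>\<^bsub>?M\<^esub> lact ?M a v k)" for a v n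
  proof -
    have "lactp sM (Poly_Mapping.map ((*) [:0, 1:]) a) v c = - (lam * lactp sM a v c)" for c
      by (rule ev_eqI) (simp add: ev_lactp_smult_left)
    then show ?thesis
      by (intro poly_mapping_eqI) (simp add: lookup_map lookup_lact lam_def minus_free_conf coeff_pCons split: nat.split)
  qed
  show "lact ?M a ([:0, 1:] \<odot>\<^bsub>?M\<^esub> v) n =
      [:0, 1:] \<odot>\<^bsub>?M\<^esub> lact ?M a v n \<oplus>\<^bsub>?M\<^esub> (case n of 0 \<Rightarrow> \<zero>\<^bsub>?M\<^esub> | Suc k \<Rightarrow> lact ?M a v k)" for a v n
  proof -
    have "lactp sM a (Poly_Mapping.map ((*) [:0, 1:]) v) c = del * lactp sM a v c + lam * lactp sM a v c" for c
      by (rule ev_eqI) (simp add: ev_lactp_smult_right distrib_right)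
    then show ?thesis
      by (intro poly_mapping_eqI)
         (simp add: lookup_map lookup_add lookup_lact lam_def del_def coeff_pCons split: nat.split)
  qed
  show "lact ?M a v n \<in> grade ?M (s + t)" if a: "a \<in> grade ?R s" and v: "v \<in> grade ?M t" for a s v t n
  proof -
    have "pM c = s + t" if c: "lookup (lact ?M a v n) c \<noteq> 0" for c
    proof -
      have "lactp sM a v c \<noteq> 0" using c by (auto simp: lookup_lact)
      then obtain i where i: "i \<in> keys a" "(\<Sum>b\<in>keys v.
          subst_del (lookup a i) (- lam) * subst_del (lookup v b) (del + lam) * lookup (sM i b) c) \<noteq> 0"
        unfolding lactp_def by (meson sum.not_neutral_contains_not_neutral)
      then obtain b where "b \<in> keys v" "lookup (sM i b) c \<noteq> 0"
        by (metis (no_types, lifting) mult_zero_right sum.not_neutral_contains_not_neutral)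
      then show ?thesis using par a v i(1) by auto
    qed
    then show ?thesis by (auto simp: in_keys_iff)
  qed
  fix a s b t v m n assume a: "a \<in> grade ?R s" and b: "b \<in> grade ?R t"
  let ?G = "\<lambda>m n. lact ?M a (lact ?M b v n) m - Poly_Mapping.map ((*) [:ksign s t:]) (lact ?M b (lact ?M a v m) n)"
  \<comment> \<open>One bound for the degrees of all inner and outer actions. It exists because an
    inner coefficient is nonzero for finitely many indices only, and at the other indices the outer
    action is applied to zero.\<close>
  obtain N where N: "\<And>k. N < k \<Longrightarrow> lact ?R a b k = 0" "\<And>k j. N < j \<Longrightarrow> lact ?M (lact ?R a b k) v j = 0"
    "\<And>n. N < n \<Longrightarrow> lact ?M a v n = 0" "\<And>n. N < n \<Longrightarrow> lact ?M b v n = 0"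
    "\<And>m n. N < m \<Longrightarrow> lact ?M a (lact ?M b v n) m = 0" "\<And>m n. N < n \<Longrightarrow> lact ?M b (lact ?M a v m) n = 0"
  proof -
    define S where "S = {k. lact ?R a b k \<noteq> 0}"
    define S2 where "S2 = {n. lact ?M a v n \<noteq> 0}"
    define S3 where "S3 = {n. lact ?M b v n \<noteq> 0}"
    define T where "T = S \<union> S2 \<union> S3 \<union> (\<Union>k\<in>S. {j. lact ?M (lact ?R a b k) v j \<noteq> 0}) \<union>
      (\<Union>n\<in>S3. {m. lact ?M a (lact ?M b v n) m \<noteq> 0}) \<union> (\<Union>m\<in>S2. {n. lact ?M b (lact ?M a v m) n \<noteq> 0})"
    have "finite T" unfolding T_def S_def S2_def S3_def by (simp add: finite_lact_free_conf)
    then obtain N where "\<forall>k\<in>T. k \<le> N" by (meson finite_nat_set_iff_bounded_le)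
    then have NT: "k \<notin> T" if "N < k" for k using that by fastforce
    show ?thesis
    proof (rule that[of N])
      show "lact ?R a b k = 0" if "N < k" for k using NT[OF that] by (auto simp: T_def S_def)
      show "lact ?M a v k = 0" if "N < k" for k using NT[OF that] by (auto simp: T_def S2_def)
      show "lact ?M b v k = 0" if "N < k" for k using NT[OF that] by (auto simp: T_def S3_def)
      show "lact ?M (lact ?R a b k) v j = 0" if "N < j" for k j
        using NT[OF that] lact_free_conf_zero_left[of pM sM v j] by (cases "k \<in> S") (auto simp: T_def S_def)
      show "lact ?M a (lact ?M b v n) j = 0" if "N < j" for n j
        using NT[OF that] lact_free_conf_zero_right[of pM sM a j] by (cases "n \<in> S3") (auto simp: T_def S3_def)
      show "lact ?M b (lact ?M a v m) j = 0" if "N < j" for m j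
        using NT[OF that] lact_free_conf_zero_right[of pM sM b j] by (cases "m \<in> S2") (auto simp: T_def S2_def)
    qed
  qed
  have key: "(\<Sum>k\<le>m. of_nat ((m - k + n) choose n) * poly (lookup (lact ?M (lact ?R a b k) v (m - k + n)) c) d) =
      poly (lookup (?G m n) c) d" for c d
  proof (rule jacobi_coefficients[where N = N and F = "\<lambda>k j. poly (lookup (lact ?M (lact ?R a b k) v j) c) d"
        and G = "\<lambda>m n. poly (lookup (?G m n) c) d"])
    show "poly (lookup (lact ?M (lact ?R a b k) v j) c) d = 0" if "N < k \<or> N < j" for k j
      using that N(1,2) by (auto simp: lact_free_conf_zero_left)
    show "poly (lookup (?G m n) c) d = 0" if "N < m \<or> N < n" for m n
      using that N(3-6) by (auto simp: lact_free_conf_zero_right lookup_minus lookup_map)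
    fix l u
    have 1: "ev (lactp sM x w c) u' d = (\<Sum>j\<le>N. u' ^ j * poly (lookup (lact ?M x w j) c) d)"
      if "\<And>j. N < j \<Longrightarrow> lact ?M x w j = 0" for x w u'
    proof -
      have "poly (coeff (lactp sM x w c) j) d = 0" if "N < j" for j
        using \<open>\<And>j. N < j \<Longrightarrow> lact ?M x w j = 0\<close>[OF that] by (simp add: lookup_lact[of pM sM, symmetric])
      then show ?thesis by (simp add: ev_altdef lookup_lact)
    qed
    have V: "vact sR a b l = (\<Sum>n\<le>N. Poly_Mapping.map ((*) [:l ^ n:]) (lact ?R a b n))"
      "vact sM b v u = (\<Sum>n\<le>N. Poly_Mapping.map ((*) [:u ^ n:]) (lact ?M b v n))"
      "vact sM a v l = (\<Sum>n\<le>N. Poly_Mapping.map ((*) [:l ^ n:]) (lact ?M a v n))"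
      using N(1,3,4) by (intro vact_altdef; blast)+
    have L: "ev (lactp sM (vact sR a b l) v c) (l + u) d =
        (\<Sum>k\<le>N. \<Sum>j\<le>N. l ^ k * (l + u) ^ j * poly (lookup (lact ?M (lact ?R a b k) v j) c) d)"
      unfolding V(1) ev_lactp_sum_left
      by (simp add: 1[OF N(2)] sum_distrib_left mult.assoc)
    have R1: "ev (lactp sM a (vact sM b v u) c) l d =
        (\<Sum>m\<le>N. \<Sum>n\<le>N. l ^ m * u ^ n * poly (lookup (lact ?M a (lact ?M b v n) m) c) d)"
      unfolding V(2) ev_lactp_sum_right
      by (subst sum.swap) (simp add: 1[OF N(5)] sum_distrib_left mult_ac)
    have R2: "ev (lactp sM b (vact sM a v l) c) u d =
        (\<Sum>m\<le>N. \<Sum>n\<le>N. l ^ m * u ^ n * poly (lookup (lact ?M b (lact ?M a v m) n) c) d)"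
      unfolding V(3) ev_lactp_sum_right
      by (simp add: 1[OF N(6)] sum_distrib_left mult_ac)
    have "ev (lactp sM (vact sR a b l) v c) (l + u) d =
        ev (lactp sM a (vact sM b v u) c) l d - ksign s t * ev (lactp sM b (vact sM a v l) c) u d"
      by (rule jacobi_vact[OF J]) (use a b in auto)
    then show "(\<Sum>k\<le>N. \<Sum>j\<le>N. l ^ k * (l + u) ^ j * poly (lookup (lact ?M (lact ?R a b k) v j) c) d) =
        (\<Sum>m\<le>N. \<Sum>n\<le>N. l ^ m * u ^ n * poly (lookup (?G m n) c) d)"
      unfolding L R1 R2
      by (simp add: lookup_minus lookup_map right_diff_distrib sum_subtractf sum_distrib_left mult_ac)
  qed
  show "finsum ?M (\<lambda>k. [:of_nat ((m - k + n) choose n):] \<odot>\<^bsub>?M\<^esub> lact ?M (lact ?R a b k) v (m - k + n)) {..m} =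
      lact ?M a (lact ?M b v n) m \<ominus>\<^bsub>?M\<^esub> [:ksign s t:] \<odot>\<^bsub>?M\<^esub> lact ?M b (lact ?M a v m) n"
    unfolding minus_free_conf finsum_free_conf[OF finite_atMost]
    by (rule poly_lookup_eqI) (use key in \<open>simp add: lookup_sum lookup_map poly_sum\<close>)
qed simp_all

section \<open>The Lie conformal superalgebra \<open>K(p)\<close>\<close>

lemma coeff_const_mult: "coeff ([:q:] * P) n = q * coeff P n" for q :: "complex poly"
  by simp

text \<open>Replacing \<open>l\<close> by \<open>- l - d\<close> exchanges the arguments
  \<open>- l\<close> and \<open>d + l\<close> of the two coefficients, so skew-symmetry passes from
  basis elements to all elements. The sum over \<open>k\<close> in the axiom is the expansion of the
  powers of \<open>- lambda - del\<close>.\<close>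

lemma lie_conformal_superalgebra_free_conf:
  assumes par: "\<And>a b c. lookup (s a b) c \<noteq> 0 \<Longrightarrow> p c = p a + p b"
    and J: "jacobi_on_basis p s s"
    and skew: "\<And>i j c l d. ev (lookup (s i j) c) l d = - ksign (p i) (p j) * ev (lookup (s j i) c) (- l - d) d"
  shows "lie_conformal_superalgebra (free_conf p s)"
proof (intro lie_conformal_superalgebra.intro lie_conformal_superalgebra_axioms.intro)
  show "lambda_action (free_conf p s) (free_conf p s)" by (rule lambda_action_free_conf[OF par J])
  let ?R = "free_conf p s"
  fix a s' b t n assume a: "a \<in> grade ?R s'" and b: "b \<in> grade ?R t"
  define K where "K = {k. lact ?R b a k \<noteq> 0}"
  have K: "finite K" unfolding K_def by (rule finite_lact_free_conf)
  have evP: "ev (lactp s b a c) l d = (\<Sum>k\<in>K. l ^ k * poly (coeff (lactp s b a c) k) d)" for c l d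
  proof -
    obtain N where N: "\<forall>k\<in>K. k \<le> N" using K by (meson finite_nat_set_iff_bounded_le)
    have z: "coeff (lactp s b a c) k = 0" if "k \<notin> K" for k
      using that by (simp add: K_def lookup_lact[of p s, symmetric])
    have "ev (lactp s b a c) l d = (\<Sum>k\<le>N. l ^ k * poly (coeff (lactp s b a c) k) d)"
      by (rule ev_altdef) (metis N z not_less poly_0)
    also have "\<dots> = (\<Sum>k\<in>K. l ^ k * poly (coeff (lactp s b a c) k) d)"
      by (rule sum.mono_neutral_right) (use N z in auto)
    finally show ?thesis .
  qed
  have "lactp s a b c = - (cst (ksign s' t) * (\<Sum>k\<in>K. [:coeff (lactp s b a c) k:] * (cst ((- 1) ^ k) * (lam + del) ^ k)))" for c
  proof (rule ev_eqI)
    fix l d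
    have "ev (lactp s a b c) l d = (\<Sum>i\<in>keys a. \<Sum>j\<in>keys b. poly (lookup a i) (- l) * poly (lookup b j) (d + l) *
        (- ksign s' t * ev (lookup (s j i) c) (- l - d) d))"
      unfolding ev_lactp[OF finite_keys order_refl finite_keys order_refl]
      by (intro sum.cong refl) (use a b in \<open>subst skew, auto\<close>)
    also have "\<dots> = - ksign s' t * (\<Sum>j\<in>keys b. \<Sum>i\<in>keys a. poly (lookup b j) (d + l) * poly (lookup a i) (- l) *
        ev (lookup (s j i) c) (- l - d) d)"
      by (subst sum.swap) (simp add: sum_distrib_left mult_ac sum_negf)
    also have "\<dots> = - ksign s' t * ev (lactp s b a c) (- l - d) d"
      unfolding ev_lactp[OF finite_keys order_refl finite_keys order_refl] by (simp add: add.commute)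
    also have "\<dots> = ev (- (cst (ksign s' t) * (\<Sum>k\<in>K. [:coeff (lactp s b a c) k:] * (cst ((- 1) ^ k) * (lam + del) ^ k)))) l d"
    proof -
      have "(- l - d) ^ k = (- 1) ^ k * (l + d) ^ k" for k
        unfolding power_mult_distrib[symmetric] by simp
      moreover have "ev (Polynomial.smult q P) l d = poly q d * ev P l d" for q P by (simp add: ev_def)
      ultimately show ?thesis unfolding evP by (simp add: mult_ac)
    qed
    finally show "ev (lactp s a b c) l d =
        ev (- (cst (ksign s' t) * (\<Sum>k\<in>K. [:coeff (lactp s b a c) k:] * (cst ((- 1) ^ k) * (lam + del) ^ k)))) l d" .
  qed
  note Q = this
  have coeff_term: "coeff ([:q:] * (cst e * (lam + del) ^ k)) n =
      (if n \<le> k then [:e * of_nat (k choose n):] * [:0, 1:] ^ (k - n) * q else 0)" for q e k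
  proof -
    have "coeff ([:q:] * (cst e * (lam + del) ^ k)) n = q * ([:e:] * coeff ((lam + del) ^ k) n)"
      by (simp only: cst_def coeff_const_mult)
    then show ?thesis by (simp add: coeff_lam_del_power of_nat_poly mult_ac)
  qed
  have "coeff (lactp s a b c) n = - Polynomial.smult (ksign s' t) (\<Sum>k\<in>{k \<in> K. n \<le> k}.
      [:(- 1) ^ k * of_nat (k choose n):] * [:0, 1:] ^ (k - n) * coeff (lactp s b a c) k)" for c
  proof -
    have "coeff (- (cst e * q)) n = - Polynomial.smult e (coeff q n)" for e q
      by (simp add: cst_def)
    then have "coeff (lactp s a b c) n = - Polynomial.smult (ksign s' t) (\<Sum>k\<in>K. if n \<le> k then
        [:(- 1) ^ k * of_nat (k choose n):] * [:0, 1:] ^ (k - n) * coeff (lactp s b a c) k else 0)"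
      by (subst Q) (simp only: coeff_sum coeff_term)
    then show ?thesis by (simp only: sum.inter_filter[OF K])
  qed
  moreover have "{k \<in> K. n \<le> k} = {k. n \<le> k \<and> lact ?R b a k \<noteq> \<zero>\<^bsub>?R\<^esub>}" by (auto simp: K_def)
  ultimately show "lact ?R a b n = \<ominus>\<^bsub>?R\<^esub> ([:ksign s' t:] \<odot>\<^bsub>?R\<^esub>
      (finsum ?R (\<lambda>k. ([:(- 1) ^ k * of_nat (k choose n):] * [:0, 1:] ^ (k - n)) \<odot>\<^bsub>?R\<^esub> lact ?R b a k)
        {k. n \<le> k \<and> lact ?R b a k \<noteq> \<zero>\<^bsub>?R\<^esub>}))"
    using K
    by (intro poly_mapping_eqI)
       (simp add: minus_free_conf finsum_free_conf lookup_sum lookup_map lookup_lact K_def)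
qed

text \<open>Evaluating against an arbitrary function of the basis instead of extracting the coefficient of a basis
  vector makes the Jacobi identity on the basis a matter of rewriting.\<close>

definition pair where
  "pair m f l d = (\<Sum>b\<in>keys m. ev (lookup m b) l d * f b)"

lemma pair_superset: "finite B \<Longrightarrow> keys m \<subseteq> B \<Longrightarrow> pair m f l d = (\<Sum>b\<in>B. ev (lookup m b) l d * f b)"
  unfolding pair_def by (rule sum.mono_neutral_left) (auto simp: in_keys_iff)

lemma pair_simps [simp]:
  "pair 0 f l d = 0" "pair (Poly_Mapping.single b q) f l d = ev q l d * f b"
  "pair (m + m') f l d = pair m f l d + pair m' f l d"
proof -
  show "pair 0 f l d = 0" by (simp add: pair_def)
  show "pair (Poly_Mapping.single b q) f l d = ev q l d * f b" by (simp add: pair_def)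
  have "keys (m + m') \<subseteq> keys m \<union> keys m'" by (rule keys_add)
  then show "pair (m + m') f l d = pair m f l d + pair m' f l d"
    by (simp add: pair_superset[of "keys m \<union> keys m'"] lookup_add distrib_right sum.distrib)
qed

lemma pair_skew [simp]: "pair (skew s t m) f l d = - ksign s t * pair m f (- l - d) d"
proof -
  have "keys (skew s t m) \<subseteq> keys m" unfolding skew_def by (rule keys_map_subset)
  then show ?thesis
    by (simp add: pair_superset[of "keys m"] skew_def lookup_map sum_distrib_left mult.assoc sum_negf)
qed

lemma pair_indicator: "pair m (\<lambda>b. if b = c then 1 else 0) l d = ev (lookup m c) l d"
  unfolding pair_def by (simp add: if_distrib[of "\<lambda>x. _ * x"] in_keys_iff cong: if_cong)

lemma jacobi_on_basisI:
  assumes "\<And>i j k f l u d. pair (sR i j) (\<lambda>a. pair (sM a k) f (l + u) d) l (- l - u) =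
      pair (sM j k) (\<lambda>b. pair (sM i b) f l d) u (d + l) -
      ksign (pR i) (pR j) * pair (sM i k) (\<lambda>b. pair (sM j b) f u d) l (d + u)"
  shows "jacobi_on_basis pR sR sM"
  unfolding jacobi_on_basis_def
proof (intro allI)
  fix i j k c l u d
  show "(\<Sum>i'\<in>keys (sR i j). ev (lookup (sR i j) i') l (- l - u) * ev (lookup (sM i' k) c) (l + u) d) =
     (\<Sum>b\<in>keys (sM j k). ev (lookup (sM j k) b) u (d + l) * ev (lookup (sM i b) c) l d) -
     ksign (pR i) (pR j) * (\<Sum>b\<in>keys (sM i k). ev (lookup (sM i k) b) l (d + u) * ev (lookup (sM j b) c) u d)"
    using assms[of i j k "\<lambda>b. if b = c then 1 else 0" l u d]
    unfolding pair_indicator unfolding pair_def .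
qed

lemma ksign_simps [simp]: "ksign 0 s = 1" "ksign s 0 = 1" "ksign 1 1 = - 1"
  by (simp_all add: ksign_def)

lemma K_jacobi: "jacobi_on_basis gen_parity (K_bracket p) (K_bracket p)"
proof (rule jacobi_on_basisI)
  fix a b c f l u d
  \<comment> \<open>Halving \<open>p\<close> clears the denominator in the coefficient
    \<open>3 / 2 * p\<close> of the brackets of \<open>L\<close> with \<open>Gp\<close> and
    \<open>Gm\<close>.\<close>
  obtain h where p: "p = 2 * h" by (metis mult.commute nonzero_divide_eq_eq zero_neq_numeral)
  show "pair (K_bracket p a b) (\<lambda>a. pair (K_bracket p a c) f (l + u) d) l (- l - u) =
      pair (K_bracket p b c) (\<lambda>b. pair (K_bracket p a b) f l d) u (d + l) -
      ksign (gen_parity a) (gen_parity b) * pair (K_bracket p a c) (\<lambda>a. pair (K_bracket p b a) f u d) l (d + u)"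
  proof (cases a)
    case L
    then show ?thesis by (cases b; cases c; simp add: add_ac p; simp add: algebra_simps)
  next
    case J
    then show ?thesis by (cases b; cases c; simp add: add_ac p; simp add: algebra_simps)
  next
    case Gp
    then show ?thesis by (cases b; cases c; simp add: add_ac p; simp add: algebra_simps)
  next
    case Gm
    then show ?thesis by (cases b; cases c; simp add: add_ac p; simp add: algebra_simps)
  qed
qed

lemma K_skew: "ev (lookup (K_bracket p a b) c) l d =
  - ksign (gen_parity a) (gen_parity b) * ev (lookup (K_bracket p b a) c) (- l - d) d"
  unfolding pair_indicator[symmetric]
  by (cases a; cases b; simp add: add_ac; simp add: algebra_simps)

lemma K_parity: "lookup (K_bracket p a b) c \<noteq> 0 \<Longrightarrow> gen_parity c = gen_parity a + gen_parity b"
  by (cases a; cases b)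
     (auto simp: skew_def lookup_map lookup_add lookup_single when_def split: if_splits)

lemma lie_conformal_superalgebra_K: "lie_conformal_superalgebra (K p)"
  unfolding K_def by (intro lie_conformal_superalgebra_free_conf K_jacobi K_skew K_parity)

lemma gen_cases_0:
  obtains "g = L 0" | "g = J 0" | "g = Gp 0" | "g = Gm 0"
  | n where "g = L (Suc n)" | n where "g = J (Suc n)" | n where "g = Gp (Suc n)" | n where "g = Gm (Suc n)"
  by (metis gen.exhaust not0_implies_Suc)

text \<open>Adapted to \<open>act4b\<close>, where index one acts through \<open>\<beta>\<close> and
  every index from two on acts as zero.\<close>

lemma gen_cases_1:
  obtains "g = L 0" | "g = J 0" | "g = Gp 0" | "g = Gm 0"
  | "g = L (Suc 0)" | "g = J (Suc 0)" | "g = Gp (Suc 0)" | "g = Gm (Suc 0)"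
  | n where "g = L (Suc (Suc n))" | n where "g = J (Suc (Suc n))"
  | n where "g = Gp (Suc (Suc n))" | n where "g = Gm (Suc (Suc n))"
  by (metis gen.exhaust not0_implies_Suc)

text \<open>With \<open>p\<close> written as \<open>r * r\<close> the relation between
  \<open>p\<close> and its root is built in, and every case is an identity in independent
  parameters.\<close>

lemma act4_jacobi: "jacobi_on_basis gen_parity (K_bracket (r * r)) (act4 (r * r) r \<Delta> \<Lambda> \<alpha>)"
proof (rule jacobi_on_basisI)
  fix a b c f l u d
  show "pair (K_bracket (r * r) a b) (\<lambda>a. pair (act4 (r * r) r \<Delta> \<Lambda> \<alpha> a c) f (l + u) d) l (- l - u) =
      pair (act4 (r * r) r \<Delta> \<Lambda> \<alpha> b c) (\<lambda>b. pair (act4 (r * r) r \<Delta> \<Lambda> \<alpha> a b) f l d) u (d + l) -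
      ksign (gen_parity a) (gen_parity b) *
        pair (act4 (r * r) r \<Delta> \<Lambda> \<alpha> a c) (\<lambda>a. pair (act4 (r * r) r \<Delta> \<Lambda> \<alpha> b a) f u d) l (d + u)"
  proof (cases a rule: gen_cases_0)
    case 1 show ?thesis unfolding 1 by (cases b rule: gen_cases_0; cases c; simp; simp add: field_simps power2_eq_square)
  next
    case 2 show ?thesis unfolding 2 by (cases b rule: gen_cases_0; cases c; simp; simp add: field_simps power2_eq_square)
  next
    case 3 show ?thesis unfolding 3 by (cases b rule: gen_cases_0; cases c; simp; simp add: field_simps power2_eq_square)
  next
    case 4 show ?thesis unfolding 4 by (cases b rule: gen_cases_0; cases c; simp; simp add: field_simps power2_eq_square)
  qed (cases b rule: gen_cases_0; cases c; simp)+
qed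


lemma act4b_jacobi:
  assumes r: "r * r = - 1"
  shows "jacobi_on_basis gen_parity (K_bracket (- 1)) (act4b r \<Delta> \<Lambda> \<alpha> \<beta>)"
proof (rule jacobi_on_basisI)
  fix a b c f l u d
  \<comment> \<open>This form eliminates the square of \<open>r\<close> inside right-nested
    products.\<close>
  have r': "r * (r * x) = - x" for x using r by (simp add: mult.assoc[symmetric])
  show "pair (K_bracket (- 1) a b) (\<lambda>a. pair (act4b r \<Delta> \<Lambda> \<alpha> \<beta> a c) f (l + u) d) l (- l - u) =
      pair (act4b r \<Delta> \<Lambda> \<alpha> \<beta> b c) (\<lambda>b. pair (act4b r \<Delta> \<Lambda> \<alpha> \<beta> a b) f l d) u (d + l) -
      ksign (gen_parity a) (gen_parity b) *
        pair (act4b r \<Delta> \<Lambda> \<alpha> \<beta> a c) (\<lambda>a. pair (act4b r \<Delta> \<Lambda> \<alpha> \<beta> b a) f u d) l (d + u)"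
  proof (cases a rule: gen_cases_1)
    case 1 show ?thesis unfolding 1
      by (cases b rule: gen_cases_1; cases c; simp; simp add: field_simps power2_eq_square r r')
  next
    case 2 show ?thesis unfolding 2
      by (cases b rule: gen_cases_1; cases c; simp; simp add: field_simps power2_eq_square r r')
  next
    case 3 show ?thesis unfolding 3
      by (cases b rule: gen_cases_1; cases c; simp; simp add: field_simps power2_eq_square r r')
  next
    case 4 show ?thesis unfolding 4
      by (cases b rule: gen_cases_1; cases c; simp; simp add: field_simps power2_eq_square r r')
  next
    case 5 show ?thesis unfolding 5
      by (cases b rule: gen_cases_1; cases c; simp; simp add: field_simps power2_eq_square r r')
  next
    case 6 show ?thesis unfolding 6
      by (cases b rule: gen_cases_1; cases c; simp; simp add: field_simps power2_eq_square r r')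
  next
    case 7 show ?thesis unfolding 7
      by (cases b rule: gen_cases_1; cases c; simp; simp add: field_simps power2_eq_square r r')
  next
    case 8 show ?thesis unfolding 8
      by (cases b rule: gen_cases_1; cases c; simp; simp add: field_simps power2_eq_square r r')
  qed (cases b rule: gen_cases_1; cases c; simp)+
qed

section \<open>Homomorphisms of free modules and leading coefficients\<close>

lemma act4_parity: "lookup (act4 p r \<Delta> \<Lambda> \<alpha> a b) c \<noteq> 0 \<Longrightarrow> basis4_parity c = gen_parity a + basis4_parity b"
  by (cases a rule: gen_cases_0; cases b; simp add: lookup_add lookup_single when_def split: if_splits)

lemma act4b_parity: "lookup (act4b r \<Delta> \<Lambda> \<alpha> \<beta> a b) c \<noteq> 0 \<Longrightarrow> basis4_parity c = gen_parity a + basis4_parity b"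
  by (cases a rule: gen_cases_1; cases b; simp add: lookup_add lookup_single when_def split: if_splits)

lemma conformal_module_Vmod4: "r\<^sup>2 = p \<Longrightarrow> conformal_module (K p) (Vmod4 p r \<Delta> \<Lambda> \<alpha>)"
  unfolding conformal_module_def
  using lie_conformal_superalgebra_K[of p] lambda_action_free_conf[OF act4_parity act4_jacobi, of r \<Delta> \<Lambda> \<alpha>]
  by (simp add: Vmod4_def K_def power2_eq_square)

lemma conformal_module_Vmod4b: "r\<^sup>2 = - 1 \<Longrightarrow> conformal_module (K (- 1)) (Vmod4b r \<Delta> \<Lambda> \<alpha> \<beta>)"
  unfolding conformal_module_def
  using lie_conformal_superalgebra_K[of "- 1"] lambda_action_free_conf[OF act4b_parity act4b_jacobi, of r \<Delta> \<Lambda> \<alpha> \<beta>]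
  by (simp add: Vmod4b_def K_def power2_eq_square)

lemma UNIV_basis2: "UNIV = {V0, V1}"
  using basis2.exhaust by blast

lemma UNIV_basis4: "UNIV = {V01, V02, V11, V12}"
  using basis4.exhaust by blast

instance basis2 :: finite
  by standard (simp add: UNIV_basis2)

instance basis4 :: finite
  by standard (simp add: UNIV_basis4)

lemma closed_conf_free_conf: "carrier R = UNIV \<Longrightarrow> closed_conf R (free_conf p s)"
  by (simp add: closed_conf_def supermodule_free_conf)

lemma carrier_K [simp]: "carrier (K p) = UNIV"
  by (simp add: K_def)

lemma rev_parity_free_conf: "rev_parity (free_conf p s) = free_conf (\<lambda>b. p b + 1) s"
proof -
  have "p b = e + 1 \<longleftrightarrow> p b + 1 = e" for b e by (cases "p b"; cases e) simp_all
  then show ?thesis by (simp add: free_conf_def rev_parity_def)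
qed

section \<open>Homomorphisms given by matrices\<close>

text \<open>Vectors are rows: the image of the basis vector \<open>b\<close> is row \<open>b\<close>
  of \<open>F\<close>.\<close>

definition matmap :: "('b::finite \<Rightarrow> 'c::finite \<Rightarrow> complex poly) \<Rightarrow> ('b \<Rightarrow>\<^sub>0 complex poly) \<Rightarrow> ('c \<Rightarrow>\<^sub>0 complex poly)" where
  "matmap F v = Abs_poly_mapping (\<lambda>c. \<Sum>b\<in>UNIV. lookup v b * F b c)"

lemma lookup_matmap [simp]: "lookup (matmap F v) c = (\<Sum>b\<in>UNIV. lookup v b * F b c)"
  by (simp add: matmap_def)

lemma ev_smult: "ev (Polynomial.smult q P) l d = poly q d * ev P l d"
  by (simp add: ev_def)

text \<open>By sesquilinearity the compatibility with the action need only be checked on basis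
  elements. On the left the entries of \<open>F\<close> stand inside a lambda-action and are taken
  at \<open>d + l\<close>; on the right they are applied after it and taken at
  \<open>d\<close>.\<close>

lemma conf_hom_matmap:
  fixes F :: "'b::finite \<Rightarrow> 'c::finite \<Rightarrow> complex poly"
  assumes R: "carrier R = UNIV"
    and F: "\<And>b c. F b c \<noteq> 0 \<Longrightarrow> p b = q c"
    and act: "\<And>i k c l d. (\<Sum>b\<in>UNIV. poly (F k b) (d + l) * ev (lookup (t i b) c) l d) =
      (\<Sum>b\<in>UNIV. ev (lookup (s i k) b) l d * poly (F b c) d)"
  shows "conf_hom R (free_conf p s) (free_conf q t) (matmap F)"
  unfolding conf_hom_def
proof (intro conjI ballI allI)
  show "matmap F (u \<oplus>\<^bsub>free_conf p s\<^esub> v) = matmap F u \<oplus>\<^bsub>free_conf q t\<^esub> matmap F v" for u v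
    by (rule poly_mapping_eqI) (simp add: lookup_add distrib_right sum.distrib)
  show "matmap F (h \<odot>\<^bsub>free_conf p s\<^esub> v) = h \<odot>\<^bsub>free_conf q t\<^esub> matmap F v" for h v
    by (rule poly_mapping_eqI) (simp add: lookup_map sum_distrib_left mult.assoc)
  show "matmap F v \<in> grade (free_conf q t) e" if v: "v \<in> grade (free_conf p s) e" for e v
  proof -
    have "q c = e" if "lookup (matmap F v) c \<noteq> 0" for c
    proof -
      have "(\<Sum>b\<in>UNIV. lookup v b * F b c) \<noteq> 0" using that by simp
      then obtain b where "lookup v b * F b c \<noteq> 0" by (rule sum.not_neutral_contains_not_neutral)
      then show ?thesis using v F[of b c] by (auto simp: in_keys_iff)
    qed
    then show ?thesis by (simp add: in_keys_iff del: lookup_matmap)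
  qed
  show "matmap F (lact (free_conf p s) a v n) = lact (free_conf q t) a (matmap F v) n" for a v n
  proof (rule poly_mapping_eqI)
    fix c
    have "lactp t a (matmap F v) c = (\<Sum>b\<in>UNIV. [:F b c:] * lactp s a v b)"
    proof (rule ev_eqI)
      fix l d
      have "ev (lactp t a (matmap F v) c) l d = (\<Sum>i\<in>keys a. \<Sum>k\<in>UNIV. poly (lookup a i) (- l) *
          poly (lookup v k) (d + l) * (\<Sum>b\<in>UNIV. poly (F k b) (d + l) * ev (lookup (t i b) c) l d))"
        unfolding ev_lactp[OF finite_keys order_refl finite_UNIV subset_UNIV] lookup_matmap
        by (rule sum.cong[OF refl])
           (simp only: poly_sum poly_mult sum_distrib_left sum_distrib_right mult.assoc, rule sum.swap)
      also have "\<dots> = (\<Sum>i\<in>keys a. \<Sum>k\<in>UNIV. \<Sum>b\<in>UNIV. poly (F b c) d *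
          (poly (lookup a i) (- l) * poly (lookup v k) (d + l) * ev (lookup (s i k) b) l d))"
        unfolding act by (simp add: sum_distrib_left mult_ac)
      also have "\<dots> = (\<Sum>b\<in>UNIV. poly (F b c) d * ev (lactp s a v b) l d)"
        unfolding ev_lactp[OF finite_keys order_refl finite_UNIV subset_UNIV] sum_distrib_left
        by (subst sum_rotate[symmetric]) (rule refl)
      finally show "ev (lactp t a (matmap F v) c) l d = ev (\<Sum>b\<in>UNIV. [:F b c:] * lactp s a v b) l d"
        by (simp add: ev_smult)
    qed
    then have "coeff (lactp t a (matmap F v) c) n = (\<Sum>b\<in>UNIV. F b c * coeff (lactp s a v b) n)"
      by (simp add: coeff_sum)
    then show "lookup (matmap F (lact (free_conf p s) a v n)) c = lookup (lact (free_conf q t) a (matmap F v) n) c"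
      by (simp add: lookup_lact mult.commute)
  qed
qed simp_all

text \<open>Evaluating the coordinate at \<open>b0\<close> in \<open>\<gamma>\<close> turns the
  derivation into the scalar \<open>\<gamma>\<close>, and it kills all actions as soon as every
  structure constant with target \<open>b0\<close> vanishes there.\<close>

lemma conf_hom_triv:
  fixes b0 :: "'b::finite"
  assumes R: "carrier R = UNIV" and p: "p b0 = 0"
    and act: "\<And>i k l. ev (lookup (s i k) b0) l \<gamma> = 0"
  shows "conf_hom R (free_conf p s) (triv_conf \<gamma>) (\<lambda>v. poly (lookup v b0) \<gamma>)"
  unfolding conf_hom_def
proof (intro conjI ballI allI)
  show "poly (lookup v b0) \<gamma> \<in> grade (triv_conf \<gamma>) e" if "v \<in> grade (free_conf p s) e" for e v
    using that p not_in_keys_iff_lookup_eq_zero[of b0 v] by (cases e) (auto simp: triv_conf_def)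
  show "poly (lookup (lact (free_conf p s) a v n) b0) \<gamma> = lact (triv_conf \<gamma>) a (poly (lookup v b0) \<gamma>) n" for a v n
  proof -
    \<comment> \<open>\<open>m\<close> evaluates the derivation and keeps lambda, so vanishing for
      all values of lambda gives vanishing of each coefficient.\<close>
    define m :: "complex poly poly \<Rightarrow> complex poly" where "m = map_poly (\<lambda>q. poly q \<gamma>)"
    have "poly (m (lactp s a v b0)) l = ev (lactp s a v b0) l \<gamma>" for l
    proof -
      have "poly (m Q) l = ev Q l \<gamma>" for Q
        by (induction Q) (simp_all add: m_def ev_def map_poly_pCons)
      then show ?thesis .
    qed
    then have "poly (m (lactp s a v b0)) l = 0" for l
      unfolding ev_lactp[OF finite_keys order_refl finite_UNIV subset_UNIV] by (simp add: act)
    then have "m (lactp s a v b0) = 0" using poly_eq_poly_eq_iff[of "m (lactp s a v b0)" 0] by (simp add: fun_eq_iff)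
    then have "poly (coeff (lactp s a v b0) n) \<gamma> = 0" unfolding m_def by (metis coeff_0 coeff_map_poly poly_0)
    then show ?thesis by (simp add: lookup_lact triv_conf_def)
  qed
qed (simp_all add: triv_conf_def lookup_add lookup_map)

lemma supermodule_triv: "supermodule (triv_conf \<gamma> :: ('r, complex) conf)"
proof -
  let ?M = "triv_conf \<gamma> :: ('r, complex) conf"
  have s: "carrier ?M = UNIV" "add ?M = (+)" "zero ?M = 0" "\<And>q z. q \<odot>\<^bsub>?M\<^esub> z = poly q \<gamma> * z"
    "\<And>e. grade ?M e = (if e = 0 then UNIV else {0})"
    by (simp_all add: triv_conf_def)
  have ab: "abelian_group ?M"
    by (rule abelian_groupI) (auto simp: s intro: exI[of _ "- _"])
  have mod: "Module.module CD ?M"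
    by (rule moduleI[OF cring_CD ab]) (auto simp: s algebra_simps)
  interpret M: Module.module CD ?M by (rule mod)
  have inv: "\<ominus>\<^bsub>?M\<^esub> v = - v" for v by (rule M.M.minus_equality) (simp_all add: s)
  show ?thesis
  proof (intro supermodule.intro[OF mod] supermodule_axioms.intro)
    show "submodule (grade ?M e) CD ?M" for e by (rule M.submoduleI) (auto simp: s inv)
    show "grade ?M 0 <+>\<^bsub>?M\<^esub> grade ?M 1 = carrier ?M"
    proof -
      have "v \<in> grade ?M 0 <+>\<^bsub>?M\<^esub> grade ?M 1" for v
        using set_addI[of v "grade ?M 0" 0 "grade ?M 1" ?M] by (simp add: s)
      then show ?thesis by (auto simp: s)
    qed
    show "grade ?M 0 \<inter> grade ?M 1 = {\<zero>\<^bsub>?M\<^esub>}" by (simp add: s)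
  qed
qed

lemma triv_conf_simps:
  "carrier (triv_conf \<gamma>) = UNIV" "zero (triv_conf \<gamma>) = 0" "lact (triv_conf \<gamma>) a v n = 0"
  "grade (triv_conf \<gamma>) e = (if e = 0 then UNIV else {0})" "q \<odot>\<^bsub>triv_conf \<gamma>\<^esub> z = poly q \<gamma> * z"
  by (simp_all add: triv_conf_def)

lemma closed_conf_triv: "closed_conf R (triv_conf \<gamma>)"
  by (simp add: closed_conf_def supermodule_triv triv_conf_simps)

lemma conf_simple_triv: "conf_simple R (triv_conf \<gamma>)"
  unfolding conf_simple_def triv_conf_simps
proof (intro conjI allI impI)
  show "UNIV \<noteq> {0 :: complex}" using UNIV_not_singleton[of "0 :: complex"] by blast
  fix N assume N: "conf_sub R (triv_conf \<gamma>) N"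
  have "N = UNIV" if z: "z \<in> N" "z \<noteq> 0" for z
  proof -
    have "w \<in> N" for w using conf_subD(4)[OF N z(1), of "[:w / z:]"] z(2) by (simp add: triv_conf_simps)
    then show ?thesis by blast
  qed
  then show "N = {0} \<or> N = UNIV" using conf_subD(2)[OF N] by (auto simp: triv_conf_simps)
qed

section \<open>Leading coefficients and generation of free modules\<close>

definition shift :: "complex poly \<Rightarrow> complex poly poly" where
  "shift h = subst_del h (del + lam)"

lemma coeff_shift: "coeff (shift h) n = (\<Sum>k\<le>degree h. [:coeff h k:] * (if n \<le> k then of_nat (k choose n) * [:0, 1:] ^ (k - n) else 0))"
proof -
  have "shift h = (\<Sum>k\<le>degree h. cst (coeff h k) * (lam + del) ^ k)"
    by (rule ev_eqI) (simp add: shift_def poly_altdef add.commute)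
  then show ?thesis by (simp add: coeff_sum cst_def coeff_lam_del_power)
qed

text \<open>\<open>h(del + lam)\<close> is symmetric in its two variables, so its top coefficient in
  lambda is that of \<open>h\<close>: a scalar, whatever \<open>h\<close> is.\<close>

lemma coeff_shift_degree: "coeff (shift h) (degree h) = [:lead_coeff h:]"
  unfolding coeff_shift by (subst sum.remove[of _ "degree h"]) (auto intro!: sum.neutral)

lemma coeff_shift_high: "degree h < n \<Longrightarrow> coeff (shift h) n = 0"
  unfolding coeff_shift by (rule sum.neutral) auto

lemma coeff_shift_0: "coeff (shift h) 0 = h"
proof -
  have "poly (coeff (shift h) 0) d = poly h d" for d
  proof -
    have "poly (coeff (shift h) 0) d = ev (shift h) 0 d" by (simp add: ev_def poly_0_coeff_0)
    then show ?thesis by (simp add: shift_def)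
  qed
  then show ?thesis by (simp add: poly_eq_poly_eq_iff[symmetric] fun_eq_iff)
qed

lemma lactp_single: "lactp s (Poly_Mapping.single g 1) (v :: 'b::finite \<Rightarrow>\<^sub>0 complex poly) c =
  (\<Sum>b\<in>UNIV. shift (lookup v b) * lookup (s g b) c)"
  by (rule ev_eqI) (simp add: ev_lactp[OF finite_keys order_refl finite_UNIV subset_UNIV] shift_def)

lemma cst_0: "cst 0 = 0"
  by (simp add: cst_def)

lemma coeff_mult_cst: "coeff (q * cst \<kappa>) n = Polynomial.smult \<kappa> (coeff q n)"
  by (simp add: cst_def mult.commute)

lemma coeff_mult_lam: "coeff (q * lam) (Suc n) = coeff q n" "coeff (q * lam) 0 = 0"
  by (simp_all add: lam_def)

lemma coeff_mult_2: "coeff (q * 2) n = 2 * coeff q n" for q :: "complex poly poly"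
proof -
  have "q * 2 = q + q" by (simp add: mult_2_right)
  then show ?thesis by (simp only: coeff_add mult_2)
qed

lemma coeff_mult_del: "coeff (q * del) n = coeff q n * [:0, 1:]"
  by (simp add: del_def mult.commute)

lemmas coeff_act = coeff_mult_cst coeff_mult_2 coeff_mult_lam coeff_mult_del mult.assoc[symmetric] distrib_left

lemma shift_0 [simp]: "shift 0 = 0"
  by (simp add: shift_def subst_del_def)

context
  fixes R :: "('a \<Rightarrow>\<^sub>0 complex poly, 'a \<Rightarrow>\<^sub>0 complex poly) conf" and p :: "'b::finite \<Rightarrow> bit"
    and s :: "'a \<Rightarrow> 'b \<Rightarrow> ('b \<Rightarrow>\<^sub>0 complex poly poly)" and N
  assumes R: "carrier R = UNIV" and N: "conf_sub R (free_conf p s) N"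
begin

lemma conf_sub_lact: "v \<in> N \<Longrightarrow> lact (free_conf p s) x v n \<in> N"
  by (rule conf_subD(5)[OF N]) (simp add: R)

text \<open>The working form of closure under the action: fix a basis element \<open>g\<close> and a
  power \<open>n\<close> of lambda, and read off the coordinates.\<close>

lemma conf_sub_coeff:
  assumes "v \<in> N" "\<And>c. coeff (\<Sum>b\<in>UNIV. shift (lookup v b) * lookup (s g b) c) n = lookup w c"
  shows "w \<in> N"
proof -
  have "lact (free_conf p s) (Poly_Mapping.single g 1) v n = w"
    by (rule poly_mapping_eqI) (simp add: lookup_lact lactp_single assms(2))
  then show ?thesis using conf_sub_lact[OF assms(1), of "Poly_Mapping.single g 1" n] by simp
qed

lemma conf_sub_single:
  assumes "Poly_Mapping.single b [:\<kappa>:] \<in> N" "\<kappa> \<noteq> 0"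
  shows "Poly_Mapping.single b q \<in> N"
proof -
  have "Poly_Mapping.map ((*) (q * [:1 / \<kappa>:])) (Poly_Mapping.single b [:\<kappa>:]) \<in> N"
    using conf_subD(4)[OF N assms(1), of "q * [:1 / \<kappa>:]"] by simp
  moreover have "Poly_Mapping.map ((*) (q * [:1 / \<kappa>:])) (Poly_Mapping.single b [:\<kappa>:]) = Poly_Mapping.single b q"
    using assms(2) by (intro poly_mapping_eqI) (simp add: lookup_map lookup_single when_def)
  ultimately show ?thesis by simp
qed

lemma conf_sub_UNIV:
  assumes "\<And>b. Poly_Mapping.single b 1 \<in> N"
  shows "N = UNIV"
proof -
  have "v \<in> N" for v :: "'b \<Rightarrow>\<^sub>0 complex poly"
  proof -
    have "(\<Sum>b\<in>B. Poly_Mapping.single b (lookup v b)) \<in> N" if "finite B" for B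
      using that
    proof (induction B)
      case empty
      then show ?case using conf_subD(2)[OF N] by simp
    next
      case (insert b B)
      have "Poly_Mapping.single b [:1:] \<in> N" using assms[of b] by (simp add: one_pCons)
      then have "Poly_Mapping.single b (lookup v b) \<in> N" by (rule conf_sub_single) simp
      then show ?case using insert conf_subD(3)[OF N, of "Poly_Mapping.single b (lookup v b)"] by simp
    qed
    moreover have "(\<Sum>b\<in>UNIV. Poly_Mapping.single b (lookup v b)) = v"
      by (rule poly_mapping_eqI) (simp add: lookup_sum lookup_single when_def)
    ultimately show ?thesis by (metis finite_UNIV)
  qed
  then show ?thesis by blast
qed

lemma conf_sub_homogeneous:
  assumes "N \<noteq> {0}"
  obtains v e where "v \<in> N" "v \<noteq> 0" "\<And>b. p b \<noteq> e \<Longrightarrow> lookup v b = 0"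
proof -
  interpret supermodule "free_conf p s" by (rule supermodule_free_conf)
  obtain v where v: "v \<in> N" "v \<noteq> 0" using assms conf_subD(2)[OF N] by auto
  obtain v0 v1 where w: "v0 \<in> grade (free_conf p s) 0" "v1 \<in> grade (free_conf p s) 1" "v = v0 + v1"
    using grade_split[of v] by auto
  have m: "v0 \<in> N" "v1 \<in> N" using conf_subD(6,7)[OF N w(1,2)] v(1) w(3) by simp_all
  show ?thesis
  proof (cases "v0 = 0")
    case True
    have "lookup v1 b = 0" if "p b \<noteq> 1" for b
      using w(2) that not_in_keys_iff_lookup_eq_zero[of b v1] by auto
    then show ?thesis using that[of v1 1] m v w(3) True by simp
  next
    case False
    have "lookup v0 b = 0" if "p b \<noteq> 0" for b
      using w(1) that not_in_keys_iff_lookup_eq_zero[of b v0] by auto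
    then show ?thesis using that[of v0 0] m False by simp
  qed
qed

end

lemma free_conf_nontrivial: "UNIV \<noteq> {0 :: 'b \<Rightarrow>\<^sub>0 complex poly}"
proof -
  have "lookup (Poly_Mapping.single b (1 :: complex poly)) b \<noteq> lookup 0 b" for b :: 'b by simp
  then show ?thesis by (metis UNIV_I singletonD)
qed

text \<open>Serves both rank (1+1) families, with \<open>g\<close> and \<open>h\<close> the two
  generators \<open>Gp 0\<close> and \<open>Gm 0\<close> in either order and
  \<open>c = 2 * \<Delta>\<close>. For vanishing \<open>c\<close> the action of \<open>h\<close>
  would only reach multiples of \<open>del + \<alpha>\<close> at \<open>V0\<close>.\<close>

lemma conf_simple_basis2:
  assumes R: "carrier R = UNIV" and r: "r \<noteq> 0" and c: "c \<noteq> 0"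
    and g: "s g V0 = trm V1 (cst r)" "s g V1 = 0"
    and h: "s h V0 = 0" "s h V1 = trm V0 (cst (2 * r) * (del + cst c * lam + cst \<alpha>))"
  shows "conf_simple R (free_conf basis2_parity s)"
  unfolding conf_simple_def
proof (intro conjI allI impI)
  show "carrier (free_conf basis2_parity s) \<noteq> {\<zero>\<^bsub>free_conf basis2_parity s\<^esub>}"
    using free_conf_nontrivial by simp
  fix N assume N: "conf_sub R (free_conf basis2_parity s) N"
  note coeff = conf_sub_coeff[OF R N] and single = conf_sub_single[OF R N]
  have "N = UNIV" if ne: "N \<noteq> {0}"
  proof -
    obtain v e where v: "v \<in> N" "v \<noteq> 0" "\<And>b. basis2_parity b \<noteq> e \<Longrightarrow> lookup v b = 0"
      using conf_sub_homogeneous[OF R N ne] by metis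
    have V0: "Poly_Mapping.single V0 1 \<in> N \<or> Poly_Mapping.single V1 1 \<in> N"
    proof (cases "e = 0")
      case True
      then have z: "lookup v V1 = 0" using v(3)[of V1] by simp
      have f: "lookup v V0 \<noteq> 0"
      proof
        assume "lookup v V0 = 0"
        then have "v = 0" using z by (intro poly_mapping_eqI) (metis basis2.exhaust lookup_zero)
        then show False using v(2) by simp
      qed
      have "Poly_Mapping.single V1 [:r * lead_coeff (lookup v V0):] \<in> N"
        by (rule coeff[OF v(1), of g "degree (lookup v V0)"])
           (simp add: UNIV_basis2 g z lookup_single when_def coeff_act coeff_shift_degree)
      then show ?thesis using single[of V1 _ 1] r f by simp
    next
      case False
      then have z: "lookup v V0 = 0" using v(3)[of V0] by simp
      have f: "lookup v V1 \<noteq> 0"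
      proof
        assume "lookup v V1 = 0"
        then have "v = 0" using z by (intro poly_mapping_eqI) (metis basis2.exhaust lookup_zero)
        then show False using v(2) by simp
      qed
      \<comment> \<open>One power above the degree only the \<open>lam\<close> term of
        \<open>s h V1\<close> contributes, which brings in the factor \<open>c\<close>.\<close>
      have "Poly_Mapping.single V0 [:c * (2 * r * lead_coeff (lookup v V1)):] \<in> N"
        by (rule coeff[OF v(1), of h "Suc (degree (lookup v V1))"])
           (simp add: UNIV_basis2 h z lookup_single when_def coeff_act coeff_shift_degree coeff_shift_high)
      then show ?thesis using single[of V0 _ 1] r c f by simp
    qed
    have 01: "Poly_Mapping.single V1 1 \<in> N" if "Poly_Mapping.single V0 1 \<in> N"
    proof -
      have "Poly_Mapping.single V1 [:r:] \<in> N"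
        by (rule coeff[OF that, of g 0])
           (simp add: UNIV_basis2 g lookup_single when_def coeff_act coeff_shift_0 one_pCons)
      then show ?thesis using single[of V1 _ 1] r by simp
    qed
    have 10: "Poly_Mapping.single V0 1 \<in> N" if "Poly_Mapping.single V1 1 \<in> N"
    proof -
      have "Poly_Mapping.single V0 [:c * (2 * r):] \<in> N"
        by (rule coeff[OF that, of h 1])
           (simp add: UNIV_basis2 h lookup_single when_def coeff_act coeff_shift_0 coeff_shift_high one_pCons)
      then show ?thesis using single[of V0 _ 1] r c by simp
    qed
    show ?thesis
    proof (rule conf_sub_UNIV[OF R N])
      show "Poly_Mapping.single b 1 \<in> N" for b using V0 01 10 by (cases b) auto
    qed
  qed
  then show "N = {\<zero>\<^bsub>free_conf basis2_parity s\<^esub>} \<or> N = carrier (free_conf basis2_parity s)" by auto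
qed


text \<open>Serves both rank (2+2) families: \<open>g\<close>, \<open>h\<close>, \<open>g'\<close>,
  \<open>h'\<close> are \<open>Gp 0\<close>, \<open>Gm 0\<close>, \<open>Gp 1\<close>,
  \<open>Gm 1\<close>, with \<open>c = 2 * \<Delta> + \<Lambda>\<close>,
  \<open>c' = 2 * \<Delta> - \<Lambda>\<close> and \<open>b = \<beta>\<close>. A nonzero odd vector
  yields \<open>V01\<close> directly, a nonzero even one is first turned into an odd one, and
  \<open>V01\<close> generates everything.\<close>

lemma conf_simple_basis4:
  assumes R: "carrier R = UNIV" and r: "r \<noteq> 0" and b: "b \<noteq> 0 \<or> c \<noteq> 0 \<and> c' \<noteq> 0"
    and g: "s g V01 = trm V11 (cst r)" "s g V11 = 0" "s g V02 = trm V11 (- cst (r * c) * lam)"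
      "s g V12 = trm V01 (cst (r * c) * lam) + trm V02 (cst r)"
    and h: "s h V01 = trm V12 (cst r)" "s h V12 = 0"
      "s h V11 = trm V01 (cst r * (2 * del + cst c' * lam + cst a)) + trm V02 (- cst r)"
    and g': "s g' V01 = 0" "s g' V11 = 0" "s g' V02 = trm V11 (cst b)" "s g' V12 = trm V01 (cst (- b))"
    and h': "s h' V11 = trm V01 (cst (- b))" "s h' V12 = 0"
  shows "conf_simple R (free_conf basis4_parity s)"
  unfolding conf_simple_def
proof (intro conjI allI impI)
  show "carrier (free_conf basis4_parity s) \<noteq> {\<zero>\<^bsub>free_conf basis4_parity s\<^esub>}"
    using free_conf_nontrivial by simp
  fix N assume N: "conf_sub R (free_conf basis4_parity s) N"
  note coeff = conf_sub_coeff[OF R N] and single = conf_sub_single[OF R N]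
  have odd: "Poly_Mapping.single V01 1 \<in> N"
    if w: "w \<in> N" "w \<noteq> 0" "lookup w V01 = 0" "lookup w V02 = 0" for w
  proof (cases "lookup w V12 = 0")
    case False
    \<comment> \<open>Both \<open>g\<close> and \<open>g'\<close> kill \<open>V11\<close>, so only
      the \<open>V12\<close> coordinate counts; it yields multiples of \<open>V01\<close> with the
      factors \<open>b\<close> and \<open>c\<close>, at least one of which is nonzero.\<close>
    have "Poly_Mapping.single V01 [:- b * lead_coeff (lookup w V12):] \<in> N"
      by (rule coeff[OF w(1), of g' "degree (lookup w V12)"])
         (simp add: UNIV_basis4 g' w(3,4) lookup_single when_def coeff_act coeff_shift_degree)
    moreover have "Poly_Mapping.single V01 [:r * c * lead_coeff (lookup w V12):] \<in> N"
      by (rule coeff[OF w(1), of g "Suc (degree (lookup w V12))"])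
         (simp add: UNIV_basis4 g w(3,4) lookup_single lookup_add when_def coeff_act coeff_shift_degree coeff_shift_high)
    ultimately show ?thesis using single[of V01 _ 1] r b False by auto
  next
    case True
    have f: "lookup w V11 \<noteq> 0"
    proof
      assume "lookup w V11 = 0"
      then have "w = 0" using w(3,4) True by (intro poly_mapping_eqI) (metis basis4.exhaust lookup_zero)
      then show False using w(2) by simp
    qed
    \<comment> \<open>For a pure \<open>V11\<close> vector the lowering generators give the factors
      \<open>b\<close> and \<open>c'\<close> instead.\<close>
    have "Poly_Mapping.single V01 [:- b * lead_coeff (lookup w V11):] \<in> N"
      by (rule coeff[OF w(1), of h' "degree (lookup w V11)"])
         (simp add: UNIV_basis4 h' w(3,4) True lookup_single when_def coeff_act coeff_shift_degree)
    moreover have "Poly_Mapping.single V01 [:c' * (r * lead_coeff (lookup w V11)):] \<in> N"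
      by (rule coeff[OF w(1), of h "Suc (degree (lookup w V11))"])
         (simp add: UNIV_basis4 h w(3,4) True lookup_single lookup_add when_def coeff_act coeff_shift_degree
           coeff_shift_high)
    ultimately show ?thesis using single[of V01 _ 1] r b f by auto
  qed
  have even: "Poly_Mapping.single V01 1 \<in> N"
    if v: "v \<in> N" "v \<noteq> 0" "lookup v V11 = 0" "lookup v V12 = 0" for v
  proof -
    have V11: "Poly_Mapping.single V01 1 \<in> N" if "Poly_Mapping.single V11 H \<in> N" "H \<noteq> 0" for H
      by (rule odd[OF that(1)]) (use that(2) in \<open>auto simp: lookup_single when_def dest: arg_cong[of _ _ "\<lambda>w. lookup w V11"]\<close>)
    \<comment> \<open>The action of \<open>g\<close> on an even vector lands in the span of
      \<open>V11\<close>, with this coordinate; a nonzero coefficient of it provides an odd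
      vector.\<close>
    let ?Q = "shift (lookup v V01) * cst r - shift (lookup v V02) * (cst (r * c) * lam)"
    have Q: "Poly_Mapping.single V11 (coeff ?Q n) \<in> N" for n
      by (rule coeff[OF v(1), of g n])
         (simp add: UNIV_basis4 g v(3,4) lookup_single when_def)
    show ?thesis
    proof (cases "?Q = 0")
      case False
      then obtain n where "coeff ?Q n \<noteq> 0" by (metis leading_coeff_0_iff)
      then show ?thesis using V11[OF Q] by blast
    next
      case True
      have e: "poly (lookup v V01) (d + l) * r = poly (lookup v V02) (d + l) * (r * c * l)" for d l
        using arg_cong[OF True, of "\<lambda>q. ev q l d"] by (simp add: shift_def)
      \<comment> \<open>At \<open>lambda = 0\<close> only the first term of \<open>?Q\<close>
        survives.\<close>
      have "poly (lookup v V01) d = 0" for d using e[of d 0] r by simp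
      then have z1: "lookup v V01 = 0" by (simp add: poly_eq_poly_eq_iff[symmetric] fun_eq_iff)
      have z2: "lookup v V02 \<noteq> 0"
      proof
        assume "lookup v V02 = 0"
        then have "v = 0" using v(3,4) z1 by (intro poly_mapping_eqI) (metis basis4.exhaust lookup_zero)
        then show False using v(2) by simp
      qed
      have "c = 0"
      proof (rule ccontr)
        assume "c \<noteq> 0"
        \<comment> \<open>Taking \<open>lambda = 1\<close> and \<open>d - 1\<close> gives the value
          at \<open>d\<close> with a nonzero factor.\<close>
        then have "poly (lookup v V02) d = 0" for d using e[of "d - 1" 1] r z1 by simp
        then have "lookup v V02 = 0" by (simp add: poly_eq_poly_eq_iff[symmetric] fun_eq_iff)
        then show False using z2 by simp
      qed
      then have "b \<noteq> 0" using b by blast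
      have "Poly_Mapping.single V11 [:b * lead_coeff (lookup v V02):] \<in> N"
        by (rule coeff[OF v(1), of g' "degree (lookup v V02)"])
           (simp add: UNIV_basis4 g' v(3,4) z1 lookup_single when_def coeff_act coeff_shift_degree)
      then show ?thesis using V11 \<open>b \<noteq> 0\<close> z2 by simp
    qed
  qed
  have "N = UNIV" if ne: "N \<noteq> {0}"
  proof -
    obtain v e where v: "v \<in> N" "v \<noteq> 0" "\<And>b. basis4_parity b \<noteq> e \<Longrightarrow> lookup v b = 0"
      using conf_sub_homogeneous[OF R N ne] by metis
    have 01: "Poly_Mapping.single V01 1 \<in> N"
    proof (cases "e = 0")
      case True
      then show ?thesis using even[OF v(1,2)] v(3)[of V11] v(3)[of V12] by simp
    next
      case False
      then show ?thesis using odd[OF v(1,2)] v(3)[of V01] v(3)[of V02] by simp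
    qed
    have "Poly_Mapping.single V11 [:r:] \<in> N"
      by (rule coeff[OF 01, of g 0])
         (simp add: UNIV_basis4 g lookup_single when_def coeff_act coeff_shift_0 one_pCons)
    then have 11: "Poly_Mapping.single V11 1 \<in> N" using single[of V11 _ 1] r by simp
    have "Poly_Mapping.single V12 [:r:] \<in> N"
      by (rule coeff[OF 01, of h 0])
         (simp add: UNIV_basis4 h lookup_single when_def coeff_act coeff_shift_0 one_pCons)
    then have 12: "Poly_Mapping.single V12 1 \<in> N" using single[of V12 _ 1] r by simp
    \<comment> \<open>The \<open>V01\<close> part of \<open>g\<close> on \<open>V12\<close> carries
      a factor lambda, so the constant coefficient is a pure multiple of \<open>V02\<close>.\<close>
    have "Poly_Mapping.single V02 [:r:] \<in> N"
      by (rule coeff[OF 12, of g 0])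
         (simp add: UNIV_basis4 g lookup_single lookup_add when_def coeff_act coeff_shift_0 one_pCons)
    then have 02: "Poly_Mapping.single V02 1 \<in> N" using single[of V02 _ 1] r by simp
    show ?thesis
    proof (rule conf_sub_UNIV[OF R N])
      show "Poly_Mapping.single b 1 \<in> N" for b using 01 02 11 12 by (cases b) auto
    qed
  qed
  then show "N = {\<zero>\<^bsub>free_conf basis4_parity s\<^esub>} \<or> N = carrier (free_conf basis4_parity s)" by auto
qed

lemma conf_simple_Vmod1: "r \<noteq> 0 \<Longrightarrow> \<Delta> \<noteq> 0 \<Longrightarrow> conf_simple (K p) (Vmod1 p r \<Delta> \<alpha>)"
  unfolding Vmod1_def
  by (rule conf_simple_basis2[where g = "Gp 0" and h = "Gm 0" and c = "2 * \<Delta>" and r = r and \<alpha> = \<alpha>]) simp_all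

lemma conf_simple_Vmod2: "r \<noteq> 0 \<Longrightarrow> \<Delta> \<noteq> 0 \<Longrightarrow> conf_simple (K p) (Vmod2 p r \<Delta> \<alpha>)"
  unfolding Vmod2_def
  by (rule conf_simple_basis2[where g = "Gm 0" and h = "Gp 0" and c = "2 * \<Delta>" and r = r and \<alpha> = \<alpha>]) simp_all

text \<open>With \<open>b = 0\<close> the assumptions on \<open>Gp 1\<close> and \<open>Gm 1\<close>
  say that these act as zero, as they do here.\<close>

lemma conf_simple_Vmod4:
  "r \<noteq> 0 \<Longrightarrow> 2 * \<Delta> + \<Lambda> \<noteq> 0 \<Longrightarrow> 2 * \<Delta> - \<Lambda> \<noteq> 0 \<Longrightarrow> conf_simple (K p) (Vmod4 p r \<Delta> \<Lambda> \<alpha>)"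
  unfolding Vmod4_def
  by (rule conf_simple_basis4[where g = "Gp 0" and h = "Gm 0" and g' = "Gp 1" and h' = "Gm 1" and c = "2 * \<Delta> + \<Lambda>"
        and c' = "2 * \<Delta> - \<Lambda>" and r = r and b = 0 and a = "2 * \<alpha>"])
     (simp_all add: cst_0)

lemma conf_simple_Vmod4b:
  "r \<noteq> 0 \<Longrightarrow> \<beta> \<noteq> 0 \<or> 2 * \<Delta> + \<Lambda> \<noteq> 0 \<and> 2 * \<Delta> - \<Lambda> \<noteq> 0 \<Longrightarrow>
    conf_simple (K (- 1)) (Vmod4b r \<Delta> \<Lambda> \<alpha> \<beta>)"
  unfolding Vmod4b_def
  by (rule conf_simple_basis4[where g = "Gp 0" and h = "Gm 0" and g' = "Gp 1" and h' = "Gm 1" and c = "2 * \<Delta> + \<Lambda>"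
        and c' = "2 * \<Delta> - \<Lambda>" and r = r and b = \<beta> and a = "2 * \<alpha>"])
     simp_all

section \<open>Composition factors\<close>

text \<open>Exactness is certified by two further matrices: \<open>F'\<close> undoes
  \<open>F\<close>, \<open>G'\<close> is a section of \<open>G\<close>, and \<open>F'\<close>
  followed by \<open>F\<close> is the identity on the kernel of \<open>G\<close>. Stated by
  coordinates, each condition unfolds to a finite sum.\<close>

lemma conf_ses_matmap:
  assumes R: "carrier R = UNIV"
    and F: "conf_hom R (free_conf p s) (free_conf q t) (matmap F)"
    and G: "conf_hom R (free_conf q t) (free_conf p' s') (matmap G)"
    and F': "\<And>v c. lookup (matmap F' (matmap F v)) c = lookup v c"
    and G': "\<And>v c. lookup (matmap G (matmap G' v)) c = lookup v c"
    and GF: "\<And>v c. lookup (matmap G (matmap F v)) c = 0"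
    and FF': "\<And>v c. (\<And>c. lookup (matmap G v) c = 0) \<Longrightarrow> lookup (matmap F (matmap F' v)) c = lookup v c"
  shows "conf_ses R (free_conf p s) (matmap F) (free_conf q t) (matmap G) (free_conf p' s')"
  unfolding conf_ses_def conf_onto_def
proof (intro conjI closed_conf_free_conf R F G)
  have "matmap F' (matmap F v) = v" for v by (rule poly_mapping_eqI) (rule F')
  then show "inj_on (matmap F) (carrier (free_conf p s))" by (metis inj_onI)
  have "matmap G (matmap G' x) = x" for x by (rule poly_mapping_eqI) (rule G')
  then have "x \<in> range (matmap G)" for x by (metis rangeI)
  then show "matmap G ` carrier (free_conf q t) = carrier (free_conf p' s')" by auto
  have "matmap G (matmap F v) = 0" for v by (rule poly_mapping_eqI) (simp only: GF lookup_zero)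
  moreover have "x \<in> range (matmap F)" if x: "matmap G x = 0" for x
  proof -
    have "matmap F (matmap F' x) = x" by (rule poly_mapping_eqI, rule FF') (simp only: x lookup_zero)
    then show ?thesis by (metis rangeI)
  qed
  ultimately show "matmap F ` carrier (free_conf p s) = conf_ker (free_conf q t) (free_conf p' s') (matmap G)"
    unfolding conf_ker_def by auto
qed

definition entries :: "(('b \<times> 'c) \<times> complex poly) list \<Rightarrow> 'b \<Rightarrow> 'c \<Rightarrow> complex poly" where
  "entries xs b c = (case map_of xs (b, c) of None \<Rightarrow> 0 | Some q \<Rightarrow> q)"

text \<open>For \<open>\<Lambda> = - 2 * \<Delta>\<close> the action of \<open>Gp 0\<close> on
  \<open>V12\<close> loses its \<open>V01\<close> part, so \<open>V12\<close> and \<open>V02\<close>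
  span a submodule. The odd \<open>V12\<close> takes the place of \<open>V0\<close>, whence the
  reversed parity and the shift of \<open>\<Delta>\<close> by one half.\<close>

lemma ses_Vmod1:
  "conf_ses (K p) (rev_parity (Vmod1 p r (\<Delta> + 1 / 2) \<alpha>)) (matmap (entries [((V0, V12), 1), ((V1, V02), 1)]))
    (Vmod4 p r \<Delta> (- 2 * \<Delta>) \<alpha>) (matmap (entries [((V01, V0), 1), ((V11, V1), 1)])) (Vmod1 p r \<Delta> \<alpha>)"
proof -
  let ?F = "entries [((V0, V12), 1), ((V1, V02), 1)]" and ?G = "entries [((V01, V0), 1), ((V11, V1), 1)]"
  let ?F' = "entries [((V12, V0), 1), ((V02, V1), 1)]" and ?G' = "entries [((V0, V01), 1), ((V1, V11), 1)]"
  show ?thesis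
    unfolding Vmod1_def Vmod4_def rev_parity_free_conf
  proof (rule conf_ses_matmap[where F' = ?F' and G' = ?G'])
    show "conf_hom (K p) (free_conf (\<lambda>b. basis2_parity b + 1) (act1 p r (\<Delta> + 1 / 2) \<alpha>)) (free_conf basis4_parity (act4 p r \<Delta> (- 2 * \<Delta>) \<alpha>)) (matmap ?F)"
    proof (rule conf_hom_matmap)
      show "(\<Sum>b\<in>UNIV. poly (?F k b) (d + l) * ev (lookup (act4 p r \<Delta> (- 2 * \<Delta>) \<alpha> i b) c) l d) =
          (\<Sum>b\<in>UNIV. ev (lookup (act1 p r (\<Delta> + 1 / 2) \<alpha> i k) b) l d * poly (?F b c) d)" for i k c l d
        by (cases i rule: gen_cases_0; cases k; cases c;
            simp add: UNIV_basis2 UNIV_basis4 entries_def lookup_add lookup_single when_def; simp add: field_simps power2_eq_square)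
    qed (auto simp: entries_def split: if_splits)
    show "conf_hom (K p) (free_conf basis4_parity (act4 p r \<Delta> (- 2 * \<Delta>) \<alpha>)) (free_conf basis2_parity (act1 p r \<Delta> \<alpha>)) (matmap ?G)"
    proof (rule conf_hom_matmap)
      show "(\<Sum>b\<in>UNIV. poly (?G k b) (d + l) * ev (lookup (act1 p r \<Delta> \<alpha> i b) c) l d) =
          (\<Sum>b\<in>UNIV. ev (lookup (act4 p r \<Delta> (- 2 * \<Delta>) \<alpha> i k) b) l d * poly (?G b c) d)" for i k c l d
        by (cases i rule: gen_cases_0; cases k; cases c;
            simp add: UNIV_basis2 UNIV_basis4 entries_def lookup_add lookup_single when_def; simp add: field_simps power2_eq_square)
    qed (auto simp: entries_def split: if_splits)
    show "lookup (matmap ?F' (matmap ?F v)) c = lookup v c" for v c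
      by (cases c) (simp_all add: UNIV_basis2 UNIV_basis4 entries_def)
    show "lookup (matmap ?G (matmap ?G' v)) c = lookup v c" for v c
      by (cases c) (simp_all add: UNIV_basis2 UNIV_basis4 entries_def)
    show "lookup (matmap ?G (matmap ?F v)) c = 0" for v c
      by (cases c) (simp_all add: UNIV_basis2 UNIV_basis4 entries_def)
    show "lookup (matmap ?F (matmap ?F' v)) c = lookup v c" if z: "\<And>c. lookup (matmap ?G v) c = 0" for v c
      using z[of V0] z[of V1] by (cases c) (simp_all add: UNIV_basis2 UNIV_basis4 entries_def)
  qed simp
qed

text \<open>For \<open>\<Lambda> = 2 * \<Delta>\<close> the action of \<open>Gm 0\<close> on
  \<open>V11\<close> is free of lambda: it is \<open>r\<close> times
  \<open>2 (del + \<alpha>) V01 - V02\<close>, and this vector, the image of \<open>V1\<close>,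
  spans the submodule together with \<open>V11\<close>. In the quotient \<open>V02\<close> becomes
  \<open>2 (del + \<alpha>) V01\<close>, which explains the entry from \<open>V02\<close> to
  \<open>V0\<close>.\<close>

lemma ses_Vmod2:
  "conf_ses (K p) (rev_parity (Vmod2 p r (\<Delta> + 1 / 2) \<alpha>)) (matmap (entries [((V0, V11), 1), ((V1, V01), [:2 * \<alpha>, 2:]), ((V1, V02), - 1)]))
    (Vmod4 p r \<Delta> (2 * \<Delta>) \<alpha>) (matmap (entries [((V01, V0), 1), ((V12, V1), 1), ((V02, V0), [:2 * \<alpha>, 2:])])) (Vmod2 p r \<Delta> \<alpha>)"
proof -
  let ?F = "entries [((V0, V11), 1), ((V1, V01), [:2 * \<alpha>, 2:]), ((V1, V02), - 1)]" and ?G = "entries [((V01, V0), 1), ((V12, V1), 1), ((V02, V0), [:2 * \<alpha>, 2:])]"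
  let ?F' = "entries [((V11, V0), 1), ((V02, V1), - 1)]" and ?G' = "entries [((V0, V01), 1), ((V1, V12), 1)]"
  show ?thesis
    unfolding Vmod2_def Vmod4_def rev_parity_free_conf
  proof (rule conf_ses_matmap[where F' = ?F' and G' = ?G'])
    show "conf_hom (K p) (free_conf (\<lambda>b. basis2_parity b + 1) (act2 p r (\<Delta> + 1 / 2) \<alpha>)) (free_conf basis4_parity (act4 p r \<Delta> (2 * \<Delta>) \<alpha>)) (matmap ?F)"
    proof (rule conf_hom_matmap)
      show "(\<Sum>b\<in>UNIV. poly (?F k b) (d + l) * ev (lookup (act4 p r \<Delta> (2 * \<Delta>) \<alpha> i b) c) l d) =
          (\<Sum>b\<in>UNIV. ev (lookup (act2 p r (\<Delta> + 1 / 2) \<alpha> i k) b) l d * poly (?F b c) d)" for i k c l d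
        by (cases i rule: gen_cases_0; cases k; cases c;
            simp add: UNIV_basis2 UNIV_basis4 entries_def lookup_add lookup_single when_def; simp add: field_simps power2_eq_square)
    qed (auto simp: entries_def split: if_splits)
    show "conf_hom (K p) (free_conf basis4_parity (act4 p r \<Delta> (2 * \<Delta>) \<alpha>)) (free_conf basis2_parity (act2 p r \<Delta> \<alpha>)) (matmap ?G)"
    proof (rule conf_hom_matmap)
      show "(\<Sum>b\<in>UNIV. poly (?G k b) (d + l) * ev (lookup (act2 p r \<Delta> \<alpha> i b) c) l d) =
          (\<Sum>b\<in>UNIV. ev (lookup (act4 p r \<Delta> (2 * \<Delta>) \<alpha> i k) b) l d * poly (?G b c) d)" for i k c l d
        by (cases i rule: gen_cases_0; cases k; cases c;
            simp add: UNIV_basis2 UNIV_basis4 entries_def lookup_add lookup_single when_def; simp add: field_simps power2_eq_square)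
    qed (auto simp: entries_def split: if_splits)
    show "lookup (matmap ?F' (matmap ?F v)) c = lookup v c" for v c
      by (cases c) (simp_all add: UNIV_basis2 UNIV_basis4 entries_def)
    show "lookup (matmap ?G (matmap ?G' v)) c = lookup v c" for v c
      by (cases c) (simp_all add: UNIV_basis2 UNIV_basis4 entries_def)
    show "lookup (matmap ?G (matmap ?F v)) c = 0" for v c
      by (cases c) (simp_all add: UNIV_basis2 UNIV_basis4 entries_def)
    show "lookup (matmap ?F (matmap ?F' v)) c = lookup v c" if z: "\<And>c. lookup (matmap ?G v) c = 0" for v c
    proof -
      \<comment> \<open>In the kernel of \<open>?G\<close> the \<open>V01\<close> coordinate is
        determined by the \<open>V02\<close> coordinate, which \<open>?F'\<close> reads off with a
        sign.\<close>
      have "lookup v V01 = - (lookup v V02 * [:2 * \<alpha>, 2:])"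
        using z[of V0] by (simp add: UNIV_basis4 entries_def eq_neg_iff_add_eq_0 add.commute del: mult_pCons_right)
      then show ?thesis using z[of V1] by (cases c) (simp_all add: UNIV_basis2 UNIV_basis4 entries_def)
    qed
  qed simp
qed

text \<open>The image of the matrix is spanned by \<open>V1\<close> and
  \<open>(del + \<alpha>) V0\<close> and has codimension one; the derivation acts on the quotient by
  \<open>- \<alpha>\<close>. The factor 2 in the matrix comes from \<open>2 * r\<close> in the
  actions on \<open>V1\<close>.\<close>

lemma conf_ses_triv:
  fixes \<alpha> :: complex
  defines "F \<equiv> entries [((V0, V1), 1), ((V1, V0), [:2 * \<alpha>, 2:])]"
  assumes R: "carrier R = UNIV"
    and F: "conf_hom R (free_conf p s) (free_conf q t) (matmap F)"
    and h: "conf_hom R (free_conf q t) (triv_conf (- \<alpha>)) (\<lambda>v. poly (lookup v V0) (- \<alpha>))"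
  shows "conf_ses R (free_conf p s) (matmap F) (free_conf q t) (\<lambda>v. poly (lookup v V0) (- \<alpha>)) (triv_conf (- \<alpha>))"
  unfolding conf_ses_def conf_onto_def
proof (intro conjI closed_conf_free_conf closed_conf_triv R F h)
  have l: "lookup (matmap F v) V0 = lookup v V1 * [:2 * \<alpha>, 2:]" "lookup (matmap F v) V1 = lookup v V0" for v
    by (simp_all add: UNIV_basis2 F_def entries_def)
  show "inj_on (matmap F) (carrier (free_conf p s))"
  proof (rule inj_onI)
    fix v w assume e: "matmap F v = matmap F w"
    have "lookup v V0 = lookup w V0" using arg_cong[OF e, of "\<lambda>x. lookup x V1"] by (simp only: l)
    moreover have "lookup v V1 = lookup w V1"
      using arg_cong[OF e, of "\<lambda>x. lookup x V0"] by (simp only: l mult_cancel_right) simp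
    ultimately show "v = w" by (intro poly_mapping_eqI) (metis basis2.exhaust)
  qed
  have "z \<in> range (\<lambda>v. poly (lookup v V0) (- \<alpha>))" for z
    by (rule range_eqI[of _ _ "Poly_Mapping.single V0 [:z:]"]) simp
  then show "(\<lambda>v. poly (lookup v V0) (- \<alpha>)) ` carrier (free_conf q t) = carrier (triv_conf (- \<alpha>))"
    by (auto simp: triv_conf_simps)
  have "x \<in> range (matmap F)" if "poly (lookup x V0) (- \<alpha>) = 0" for x
  proof -
    \<comment> \<open>Vanishing at \<open>- \<alpha>\<close> is divisibility by
      \<open>del + \<alpha>\<close>, so a preimage can be written down; halving \<open>q\<close>
      compensates the factor 2 of the matrix.\<close>
    have "[:- (- \<alpha>), 1:] dvd lookup x V0" using that by (simp only: poly_eq_0_iff_dvd)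
    then obtain q where q: "lookup x V0 = [:\<alpha>, 1:] * q" unfolding minus_minus by (rule dvdE)
    let ?v = "Poly_Mapping.single V0 (lookup x V1) + Poly_Mapping.single V1 (Polynomial.smult (1 / 2) q)"
    have "lookup (matmap F ?v) c = lookup x c" for c
      by (cases c) (simp_all only: l q, simp_all add: lookup_add lookup_single)
    then have "matmap F ?v = x" by (rule poly_mapping_eqI)
    then show ?thesis by (metis rangeI)
  qed
  moreover have "poly (lookup (matmap F v) V0) (- \<alpha>) = 0" for v by (simp add: l del: lookup_matmap)
  ultimately show "matmap F ` carrier (free_conf p s) =
      conf_ker (free_conf q t) (triv_conf (- \<alpha>)) (\<lambda>v. poly (lookup v V0) (- \<alpha>))"
    unfolding conf_ker_def by (auto simp: triv_conf_simps)
qed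

text \<open>The vector \<open>V1\<close> is killed by \<open>Gp 0\<close>, and \<open>Gm 0\<close>
  sends it to a multiple of \<open>(del + \<alpha>) V0\<close>, free of lambda: the pattern of the
  second family, hence the exchange of the two families.\<close>

lemma ses_Vmod1_triv:
  "conf_ses (K p) (rev_parity (Vmod2 p r (1 / 2) \<alpha>)) (matmap (entries [((V0, V1), 1), ((V1, V0), [:2 * \<alpha>, 2:])]))
    (Vmod1 p r 0 \<alpha>) (\<lambda>v. poly (lookup v V0) (- \<alpha>)) (triv_conf (- \<alpha>))"
proof -
  let ?F = "entries [((V0, V1), 1), ((V1, V0), [:2 * \<alpha>, 2:])]"
  show ?thesis
    unfolding Vmod2_def Vmod1_def rev_parity_free_conf
  proof (rule conf_ses_triv)
    show "conf_hom (K p) (free_conf (\<lambda>b. basis2_parity b + 1) (act2 p r (1 / 2) \<alpha>)) (free_conf basis2_parity (act1 p r 0 \<alpha>)) (matmap ?F)"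
    proof (rule conf_hom_matmap)
      show "(\<Sum>b\<in>UNIV. poly (?F k b) (d + l) * ev (lookup (act1 p r 0 \<alpha> i b) c) l d) =
          (\<Sum>b\<in>UNIV. ev (lookup (act2 p r (1 / 2) \<alpha> i k) b) l d * poly (?F b c) d)" for i k c l d
        by (cases i rule: gen_cases_0; cases k; cases c;
            simp add: UNIV_basis2 entries_def lookup_single when_def; simp add: field_simps)
    qed (auto simp: entries_def split: if_splits)
    show "conf_hom (K p) (free_conf basis2_parity (act1 p r 0 \<alpha>)) (triv_conf (- \<alpha>)) (\<lambda>v. poly (lookup v V0) (- \<alpha>))"
    proof (rule conf_hom_triv)
      show "ev (lookup (act1 p r 0 \<alpha> i k) V0) l (- \<alpha>) = 0" for i k l
        by (cases i rule: gen_cases_0; cases k; simp add: cst_0 lookup_single when_def)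
    qed simp_all
  qed simp
qed

lemma ses_Vmod2_triv:
  "conf_ses (K p) (rev_parity (Vmod1 p r (1 / 2) \<alpha>)) (matmap (entries [((V0, V1), 1), ((V1, V0), [:2 * \<alpha>, 2:])]))
    (Vmod2 p r 0 \<alpha>) (\<lambda>v. poly (lookup v V0) (- \<alpha>)) (triv_conf (- \<alpha>))"
proof -
  let ?F = "entries [((V0, V1), 1), ((V1, V0), [:2 * \<alpha>, 2:])]"
  show ?thesis
    unfolding Vmod1_def Vmod2_def rev_parity_free_conf
  proof (rule conf_ses_triv)
    show "conf_hom (K p) (free_conf (\<lambda>b. basis2_parity b + 1) (act1 p r (1 / 2) \<alpha>)) (free_conf basis2_parity (act2 p r 0 \<alpha>)) (matmap ?F)"
    proof (rule conf_hom_matmap)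
      show "(\<Sum>b\<in>UNIV. poly (?F k b) (d + l) * ev (lookup (act2 p r 0 \<alpha> i b) c) l d) =
          (\<Sum>b\<in>UNIV. ev (lookup (act1 p r (1 / 2) \<alpha> i k) b) l d * poly (?F b c) d)" for i k c l d
        by (cases i rule: gen_cases_0; cases k; cases c;
            simp add: UNIV_basis2 entries_def lookup_single when_def; simp add: field_simps)
    qed (auto simp: entries_def split: if_splits)
    show "conf_hom (K p) (free_conf basis2_parity (act2 p r 0 \<alpha>)) (triv_conf (- \<alpha>)) (\<lambda>v. poly (lookup v V0) (- \<alpha>))"
    proof (rule conf_hom_triv)
      show "ev (lookup (act2 p r 0 \<alpha> i k) V0) l (- \<alpha>) = 0" for i k l
        by (cases i rule: gen_cases_0; cases k; simp add: cst_0 lookup_single when_def)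
    qed simp_all
  qed simp
qed


text \<open>Hands every statement about modules with \<open>\<beta> = 0\<close> to the first family,
  whose facts are available for \<open>p = - 1\<close> too.\<close>

lemma Vmod4b_0: "Vmod4b r \<Delta> \<Lambda> \<alpha> 0 = Vmod4 (- 1) r \<Delta> \<Lambda> \<alpha>"
proof -
  have "act4b r \<Delta> \<Lambda> \<alpha> 0 g v = act4 (- 1) r \<Delta> \<Lambda> \<alpha> g v" for g v
    by (cases g rule: gen_cases_1; cases v; simp add: cst_0)
  then have "act4b r \<Delta> \<Lambda> \<alpha> 0 = act4 (- 1) r \<Delta> \<Lambda> \<alpha>" by (intro ext)
  then show ?thesis by (simp add: Vmod4b_def Vmod4_def)
qed

lemma supermodule_Vmod:
  "supermodule (Vmod1 p r \<Delta> \<alpha>)" "supermodule (Vmod2 p r \<Delta> \<alpha>)" "supermodule (Vmod4 p r \<Delta> \<Lambda> \<alpha>)"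
  "supermodule (rev_parity (Vmod1 p r \<Delta> \<alpha>))" "supermodule (rev_parity (Vmod2 p r \<Delta> \<alpha>))"
  by (simp_all add: Vmod1_def Vmod2_def Vmod4_def supermodule_free_conf rev_parity_free_conf)

lemma carrier_Vmod:
  "carrier (Vmod1 p r \<Delta> \<alpha>) \<noteq> {\<zero>\<^bsub>Vmod1 p r \<Delta> \<alpha>\<^esub>}" "carrier (Vmod2 p r \<Delta> \<alpha>) \<noteq> {\<zero>\<^bsub>Vmod2 p r \<Delta> \<alpha>\<^esub>}"
  using free_conf_nontrivial by (simp_all add: Vmod1_def Vmod2_def)

section \<open>Charges of the models\<close>

definition charges :: "'r \<Rightarrow> ('r, 'v) conf \<Rightarrow> complex option \<times> complex option \<Rightarrow> bool" where
  "charges a M c \<longleftrightarrow> grade_charge a M 0 (fst c) \<and> grade_charge a M 1 (snd c)"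

lemma charges_rev_parity: "charges a (rev_parity M) (c, d) \<longleftrightarrow> charges a M (d, c)"
  by (auto simp: charges_def grade_charge_def split: option.splits)

lemma grade_charge_free_conf:
  fixes p :: "'b::finite \<Rightarrow> bit"
  assumes "\<And>b. p b = e \<Longrightarrow> s g b = trm b (cst \<kappa>)" and b0: "p b0 = e"
  shows "grade_charge (Poly_Mapping.single g 1) (free_conf p s) e (Some \<kappa>)"
proof -
  let ?M = "free_conf p s"
  have "Poly_Mapping.single b0 1 \<in> grade ?M e" using b0 by simp
  moreover have "Poly_Mapping.single b0 (1 :: complex poly) \<noteq> 0"
    by (metis lookup_single_eq lookup_zero zero_neq_one)
  ultimately have "grade ?M e \<noteq> {0}" by blast
  moreover have "lact ?M (Poly_Mapping.single g 1) v 0 = [:\<kappa>:] \<odot>\<^bsub>?M\<^esub> v" if v: "v \<in> grade ?M e" for v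
  proof (rule poly_mapping_eqI)
    fix c
    have "(\<Sum>b\<in>UNIV. shift (lookup v b) * lookup (s g b) c) = (\<Sum>b\<in>UNIV. if b = c then shift (lookup v b) * cst \<kappa> else 0)"
    proof (rule sum.cong[OF refl])
      fix b
      show "shift (lookup v b) * lookup (s g b) c = (if b = c then shift (lookup v b) * cst \<kappa> else 0)"
      proof (cases "lookup v b = 0")
        case False
        then have "p b = e" using v by (auto simp: in_keys_iff)
        then show ?thesis by (simp add: assms(1) lookup_single when_def)
      qed auto
    qed
    then show "lookup (lact ?M (Poly_Mapping.single g 1) v 0) c = lookup ([:\<kappa>:] \<odot>\<^bsub>?M\<^esub> v) c"
      by (simp add: lookup_lact lactp_single coeff_mult_cst coeff_shift_0 lookup_map)
  qed
  ultimately show ?thesis by (simp add: grade_charge_def)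
qed

lemma charges_Vmod:
  "charges (Poly_Mapping.single (J 0) 1) (Vmod1 p r \<Delta> \<alpha>) (Some (- 2 * \<Delta>), Some (1 - 2 * \<Delta>))"
  "charges (Poly_Mapping.single (J 0) 1) (Vmod2 p r \<Delta> \<alpha>) (Some (2 * \<Delta>), Some (2 * \<Delta> - 1))"
proof -
  have c: "b = V0" if "basis2_parity b = 0" for b using that by (cases b) auto
  have d: "b = V1" if "basis2_parity b = 1" for b using that by (cases b) auto
  show "charges (Poly_Mapping.single (J 0) 1) (Vmod1 p r \<Delta> \<alpha>) (Some (- 2 * \<Delta>), Some (1 - 2 * \<Delta>))"
    unfolding charges_def Vmod1_def fst_conv snd_conv
    by (intro conjI; rule grade_charge_free_conf[where ?b0.0 = V0] grade_charge_free_conf[where ?b0.0 = V1]) (auto dest!: c d)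
  show "charges (Poly_Mapping.single (J 0) 1) (Vmod2 p r \<Delta> \<alpha>) (Some (2 * \<Delta>), Some (2 * \<Delta> - 1))"
    unfolding charges_def Vmod2_def fst_conv snd_conv
    by (intro conjI; rule grade_charge_free_conf[where ?b0.0 = V0] grade_charge_free_conf[where ?b0.0 = V1]) (auto dest!: c d)
qed

lemma charges_triv: "charges a (triv_conf \<gamma>) (Some 0, None)"
  using UNIV_not_singleton[of "0 :: complex"]
  by (auto simp: charges_def grade_charge_def triv_conf_simps)

lemma charges_iso:
  assumes "charges (a :: gen \<Rightarrow>\<^sub>0 complex poly) S c" "supermodule S" "conf_iso (K p) S Q" "conformal_module (K p) Q"
  shows "charges a Q c"
  using assms grade_charge_iso[OF assms(3,2) conformal_module_supermodule[OF assms(4)]] unfolding charges_def by simp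

text \<open>The pair \<open>c\<close> enters through an equation, so that the expected charges may
  be written in any arithmetically equal form.\<close>

lemma charges_conf_iso:
  "\<lbrakk>conf_iso (K p) (Vmod1 p r \<Delta> \<alpha>) Q; conformal_module (K p) Q; c = (Some (- 2 * \<Delta>), Some (1 - 2 * \<Delta>))\<rbrakk>
    \<Longrightarrow> charges (Poly_Mapping.single (J 0) 1) Q c"
  "\<lbrakk>conf_iso (K p) (Vmod2 p r \<Delta> \<alpha>) Q; conformal_module (K p) Q; c = (Some (2 * \<Delta>), Some (2 * \<Delta> - 1))\<rbrakk>
    \<Longrightarrow> charges (Poly_Mapping.single (J 0) 1) Q c"
  "\<lbrakk>conf_iso (K p) (triv_conf \<gamma>) Q; conformal_module (K p) Q; c = (Some 0, None)\<rbrakk>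
    \<Longrightarrow> charges (Poly_Mapping.single (J 0) 1) Q c"
  "\<lbrakk>conf_iso (K p) (rev_parity (Vmod1 p r \<Delta> \<alpha>)) Q; conformal_module (K p) Q; c = (Some (1 - 2 * \<Delta>), Some (- 2 * \<Delta>))\<rbrakk>
    \<Longrightarrow> charges (Poly_Mapping.single (J 0) 1) Q c"
  "\<lbrakk>conf_iso (K p) (rev_parity (Vmod2 p r \<Delta> \<alpha>)) Q; conformal_module (K p) Q; c = (Some (2 * \<Delta> - 1), Some (2 * \<Delta>))\<rbrakk>
    \<Longrightarrow> charges (Poly_Mapping.single (J 0) 1) Q c"
  "\<lbrakk>conf_iso (K p) (rev_parity (triv_conf \<gamma>)) Q; conformal_module (K p) Q; c = (None, Some 0)\<rbrakk>
    \<Longrightarrow> charges (Poly_Mapping.single (J 0) 1) Q c"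
  using charges_iso[OF charges_Vmod(1) supermodule_Vmod(1)]
    charges_iso[OF charges_Vmod(2) supermodule_Vmod(2)]
    charges_iso[OF charges_triv supermodule_triv]
    charges_iso[OF charges_rev_parity[THEN iffD2, OF charges_Vmod(1)] supermodule_Vmod(4)]
    charges_iso[OF charges_rev_parity[THEN iffD2, OF charges_Vmod(2)] supermodule_Vmod(5)]
    charges_iso[OF charges_rev_parity[THEN iffD2, OF charges_triv] closed_confD(1)[OF closed_conf_rev_parity[OF closed_conf_triv]]]
  by (simp_all only:)

text \<open>Both parities are recorded because one does not separate the factors: for
  \<open>\<Delta> = \<Lambda> = 0\<close> all three even charges are 0, and the odd ones are -1, 1
  and \<open>None\<close>.\<close>

lemma multiplicity_one_K:
  assumes F: "composition_factors_are (K p) M Fs" and dist: "distinct cs"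
    and cs: "list_all2 (\<lambda>F c. \<forall>Q. F Q \<longrightarrow> conformal_module (K p) Q \<longrightarrow> charges (Poly_Mapping.single (J 0) 1) Q c) Fs cs"
    and iso: "\<And>F Q Q'. \<lbrakk>F \<in> set Fs; F Q; conf_iso (K p) Q Q'\<rbrakk> \<Longrightarrow> F Q'"
  shows "multiplicity_one (K p) M"
proof (rule multiplicity_one_charges[OF F])
  show "length cs = length Fs" using cs by (simp add: list_all2_lengthD)
  show "distinct cs" by (rule dist)
  show "grade_charge (Poly_Mapping.single (J 0) 1) Q 0 (fst (cs ! i)) \<and> grade_charge (Poly_Mapping.single (J 0) 1) Q 1 (snd (cs ! i))"
    if "i < length Fs" "(Fs ! i) Q" "conformal_module (K p) Q" for i Q
    using list_all2_nthD[OF cs that(1)] that(2,3) by (simp add: charges_def)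
  show "F Q'" if "F \<in> set Fs" "F Q" "conf_iso (K p) Q Q'" for F Q Q' using iso that by blast
qed

section \<open>Structure of the rank (2+2) modules\<close>

context
  fixes p r :: complex
  assumes p: "p \<noteq> 0" and r: "r\<^sup>2 = p"
begin

lemma r_nonzero: "r \<noteq> 0"
  using p r by auto

lemma conf_simple_rev_Vmod:
  "\<Delta> \<noteq> 0 \<Longrightarrow> conf_simple (K p) (rev_parity (Vmod1 p r \<Delta> \<alpha>))"
  "\<Delta> \<noteq> 0 \<Longrightarrow> conf_simple (K p) (rev_parity (Vmod2 p r \<Delta> \<alpha>))"
  by (simp_all add: conf_simple_rev_parity supermodule_Vmod conf_simple_Vmod1 conf_simple_Vmod2 r_nonzero)

lemma simple_module_Vmod4_iff:
  "simple_module (K p) (Vmod4 p r \<Delta> \<Lambda> \<alpha>) \<longleftrightarrow> 2 * \<Delta> + \<Lambda> \<noteq> 0 \<and> 2 * \<Delta> - \<Lambda> \<noteq> 0"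
proof
  assume s: "simple_module (K p) (Vmod4 p r \<Delta> \<Lambda> \<alpha>)"
  have c: "carrier (rev_parity M) \<noteq> {\<zero>\<^bsub>rev_parity M\<^esub>}" if "carrier M \<noteq> {\<zero>\<^bsub>M\<^esub>}" for M :: "('x, 'y) conf"
    using that by simp
  have "\<Lambda> \<noteq> - 2 * \<Delta>"
    using s not_simple_ses[OF conformal_module_Vmod4[OF r] ses_Vmod1 c[OF carrier_Vmod(1)] carrier_Vmod(1), of \<Delta> \<alpha>] by blast
  moreover have "\<Lambda> \<noteq> 2 * \<Delta>"
    using s not_simple_ses[OF conformal_module_Vmod4[OF r] ses_Vmod2 c[OF carrier_Vmod(2)] carrier_Vmod(2), of \<Delta> \<alpha>] by blast
  ultimately show "2 * \<Delta> + \<Lambda> \<noteq> 0 \<and> 2 * \<Delta> - \<Lambda> \<noteq> 0" by (auto simp: eq_neg_iff_add_eq_0 add.commute)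
next
  assume "2 * \<Delta> + \<Lambda> \<noteq> 0 \<and> 2 * \<Delta> - \<Lambda> \<noteq> 0"
  then show "simple_module (K p) (Vmod4 p r \<Delta> \<Lambda> \<alpha>)"
    using conf_simple_Vmod4 conformal_module_Vmod4[OF r] r_nonzero by (simp add: simple_module_iff)
qed

lemma has_sub_quot_Vmod4:
  "has_sub_quot (K p) (Vmod4 p r \<Delta> (- 2 * \<Delta>) \<alpha>) (rev_parity (Vmod1 p r (\<Delta> + 1 / 2) \<alpha>)) (Vmod1 p r \<Delta> \<alpha>)"
  "has_sub_quot (K p) (Vmod4 p r \<Delta> (2 * \<Delta>) \<alpha>) (rev_parity (Vmod2 p r (\<Delta> + 1 / 2) \<alpha>)) (Vmod2 p r \<Delta> \<alpha>)"
  "has_sub_quot (K p) (rev_parity (Vmod4 p r \<Delta> (- 2 * \<Delta>) \<alpha>)) (Vmod1 p r (\<Delta> + 1 / 2) \<alpha>) (rev_parity (Vmod1 p r \<Delta> \<alpha>))"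
  "has_sub_quot (K p) (rev_parity (Vmod4 p r \<Delta> (2 * \<Delta>) \<alpha>)) (Vmod2 p r (\<Delta> + 1 / 2) \<alpha>) (rev_parity (Vmod2 p r \<Delta> \<alpha>))"
  using has_sub_quot_ses[OF conformal_module_Vmod4[OF r] ses_Vmod1, of \<Delta> \<alpha>]
    has_sub_quot_ses[OF conformal_module_Vmod4[OF r] ses_Vmod2, of \<Delta> \<alpha>]
    has_sub_quot_ses[OF conformal_module_rev_parity[OF conformal_module_Vmod4[OF r]] conf_ses_rev_parity[OF ses_Vmod1], of \<Delta> \<alpha>]
    has_sub_quot_ses[OF conformal_module_rev_parity[OF conformal_module_Vmod4[OF r]] conf_ses_rev_parity[OF ses_Vmod2], of \<Delta> \<alpha>]
  by simp_all

text \<open>At \<open>\<Delta> = 0\<close> the quotient in \<open>ses_Vmod1\<close> decomposes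
  further, at \<open>\<Delta> = - 1 / 2\<close> the submodule does, since its parameter
  \<open>\<Delta> + 1 / 2\<close> is then 0. Arguments such as \<open>- 2 * 0\<close> keep the shape
  of the general \<open>- 2 * \<Delta>\<close>.\<close>

lemma composition_factors_Vmod4_1:
  "\<Delta> \<noteq> 0 \<Longrightarrow> \<Delta> \<noteq> - 1 / 2 \<Longrightarrow> composition_factors_are (K p) (Vmod4 p r \<Delta> (- 2 * \<Delta>) \<alpha>)
    [conf_iso (K p) (Vmod1 p r \<Delta> \<alpha>), conf_iso (K p) (rev_parity (Vmod1 p r (\<Delta> + 1 / 2) \<alpha>))]"
  "composition_factors_are (K p) (Vmod4 p r 0 (- 2 * 0) \<alpha>)
    [conf_iso (K p) (rev_parity (Vmod1 p r (1 / 2) \<alpha>)), conf_iso (K p) (rev_parity (Vmod2 p r (1 / 2) \<alpha>)),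
     conf_iso (K p) (triv_conf (- \<alpha>))]"
  "composition_factors_are (K p) (Vmod4 p r (- 1 / 2) (- 2 * (- 1 / 2)) \<alpha>)
    [conf_iso (K p) (Vmod1 p r (- 1 / 2) \<alpha>), conf_iso (K p) (Vmod2 p r (1 / 2) \<alpha>),
     conf_iso (K p) (rev_parity (triv_conf (- \<alpha>)))]"
proof -
  note M = conformal_module_Vmod4[OF r]
  show "composition_factors_are (K p) (Vmod4 p r \<Delta> (- 2 * \<Delta>) \<alpha>)
      [conf_iso (K p) (Vmod1 p r \<Delta> \<alpha>), conf_iso (K p) (rev_parity (Vmod1 p r (\<Delta> + 1 / 2) \<alpha>))]"
    if "\<Delta> \<noteq> 0" "\<Delta> \<noteq> - 1 / 2"
    by (rule composition_factors_are_ses[OF M ses_Vmod1])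
       (use that in \<open>auto intro!: conf_simple_rev_Vmod conf_simple_Vmod1 r_nonzero simp: add_eq_0_iff2 add_mset_commute\<close>)
  show "composition_factors_are (K p) (Vmod4 p r 0 (- 2 * 0) \<alpha>)
    [conf_iso (K p) (rev_parity (Vmod1 p r (1 / 2) \<alpha>)), conf_iso (K p) (rev_parity (Vmod2 p r (1 / 2) \<alpha>)),
     conf_iso (K p) (triv_conf (- \<alpha>))]"
    by (rule composition_factors_are_ses_quot[OF M ses_Vmod1 _ ses_Vmod1_triv])
       (simp_all add: conf_simple_rev_Vmod conf_simple_triv)
  \<comment> \<open>The submodule of \<open>ses_Vmod1\<close> is the reversal of the first rank
    (1+1) module at parameter 0, so its own sequence is the reversed \<open>ses_Vmod1_triv\<close>;
    the sum \<open>- 1 / 2 + 1 / 2\<close> keeps the shape of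
    \<open>\<Delta> + 1 / 2\<close>.\<close>
  have s: "conf_ses (K p) (Vmod2 p r (1 / 2) \<alpha>) (matmap (entries [((V0, V1), 1), ((V1, V0), [:2 * \<alpha>, 2:])]))
      (rev_parity (Vmod1 p r (- 1 / 2 + 1 / 2) \<alpha>)) (\<lambda>v. poly (lookup v V0) (- \<alpha>)) (rev_parity (triv_conf (- \<alpha>)))"
    using conf_ses_rev_parity[OF ses_Vmod1_triv[of p r \<alpha>]] by simp
  show "composition_factors_are (K p) (Vmod4 p r (- 1 / 2) (- 2 * (- 1 / 2)) \<alpha>)
    [conf_iso (K p) (Vmod1 p r (- 1 / 2) \<alpha>), conf_iso (K p) (Vmod2 p r (1 / 2) \<alpha>),
     conf_iso (K p) (rev_parity (triv_conf (- \<alpha>)))]"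
    by (rule composition_factors_are_ses_sub[OF M ses_Vmod1 s])
       (simp_all add: conf_simple_Vmod1 conf_simple_Vmod2 r_nonzero conf_simple_rev_parity supermodule_triv
         conf_simple_triv add_mset_commute)
qed

lemma composition_factors_Vmod4_2:
  "\<Delta> \<noteq> 0 \<Longrightarrow> \<Delta> \<noteq> - 1 / 2 \<Longrightarrow> composition_factors_are (K p) (Vmod4 p r \<Delta> (2 * \<Delta>) \<alpha>)
    [conf_iso (K p) (Vmod2 p r \<Delta> \<alpha>), conf_iso (K p) (rev_parity (Vmod2 p r (\<Delta> + 1 / 2) \<alpha>))]"
  "composition_factors_are (K p) (Vmod4 p r 0 (2 * 0) \<alpha>)
    [conf_iso (K p) (rev_parity (Vmod1 p r (1 / 2) \<alpha>)), conf_iso (K p) (rev_parity (Vmod2 p r (1 / 2) \<alpha>)),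
     conf_iso (K p) (triv_conf (- \<alpha>))]"
  "composition_factors_are (K p) (Vmod4 p r (- 1 / 2) (2 * (- 1 / 2)) \<alpha>)
    [conf_iso (K p) (Vmod1 p r (1 / 2) \<alpha>), conf_iso (K p) (Vmod2 p r (- 1 / 2) \<alpha>),
     conf_iso (K p) (rev_parity (triv_conf (- \<alpha>)))]"
proof -
  note M = conformal_module_Vmod4[OF r]
  show "composition_factors_are (K p) (Vmod4 p r \<Delta> (2 * \<Delta>) \<alpha>)
      [conf_iso (K p) (Vmod2 p r \<Delta> \<alpha>), conf_iso (K p) (rev_parity (Vmod2 p r (\<Delta> + 1 / 2) \<alpha>))]"
    if "\<Delta> \<noteq> 0" "\<Delta> \<noteq> - 1 / 2"
    by (rule composition_factors_are_ses[OF M ses_Vmod2])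
       (use that in \<open>auto intro!: conf_simple_rev_Vmod conf_simple_Vmod2 r_nonzero simp: add_eq_0_iff2 add_mset_commute\<close>)
  show "composition_factors_are (K p) (Vmod4 p r 0 (2 * 0) \<alpha>)
    [conf_iso (K p) (rev_parity (Vmod1 p r (1 / 2) \<alpha>)), conf_iso (K p) (rev_parity (Vmod2 p r (1 / 2) \<alpha>)),
     conf_iso (K p) (triv_conf (- \<alpha>))]"
    by (rule composition_factors_are_ses_quot[OF M ses_Vmod2 _ ses_Vmod2_triv])
       (simp_all add: conf_simple_rev_Vmod conf_simple_triv add_mset_commute)
  have s: "conf_ses (K p) (Vmod1 p r (1 / 2) \<alpha>) (matmap (entries [((V0, V1), 1), ((V1, V0), [:2 * \<alpha>, 2:])]))
      (rev_parity (Vmod2 p r (- 1 / 2 + 1 / 2) \<alpha>)) (\<lambda>v. poly (lookup v V0) (- \<alpha>)) (rev_parity (triv_conf (- \<alpha>)))"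
    using conf_ses_rev_parity[OF ses_Vmod2_triv[of p r \<alpha>]] by simp
  show "composition_factors_are (K p) (Vmod4 p r (- 1 / 2) (2 * (- 1 / 2)) \<alpha>)
    [conf_iso (K p) (Vmod1 p r (1 / 2) \<alpha>), conf_iso (K p) (Vmod2 p r (- 1 / 2) \<alpha>),
     conf_iso (K p) (rev_parity (triv_conf (- \<alpha>)))]"
    by (rule composition_factors_are_ses_sub[OF M ses_Vmod2 s])
       (simp_all add: conf_simple_Vmod1 conf_simple_Vmod2 r_nonzero conf_simple_rev_parity supermodule_triv
         conf_simple_triv add_mset_commute)
qed

lemma multiplicity_one_Vmod4: "multiplicity_one (K p) (Vmod4 p r \<Delta> \<Lambda> \<alpha>)"
proof -
  consider "2 * \<Delta> + \<Lambda> \<noteq> 0" "2 * \<Delta> - \<Lambda> \<noteq> 0" | "\<Lambda> = - 2 * \<Delta>" | "\<Lambda> = 2 * \<Delta>"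
    by (metis eq_iff_diff_eq_0 eq_neg_iff_add_eq_0 add.commute mult_minus_left)
  then show ?thesis
  proof cases
    case 1
    then have "simple_module (K p) (Vmod4 p r \<Delta> \<Lambda> \<alpha>)" using simple_module_Vmod4_iff by blast
    from multiplicity_oneI[OF composition_factors_are_simple[OF this]] show ?thesis by simp
  next
    case 2
    consider "\<Delta> \<noteq> 0" "\<Delta> \<noteq> - 1 / 2" | "\<Delta> = 0" | "\<Delta> = - 1 / 2" by blast
    then show ?thesis
    proof cases
      \<comment> \<open>The even charges agree, both being \<open>- 2 * \<Delta>\<close>; the odd
        ones are \<open>1 - 2 * \<Delta>\<close> and \<open>- 1 - 2 * \<Delta>\<close>, which differ
        by 2.\<close>
      case a: 1
      show ?thesis unfolding 2
        by (rule multiplicity_one_K[OF composition_factors_Vmod4_1(1)[OF a],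
              of "[(Some (- 2 * \<Delta>), Some (1 - 2 * \<Delta>)), (Some (1 - 2 * (\<Delta> + 1 / 2)), Some (- 2 * (\<Delta> + 1 / 2)))]"])
           (simp, simp only: list_all2_Cons list_all2_Nil simp_thms,
            (intro conjI allI impI, (erule (1) charges_conf_iso, simp add: field_simps)+)[1],
            auto intro: conf_iso_trans)
    next
      case a: 2
      show ?thesis unfolding 2 a
        by (rule multiplicity_one_K[OF composition_factors_Vmod4_1(2),
              of "[(Some (1 - 2 * (1 / 2)), Some (- 2 * (1 / 2))), (Some (2 * (1 / 2) - 1), Some (2 * (1 / 2))), (Some 0, None)]"])
           (simp, simp only: list_all2_Cons list_all2_Nil simp_thms,
            (intro conjI allI impI, (erule (1) charges_conf_iso, simp add: field_simps)+)[1],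
            auto intro: conf_iso_trans)
    next
      \<comment> \<open>The second factor and the reversed trivial one share the odd charge 0; they
        are told apart by the even part, which is zero for the latter.\<close>
      case a: 3
      show ?thesis unfolding 2 a
        by (rule multiplicity_one_K[OF composition_factors_Vmod4_1(3),
              of "[(Some (- 2 * (- 1 / 2)), Some (1 - 2 * (- 1 / 2))), (Some (2 * (1 / 2)), Some (2 * (1 / 2) - 1)), (None, Some 0)]"])
           (simp, simp only: list_all2_Cons list_all2_Nil simp_thms,
            (intro conjI allI impI, (erule (1) charges_conf_iso, simp add: field_simps)+)[1],
            auto intro: conf_iso_trans)
    qed
  next
    case 3
    consider "\<Delta> \<noteq> 0" "\<Delta> \<noteq> - 1 / 2" | "\<Delta> = 0" | "\<Delta> = - 1 / 2" by blast
    then show ?thesis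
    proof cases
      case a: 1
      show ?thesis unfolding 3
        by (rule multiplicity_one_K[OF composition_factors_Vmod4_2(1)[OF a],
              of "[(Some (2 * \<Delta>), Some (2 * \<Delta> - 1)), (Some (2 * (\<Delta> + 1 / 2) - 1), Some (2 * (\<Delta> + 1 / 2)))]"])
           (simp, simp only: list_all2_Cons list_all2_Nil simp_thms,
            (intro conjI allI impI, (erule (1) charges_conf_iso, simp add: field_simps)+)[1],
            auto intro: conf_iso_trans)
    next
      case a: 2
      show ?thesis unfolding 3 a
        by (rule multiplicity_one_K[OF composition_factors_Vmod4_2(2),
              of "[(Some (1 - 2 * (1 / 2)), Some (- 2 * (1 / 2))), (Some (2 * (1 / 2) - 1), Some (2 * (1 / 2))), (Some 0, None)]"])
           (simp, simp only: list_all2_Cons list_all2_Nil simp_thms,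
            (intro conjI allI impI, (erule (1) charges_conf_iso, simp add: field_simps)+)[1],
            auto intro: conf_iso_trans)
    next
      case a: 3
      show ?thesis unfolding 3 a
        by (rule multiplicity_one_K[OF composition_factors_Vmod4_2(3),
              of "[(Some (- 2 * (1 / 2)), Some (1 - 2 * (1 / 2))), (Some (2 * (- 1 / 2)), Some (2 * (- 1 / 2) - 1)), (None, Some 0)]"])
           (simp, simp only: list_all2_Cons list_all2_Nil simp_thms,
            (intro conjI allI impI, (erule (1) charges_conf_iso, simp add: field_simps)+)[1],
            auto intro: conf_iso_trans)
    qed
  qed
qed

end

lemma simple_module_Vmod4b_iff:
  assumes r: "r\<^sup>2 = - 1"
  shows "simple_module (K (- 1)) (Vmod4b r \<Delta> \<Lambda> \<alpha> \<beta>) \<longleftrightarrow>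
    (2 * \<Delta> + \<Lambda>, \<beta>) \<noteq> (0, 0) \<and> (2 * \<Delta> - \<Lambda>, \<beta>) \<noteq> (0, 0)"
proof (cases "\<beta> = 0")
  case True
  then show ?thesis using simple_module_Vmod4_iff[of "- 1" r, OF _ r] by (simp add: Vmod4b_0)
next
  case False
  moreover have "r \<noteq> 0" using r by auto
  ultimately show ?thesis
    using conf_simple_Vmod4b conformal_module_Vmod4b[OF r] by (simp add: simple_module_iff)
qed

lemma multiplicity_one_Vmod4b:
  assumes r: "r\<^sup>2 = - 1"
  shows "multiplicity_one (K (- 1)) (Vmod4b r \<Delta> \<Lambda> \<alpha> \<beta>)"
proof (cases "\<beta> = 0")
  case True
  then show ?thesis using multiplicity_one_Vmod4[of "- 1" r, OF _ r] by (simp add: Vmod4b_0)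
next
  case False
  then have "simple_module (K (- 1)) (Vmod4b r \<Delta> \<Lambda> \<alpha> \<beta>)" by (simp add: simple_module_Vmod4b_iff[OF r])
  from multiplicity_oneI[OF composition_factors_are_simple[OF this]] show ?thesis by simp
qed

theorem proposition4p11:
  fixes p r \<Delta> \<Lambda> \<alpha> \<beta> :: complex
  assumes "p \<noteq> 0" and "r\<^sup>2 = p"
  shows
    "(p \<noteq> - 1 \<longrightarrow>
         (simple_module (K p) (Vmod4 p r \<Delta> \<Lambda> \<alpha>) \<longleftrightarrow> 2 * \<Delta> + \<Lambda> \<noteq> 0 \<and> 2 * \<Delta> - \<Lambda> \<noteq> 0)
       \<and> has_sub_quot (K p) (Vmod4 p r \<Delta> (- 2 * \<Delta>) \<alpha>) (rev_parity (Vmod1 p r (\<Delta> + 1 / 2) \<alpha>)) (Vmod1 p r \<Delta> \<alpha>)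
       \<and> has_sub_quot (K p) (Vmod4 p r \<Delta> (2 * \<Delta>) \<alpha>) (rev_parity (Vmod2 p r (\<Delta> + 1 / 2) \<alpha>)) (Vmod2 p r \<Delta> \<alpha>)
       \<and> (simple_module (K p) (rev_parity (Vmod4 p r \<Delta> \<Lambda> \<alpha>)) \<longleftrightarrow> 2 * \<Delta> + \<Lambda> \<noteq> 0 \<and> 2 * \<Delta> - \<Lambda> \<noteq> 0)
       \<and> has_sub_quot (K p) (rev_parity (Vmod4 p r \<Delta> (- 2 * \<Delta>) \<alpha>)) (Vmod1 p r (\<Delta> + 1 / 2) \<alpha>) (rev_parity (Vmod1 p r \<Delta> \<alpha>))
       \<and> has_sub_quot (K p) (rev_parity (Vmod4 p r \<Delta> (2 * \<Delta>) \<alpha>)) (Vmod2 p r (\<Delta> + 1 / 2) \<alpha>) (rev_parity (Vmod2 p r \<Delta> \<alpha>))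
       \<and> multiplicity_one (K p) (Vmod4 p r \<Delta> \<Lambda> \<alpha>)
       \<and> multiplicity_one (K p) (rev_parity (Vmod4 p r \<Delta> \<Lambda> \<alpha>))
       \<and> (\<Delta> \<noteq> 0 \<and> \<Delta> \<noteq> - 1 / 2 \<longrightarrow>
         composition_factors_are (K p) (Vmod4 p r \<Delta> (- 2 * \<Delta>) \<alpha>)
           [conf_iso (K p) (Vmod1 p r \<Delta> \<alpha>),
            conf_iso (K p) (rev_parity (Vmod1 p r (\<Delta> + 1 / 2) \<alpha>))])
       \<and> (\<Delta> = 0 \<longrightarrow>
         composition_factors_are (K p) (Vmod4 p r \<Delta> (- 2 * \<Delta>) \<alpha>)
           [conf_iso (K p) (rev_parity (Vmod1 p r (1 / 2) \<alpha>)),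
            conf_iso (K p) (rev_parity (Vmod2 p r (1 / 2) \<alpha>)),
            conf_iso (K p) (triv_conf (- \<alpha>))])
       \<and> (\<Delta> = - 1 / 2 \<longrightarrow>
         composition_factors_are (K p) (Vmod4 p r \<Delta> (- 2 * \<Delta>) \<alpha>)
           [conf_iso (K p) (Vmod1 p r (- 1 / 2) \<alpha>),
            conf_iso (K p) (Vmod2 p r (1 / 2) \<alpha>),
            conf_iso (K p) (rev_parity (triv_conf (- \<alpha>)))])
       \<and> (\<Delta> \<noteq> 0 \<and> \<Delta> \<noteq> - 1 / 2 \<longrightarrow>
         composition_factors_are (K p) (Vmod4 p r \<Delta> (2 * \<Delta>) \<alpha>)
           [conf_iso (K p) (Vmod2 p r \<Delta> \<alpha>),
            conf_iso (K p) (rev_parity (Vmod2 p r (\<Delta> + 1 / 2) \<alpha>))])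
       \<and> (\<Delta> = 0 \<longrightarrow>
         composition_factors_are (K p) (Vmod4 p r \<Delta> (2 * \<Delta>) \<alpha>)
           [conf_iso (K p) (rev_parity (Vmod1 p r (1 / 2) \<alpha>)),
            conf_iso (K p) (rev_parity (Vmod2 p r (1 / 2) \<alpha>)),
            conf_iso (K p) (triv_conf (- \<alpha>))])
       \<and> (\<Delta> = - 1 / 2 \<longrightarrow>
         composition_factors_are (K p) (Vmod4 p r \<Delta> (2 * \<Delta>) \<alpha>)
           [conf_iso (K p) (Vmod1 p r (1 / 2) \<alpha>),
            conf_iso (K p) (Vmod2 p r (- 1 / 2) \<alpha>),
            conf_iso (K p) (rev_parity (triv_conf (- \<alpha>)))]))
     \<and> (p = - 1 \<longrightarrow>
         (simple_module (K (- 1)) (Vmod4b r \<Delta> \<Lambda> \<alpha> \<beta>) \<longleftrightarrow> (2 * \<Delta> + \<Lambda>, \<beta>) \<noteq> (0, 0) \<and> (2 * \<Delta> - \<Lambda>, \<beta>) \<noteq> (0, 0))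
       \<and> has_sub_quot (K (- 1)) (Vmod4b r \<Delta> (- 2 * \<Delta>) \<alpha> 0) (rev_parity (Vmod1 (- 1) r (\<Delta> + 1 / 2) \<alpha>)) (Vmod1 (- 1) r \<Delta> \<alpha>)
       \<and> has_sub_quot (K (- 1)) (Vmod4b r \<Delta> (2 * \<Delta>) \<alpha> 0) (rev_parity (Vmod2 (- 1) r (\<Delta> + 1 / 2) \<alpha>)) (Vmod2 (- 1) r \<Delta> \<alpha>)
       \<and> (simple_module (K (- 1)) (rev_parity (Vmod4b r \<Delta> \<Lambda> \<alpha> \<beta>)) \<longleftrightarrow> (2 * \<Delta> + \<Lambda>, \<beta>) \<noteq> (0, 0) \<and> (2 * \<Delta> - \<Lambda>, \<beta>) \<noteq> (0, 0))
       \<and> has_sub_quot (K (- 1)) (rev_parity (Vmod4b r \<Delta> (- 2 * \<Delta>) \<alpha> 0)) (Vmod1 (- 1) r (\<Delta> + 1 / 2) \<alpha>) (rev_parity (Vmod1 (- 1) r \<Delta> \<alpha>))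
       \<and> has_sub_quot (K (- 1)) (rev_parity (Vmod4b r \<Delta> (2 * \<Delta>) \<alpha> 0)) (Vmod2 (- 1) r (\<Delta> + 1 / 2) \<alpha>) (rev_parity (Vmod2 (- 1) r \<Delta> \<alpha>))
       \<and> multiplicity_one (K (- 1)) (Vmod4b r \<Delta> \<Lambda> \<alpha> \<beta>)
       \<and> multiplicity_one (K (- 1)) (rev_parity (Vmod4b r \<Delta> \<Lambda> \<alpha> \<beta>))
       \<and> (\<Delta> \<noteq> 0 \<and> \<Delta> \<noteq> - 1 / 2 \<longrightarrow>
         composition_factors_are (K (- 1)) (Vmod4b r \<Delta> (- 2 * \<Delta>) \<alpha> 0)
           [conf_iso (K (- 1)) (Vmod1 (- 1) r \<Delta> \<alpha>),
            conf_iso (K (- 1)) (rev_parity (Vmod1 (- 1) r (\<Delta> + 1 / 2) \<alpha>))])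
       \<and> (\<Delta> = 0 \<longrightarrow>
         composition_factors_are (K (- 1)) (Vmod4b r \<Delta> (- 2 * \<Delta>) \<alpha> 0)
           [conf_iso (K (- 1)) (rev_parity (Vmod1 (- 1) r (1 / 2) \<alpha>)),
            conf_iso (K (- 1)) (rev_parity (Vmod2 (- 1) r (1 / 2) \<alpha>)),
            conf_iso (K (- 1)) (triv_conf (- \<alpha>))])
       \<and> (\<Delta> = - 1 / 2 \<longrightarrow>
         composition_factors_are (K (- 1)) (Vmod4b r \<Delta> (- 2 * \<Delta>) \<alpha> 0)
           [conf_iso (K (- 1)) (Vmod1 (- 1) r (- 1 / 2) \<alpha>),
            conf_iso (K (- 1)) (Vmod2 (- 1) r (1 / 2) \<alpha>),
            conf_iso (K (- 1)) (rev_parity (triv_conf (- \<alpha>)))])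
       \<and> (\<Delta> \<noteq> 0 \<and> \<Delta> \<noteq> - 1 / 2 \<longrightarrow>
         composition_factors_are (K (- 1)) (Vmod4b r \<Delta> (2 * \<Delta>) \<alpha> 0)
           [conf_iso (K (- 1)) (Vmod2 (- 1) r \<Delta> \<alpha>),
            conf_iso (K (- 1)) (rev_parity (Vmod2 (- 1) r (\<Delta> + 1 / 2) \<alpha>))])
       \<and> (\<Delta> = 0 \<longrightarrow>
         composition_factors_are (K (- 1)) (Vmod4b r \<Delta> (2 * \<Delta>) \<alpha> 0)
           [conf_iso (K (- 1)) (rev_parity (Vmod1 (- 1) r (1 / 2) \<alpha>)),
            conf_iso (K (- 1)) (rev_parity (Vmod2 (- 1) r (1 / 2) \<alpha>)),
            conf_iso (K (- 1)) (triv_conf (- \<alpha>))])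
       \<and> (\<Delta> = - 1 / 2 \<longrightarrow>
         composition_factors_are (K (- 1)) (Vmod4b r \<Delta> (2 * \<Delta>) \<alpha> 0)
           [conf_iso (K (- 1)) (Vmod1 (- 1) r (1 / 2) \<alpha>),
            conf_iso (K (- 1)) (Vmod2 (- 1) r (- 1 / 2) \<alpha>),
            conf_iso (K (- 1)) (rev_parity (triv_conf (- \<alpha>)))]))"
proof (cases "p = - 1")
  case False
  note facts = simple_module_Vmod4_iff[OF assms] has_sub_quot_Vmod4[OF assms]
    trans[OF simple_module_rev_parity simple_module_Vmod4_iff[OF assms]]
    multiplicity_one_Vmod4[OF assms] multiplicity_one_rev_parity[OF multiplicity_one_Vmod4[OF assms]]
    composition_factors_Vmod4_1[OF assms] composition_factors_Vmod4_2[OF assms]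
  show ?thesis
    by (intro conjI impI; (erule notE[OF False])?; (elim conjE)?; hypsubst?; rule facts; assumption)
next
  case True
  then have p: "(- 1 :: complex) \<noteq> 0" "r\<^sup>2 = - 1" using assms(2) by simp_all
  \<comment> \<open>Folding \<open>Vmod4b_0\<close> reads the facts about the first family at
    \<open>p = - 1\<close> as facts about the second family at \<open>\<beta> = 0\<close>;
    simplicity and multiplicity one, where \<open>\<beta>\<close> is arbitrary, come from the lemmas
    for \<open>Vmod4b\<close>.\<close>
  note facts = simple_module_Vmod4b_iff[OF p(2)] has_sub_quot_Vmod4[OF p, folded Vmod4b_0]
    trans[OF simple_module_rev_parity simple_module_Vmod4b_iff[OF p(2)]]
    multiplicity_one_Vmod4b[OF p(2)] multiplicity_one_rev_parity[OF multiplicity_one_Vmod4b[OF p(2)]]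
    composition_factors_Vmod4_1[OF p, folded Vmod4b_0] composition_factors_Vmod4_2[OF p, folded Vmod4b_0]
  show ?thesis
    by (intro conjI impI; (erule notE[OF _ True])?; (elim conjE)?; hypsubst?; rule facts; assumption)
qed

end
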